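(* Consider Algorithm MA-OSEA (described in the context) with mixing parameter $\gamma$ and step sizes $\eta_t$. Suppose Assumptions (A1), (A2), (A3), (A5) of the context hold, $\|\cdot\|$ is the $\ell_1$ norm, and each set function $f_t:2^{\mathcal V}\to\mathbb R_+$ is monotone submodular with curvature $c$ (with $f_t(\emptyset)=0$). Then, with $\alpha=\frac{1-e^{-c}}{c}$, $$\mathbb E\Big(\alpha\sum_{t=1}^{T}f_t(\mathcal A_t^* )-\sum_{t=1}^{T}f_t\big(\cup_{i\in\mathcal N}\{a_{t,i}\}\big)\Big)\le C_1\Big(\sum_{t=1}^{T}\sum_{\tau=1}^{t}(\beta-\beta\gamma)^{t-\tau}\eta_\tau\Big)+\frac{NC_2}{\eta_{T+1}}+C_2\sum_{t=1}^{T}\frac{|\mathcal A_{t+1}^*\,\Delta\,\mathcal A_t^*|}{\eta_{t+1}}+\frac{NG}{2}\sum_{t=1}^{T}\eta_t+\sum_{t=1}^T\frac{C_3}{\eta_t}+GD\gamma ,$$ where $\mathcal A_t^*$ is any maximizer of $f_t(\mathcal A)$ subject to $|\mathcal A\cap\mathcal V_i|\le1$ for all $i\in\mathcal N$, $\Delta$ is the symmetric difference of two sets, $C_1=(4G^2+LDG)N^{3/2}$, $C_2=N\log(\frac n\gamma)$, $C_3=2N^2\gamma$, $D=\sup_{\mathbf x,\mathbf y\in\mathcal C}\|\mathbf x-\mathbf y\|_1$, $\mathcal C=\{\mathbf x\in[0,1]^n:\sum_{a\in\mathcal V_i}x_a\le1\ \forall i\in\mathcal N\}$, and $\beta=\max(|\lambda_2(\mathbf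 W)|,|\lambda_N(\mathbf W)|)$. The expectation is over the internal randomness of the algorithm.
   Context: **Problem.** $\mathcal N=\{1,\dots,N\}$ is a set of agents; agent $i$ has a finite action set $\mathcal V_i$, with the $\mathcal V_i$ pairwise disjoint; $\mathcal V=\cup_i\mathcal V_i=\{1,\dots,n\}$. A sequence of set functions $f_t:2^{\mathcal V}\to\mathbb R_+$ is given; at round $t\in\{1,\dots,T\}$ each agent $i$ chooses $a_{t,i}\in\mathcal V_i$, after which $f_t$ is revealed. ($\mathcal A^*_{T+1}$ and $\eta_{T+1}$ refer to a further function $f_{T+1}$ and a further step size of the respective sequences.) $f$ is submodular if $f(S\cup\{e\})-f(S)\ge f(T'\cup\{e\})-f(T')$ for $S\subseteq T'\subseteq\mathcal V$, $e\in\mathcal V\setminus T'$; monotone if $f(S)\le f(T')$ for $S\subseteq T'$. Its curvature is $c=1-\min_{S\subseteq\mathcal V,e\notin S}\frac{f(S\cup\{e\})-f(S)}{f(\{e\})}\in[0,1]$. For $c=0$, $\frac{1-e^{-c}}{c}$ means $1$. **Multi-linear extension and surrogate gradient.** $F_t(\mathbf x)=\sum_{\mathcal A\subseteq\mathcal V}f_t(\mathcal A)\prod_{a\in\mathcal A}x_a\prod_{a\notin\mathcal A}(1-x_a)$ on $[0,1]^n$, and $\nabla F_t^s(\mathbf x)=\int_0^1e^{c(z-1)}\nabla F_t(z\mathbf x)\,dz$. Stochastic gradient $\widetilde\nabla F_t^s(\mathbf x)$: sample $z\in[0,1]$ from the random variable $\mathcal Z$ with $P(\mathcal Z\le b)=\frac{e^{c(b-1)}-e^{-c}}{1-e^{-c}}$,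 $b\in[0,1]$ (uniform if $c=0$), then a random set $\mathcal R\subseteq\mathcal V$ containing each $a$ independently with probability $zx_a$, and set $[\widetilde\nabla F_t^s(\mathbf x)]_a=\frac{1-e^{-c}}{c}\big(f_t(\mathcal R\cup\{a\})-f_t(\mathcal R\setminus\{a\})\big)$. **Algorithm MA-OSEA.** Agents communicate over an undirected graph on $\mathcal N$; $\mathcal N_i$ is the set of neighbours of $i$; $\mathbf W=[w_{ij}]\in\mathbb R^{N\times N}$ is a weight matrix with $w_{ij}=0$ for $j\notin\mathcal N_i\cup\{i\}$; $\mathbf 1_n$ is the all-ones vector. Initialize $[\mathbf x_{1,i}]_j=1/|\mathcal V_i|$ for $j\in\mathcal V_i$ and $0$ otherwise. For $t=1,\dots,T$, each agent $i$: (1) separately draws $a_{t,i}\in\mathcal V_i$ with $P(a_{t,i}=a)=[\mathbf x_{t,i}]_a/\sum_{a'\in\mathcal V_i}[\mathbf x_{t,i}]_{a'}$; (2) mixes in a uniform distribution, $\hat{\mathbf x}_{t,i}=(1-\gamma)\mathbf x_{t,i}+\frac\gamma n\mathbf 1_n$, and sets $\mathbf y_{t,i}=\sum_{j\in\mathcal N_i\cup\{i\}}w_{ij}\hat{\mathbf x}_{t,j}$; (3) samples and computes $[\widetilde\nabla F_t^s(\mathbf x_{t,i})]_a$ for $a\in\mathcal V_i$; (4) sets $[\mathbf x_{t+1,i}]_a=[\mathbf y_{t,i}]_a$ for $a\notin\mathcal V_i$; (5) with $S=\sum_{a\in\mathcal V_i}[\mathbf y_{t,i}]_a\exp(\eta_t[\widetilde\nabla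 F_t^s(\mathbf x_{t,i})]_a)$, sets for $a\in\mathcal V_i$: $[\mathbf x_{t+1,i}]_a=[\mathbf y_{t,i}]_a\exp(\eta_t[\widetilde\nabla F_t^s(\mathbf x_{t,i})]_a)$ if $S\le1$, and this quantity divided by $S$ if $S>1$. **Assumptions** (with $\|\cdot\|=\|\cdot\|_1$, dual norm $\|\cdot\|_*=\|\cdot\|_\infty$; $\phi(\mathbf x)=\sum_{i=1}^nx_i\log x_i$; $\mathcal D_\phi(\mathbf x,\mathbf y)=\phi(\mathbf x)-\phi(\mathbf y)-\langle\nabla\phi(\mathbf y),\mathbf x-\mathbf y\rangle$). (A1) $\phi(\mathbf x)=\sum_{i=1}^ng(x_i)$ for a one-dimensional strongly convex differentiable function $g:[0,1]\to\mathbb R$ (here $g(x)=x\log x$). (A2) The graph is connected; $\mathbf W$ is symmetric and doubly stochastic with positive diagonal ($\mathbf W^T=\mathbf W$, $\mathbf W\mathbf 1_N=\mathbf 1_N$). (Its eigenvalues $1=\lambda_1(\mathbf W)\ge\dots\ge\lambda_N(\mathbf W)\ge-1$ then satisfy $\beta<1$.) (A3) For $\mathbf x,\mathbf y_1,\dots,\mathbf y_N\in[0,1]^n$ and weights $\alpha_i\ge0$ with $\sum_{i=1}^N\alpha_i=1$: $\mathcal D_\phi(\mathbf x,\sum_i\alpha_i\mathbf y_i)\le\sum_i\alpha_i\mathcal D_\phi(\mathbf x,\mathbf y_i)$. (A5) For every $t\in\{1,\dots,T\}$ and $\mathbf x\in[0,1]^n$: $\mathbb E(\widetilde\nabla F_t^s(\mathbf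 x)\mid\mathbf x)=\nabla F_t^s(\mathbf x)$, $\mathbb E(\|\widetilde\nabla F_t^s(\mathbf x)\|_*^2)\le G^2$, and $\|\nabla F_t^s(\mathbf x)-\nabla F_t^s(\mathbf y)\|_*\le L\|\mathbf x-\mathbf y\|$.
   Formalization: The step sizes are additionally assumed positive and non-increasing over rounds 1 to T+1 (the bound fails for increasing step sizes), with N ≥ 2, nonempty action sets, 0 < γ ≤ 1 and G ≥ 0 so that all quantities are defined. *)

theory Defs
  imports "HOL-Probability.Probability"
begin

text \<open>
  Conventions: the agents are the elements of a finite type \<open>'m\<close> (so the number of agents is
  \<open>CARD('m)\<close>), the ground set of actions is a finite type \<open>'n\<close> (so \<open>n = CARD('n)\<close>), and
  \<open>V i\<close> is the action set of agent \<open>i\<close>. The sets \<open>V i\<close> partition \<open>UNIV :: 'n set\<close>.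
\<close>

definition monotone_set_fun :: "('n set \<Rightarrow> real) \<Rightarrow> bool" where
  "monotone_set_fun f \<longleftrightarrow> (\<forall>S T. S \<subseteq> T \<longrightarrow> f S \<le> f T)"

definition submodular :: "('n set \<Rightarrow> real) \<Rightarrow> bool" where
  "submodular f \<longleftrightarrow>
     (\<forall>S T e. S \<subseteq> T \<longrightarrow> e \<notin> T \<longrightarrow> f (insert e S) - f S \<ge> f (insert e T) - f T)"

text \<open>
  The minimum runs over the pairs for which the quotient is defined. For a monotone submodular
  \<open>f\<close> with \<open>f {} = 0\<close>, an element with \<open>f {e} = 0\<close> has only zero marginal gains. If there
  are no other elements, \<open>f\<close> is the zero function, which is modular and gets curvature \<open>0\<close>.
\<close>

definition curvature :: "('n::finite set \<Rightarrow> real) \<Rightarrow> real" where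
  "curvature f =
     (if \<forall>e. f {e} = 0 then 0
      else 1 - Min {(f (insert e S) - f S) / f {e} | S e. e \<notin> S \<and> f {e} \<noteq> 0})"

definition curv_ratio :: "real \<Rightarrow> real" where
  "curv_ratio c = (if c = 0 then 1 else (1 - exp (- c)) / c)"


definition l1norm :: "real^'n \<Rightarrow> real" where
  "l1norm x = (\<Sum>a\<in>UNIV. \<bar>x $ a\<bar>)"

definition unit_cube :: "(real^'n) set" where
  "unit_cube = {x. \<forall>a. 0 \<le> x $ a \<and> x $ a \<le> 1}"

definition nabla :: "(real^'n \<Rightarrow> real) \<Rightarrow> real^'n \<Rightarrow> real^'n" where
  "nabla F x = (\<chi> a. frechet_derivative F (at x) (axis a 1))"

definition strongly_convex_on :: "real set \<Rightarrow> (real \<Rightarrow> real) \<Rightarrow> bool" where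
  "strongly_convex_on S g \<longleftrightarrow> (\<exists>\<mu>>0. convex_on S (\<lambda>u. g u - \<mu> / 2 * u\<^sup>2))"

text \<open>Note \<open>ln 0 = 0\<close> in HOL, so \<open>entropy_gen 0 = 0\<close>, the continuous extension.\<close>

definition entropy_gen :: "real \<Rightarrow> real" where
  "entropy_gen u = u * ln u"

definition entropy_map :: "real^'n \<Rightarrow> real" where
  "entropy_map x = (\<Sum>a\<in>UNIV. entropy_gen (x $ a))"

definition bregman :: "(real^'n \<Rightarrow> real) \<Rightarrow> real^'n \<Rightarrow> real^'n \<Rightarrow> real" where
  "bregman \<phi> x y = \<phi> x - \<phi> y - nabla \<phi> y \<bullet> (x - y)"


definition mlext :: "('n set \<Rightarrow> real) \<Rightarrow> real^'n \<Rightarrow> real" where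
  "mlext f x = (\<Sum>A\<in>UNIV. f A * (\<Prod>a\<in>A. x $ a) * (\<Prod>a\<in>- A. 1 - x $ a))"

definition surrogate_grad :: "real \<Rightarrow> ('n set \<Rightarrow> real) \<Rightarrow> real^'n \<Rightarrow> real^'n" where
  "surrogate_grad c f x =
     integral {0..1} (\<lambda>z. exp (c * (z - 1)) *\<^sub>R nabla (mlext f) (z *\<^sub>R x))"

definition Z_cdf :: "real \<Rightarrow> real \<Rightarrow> real" where
  "Z_cdf c b =
     (if b < 0 then 0 else if b > 1 then 1
      else if c = 0 then b else (exp (c * (b - 1)) - exp (- c)) / (1 - exp (- c)))"

definition Z_law :: "real \<Rightarrow> real measure" where
  "Z_law c = interval_measure (Z_cdf c)"

definition indep_set_pmf :: "real^'n \<Rightarrow> 'n set pmf" where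
  "indep_set_pmf p =
     map_pmf (\<lambda>b. {a. b a}) (Pi_pmf UNIV False (\<lambda>a. bernoulli_pmf (p $ a)))"

text \<open>
  First draw \<open>z\<close> from \<open>Z_law c\<close>, then a random set with inclusion probabilities \<open>z * x $ a\<close>.
  The variable \<open>z\<close> is continuous but is used only through the random set, whose law lives on a
  finite type, so the monadic composition is a \<open>pmf\<close>.
\<close>

definition sample_set_pmf :: "real \<Rightarrow> real^'n \<Rightarrow> 'n set pmf" where
  "sample_set_pmf c x =
     Abs_pmf (Z_law c \<bind> (\<lambda>z. measure_pmf (indep_set_pmf (z *\<^sub>R x))))"

definition stoch_grad_pmf :: "real \<Rightarrow> ('n set \<Rightarrow> real) \<Rightarrow> real^'n \<Rightarrow> (real^'n) pmf" where
  "stoch_grad_pmf c f x =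
     map_pmf (\<lambda>R. \<chi> a. curv_ratio c * (f (insert a R) - f (R - {a}))) (sample_set_pmf c x)"


definition doubly_stochastic :: "real^'m^'m \<Rightarrow> bool" where
  "doubly_stochastic W \<longleftrightarrow>
     (\<forall>i j. W $ i $ j \<ge> 0) \<and> (\<forall>i. (\<Sum>j\<in>UNIV. W $ i $ j) = 1) \<and> (\<forall>j. (\<Sum>i\<in>UNIV. W $ i $ j) = 1)"

definition charpoly :: "real^'m^'m \<Rightarrow> real poly" where
  "charpoly W = det (\<chi> i j. (if i = j then [:0, 1:] else 0) - [:W $ i $ j:])"

text \<open>
  The \<open>k\<close>-th largest eigenvalue, \<open>k = 1, \<dots>, CARD('m)\<close>, counted with multiplicity; meant for
  symmetric \<open>W\<close>, where the characteristic polynomial has \<open>CARD('m)\<close> real roots.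
\<close>

definition nth_eigenvalue :: "real^'m^'m \<Rightarrow> nat \<Rightarrow> real" where
  "nth_eigenvalue W k = rev (sorted_list_of_multiset (proots (charpoly W))) ! (k - 1)"

definition mixing_rate :: "real^'m^'m \<Rightarrow> real" where
  "mixing_rate W = max \<bar>nth_eigenvalue W 2\<bar> \<bar>nth_eigenvalue W CARD('m)\<bar>"


definition feasible :: "('m \<Rightarrow> 'n set) \<Rightarrow> (real^'n) set" where
  "feasible V = {x \<in> unit_cube. \<forall>i. (\<Sum>a\<in>V i. x $ a) \<le> 1}"

definition l1_diameter :: "(real^'n) set \<Rightarrow> real" where
  "l1_diameter C = Sup {l1norm (x - y) | x y. x \<in> C \<and> y \<in> C}"

definition x_init :: "('m \<Rightarrow> 'n set) \<Rightarrow> 'm \<Rightarrow> real^'n" where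
  "x_init V i = (\<chi> j. if j \<in> V i then 1 / real (card (V i)) else 0)"

definition action_pmf :: "'n set \<Rightarrow> real^'n \<Rightarrow> 'n pmf" where
  "action_pmf A x = embed_pmf (\<lambda>a. if a \<in> A then x $ a / (\<Sum>a'\<in>A. x $ a') else 0)"

definition x_hat :: "real \<Rightarrow> real^'n \<Rightarrow> real^'n" where
  "x_hat \<gamma> x = (1 - \<gamma>) *\<^sub>R x + (\<gamma> / real CARD('n)) *\<^sub>R vec 1"

definition y_mix ::
  "('m \<Rightarrow> 'm \<Rightarrow> bool) \<Rightarrow> real^'m^'m \<Rightarrow> real \<Rightarrow> ('m \<Rightarrow> real^'n) \<Rightarrow> 'm \<Rightarrow> real^'n" where
  "y_mix nbr W \<gamma> x i = (\<Sum>j\<in>{j. nbr i j} \<union> {i}. (W $ i $ j) *\<^sub>R x_hat \<gamma> (x j))"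

definition exp_update :: "'n set \<Rightarrow> real \<Rightarrow> real^'n \<Rightarrow> real^'n \<Rightarrow> real^'n" where
  "exp_update A h y g =
     (let S = (\<Sum>a\<in>A. y $ a * exp (h * g $ a))
      in (\<chi> a. if a \<notin> A then y $ a
               else if S \<le> 1 then y $ a * exp (h * g $ a)
               else y $ a * exp (h * g $ a) / S))"

text \<open>
  Joint law, after \<open>t\<close> rounds, of the actions (\<open>acts s i\<close> is the action of agent \<open>i\<close> in round
  \<open>s\<close> for \<open>1 \<le> s \<le> t\<close>) and of the vectors \<open>x i\<close> that the agents hold at the start of round
  \<open>Suc t\<close>. Within a round, all draws are independent given the current vectors.
\<close>

primrec ma_osea ::
  "('m \<Rightarrow> 'm \<Rightarrow> bool) \<Rightarrow> real^'m^'m \<Rightarrow> ('m \<Rightarrow> 'n set) \<Rightarrow> (nat \<Rightarrow> 'n set \<Rightarrow> real) \<Rightarrow> real \<Rightarrow> real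
     \<Rightarrow> (nat \<Rightarrow> real) \<Rightarrow> nat \<Rightarrow> ((nat \<Rightarrow> 'm \<Rightarrow> 'n) \<times> ('m \<Rightarrow> real^'n)) pmf" where
  "ma_osea nbr W V f c \<gamma> \<eta> 0 = return_pmf (\<lambda>_ _. undefined, x_init V)"
| "ma_osea nbr W V f c \<gamma> \<eta> (Suc t) =
     bind_pmf (ma_osea nbr W V f c \<gamma> \<eta> t) (\<lambda>(acts, x).
     bind_pmf (Pi_pmf UNIV undefined (\<lambda>i. action_pmf (V i) (x i))) (\<lambda>a.
     bind_pmf (Pi_pmf UNIV 0 (\<lambda>i. stoch_grad_pmf c (f (Suc t)) (x i))) (\<lambda>g.
     return_pmf
       (acts(Suc t := a), \<lambda>i. exp_update (V i) (\<eta> (Suc t)) (y_mix nbr W \<gamma> x i) (g i)))))"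

end

theory Submission
  imports Defs
begin

text \<open>
  The surrogate gradient satisfies
  \<open>\<langle>\<nabla>F\<^sup>s x, 1\<^sub>A - x\<rangle> \<ge> \<alpha> f A - F x\<close>, so the regret is bounded by linear regret. Each agent
  performs an exponentiated gradient step on its own block; summed over the agents, the Bregman
  divergence to the comparator does not grow under mixing, by convexity and double stochasticity,
  except for a term of order \<open>\<gamma>\<close>. Since only the owner of an action perturbs the corresponding
  column of the matrix of vectors, the disagreement contracts by \<open>\<beta> (1 - \<gamma>)\<close> per round up to the
  owners' steps, whose \<open>l\<^sub>1\<close> norm is at most \<open>\<eta> G\<close>.

  The initial vectors disagree by \<open>N\<close>, which contributes a geometric sum that does not appear in the
  bound. It is absorbed as follows. A round costs at most \<open>N G\<close>, so the bound is trivial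
  unless \<open>\<gamma>\<close> is small and \<open>G T \<eta>\<close> at time \<open>T + 1\<close> exceeds \<open>N ln (n / \<gamma>)\<close>. In the remaining case the
  slack in the constant \<open>C\<^sub>1\<close> covers it, because \<open>L\<close> may be replaced by \<open>min L G\<close>.
\<close>

text \<open>Assumption (A5) bounds only a second moment, while the exponentiated step and the
  consensus recursion need a sure bound. It comes from the point 0: there the surrogate gradient has
  the entries \<open>curv_ratio c * f {a}\<close>, so unbiasedness forces these to be at most G. By
  submodularity a singleton value dominates every marginal gain of its element. Hence all sampled
  gradients lie in [0, G], and the surrogate gradient is itself G-Lipschitz, which is why
  \<open>min L G\<close> is available. The initial vectors vanish off the owner's block, so their
  divergence from a comparator can be infinite. The potential is therefore evaluated only at mixed
  vectors, whose entries are at least \<gamma> / n; this is the origin of ln (n / \<gamma>).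
  Disagreement is a sum over actions, to match l1 distances, of Euclidean norms over agents, where
  the spectral contraction acts. The estimates yield the coefficients (5 N + 1) G^2 and sqrt 2 N K D
  G; for N \<ge> 2 both fit under the N^(3/2) of \<open>C1\<close>.\<close>

definition marginal :: "('n set \<Rightarrow> real) \<Rightarrow> 'n \<Rightarrow> 'n set \<Rightarrow> real" where
  "marginal h b R = h (insert b R) - h (R - {b})"

definition set_coord :: "'n \<Rightarrow> real \<Rightarrow> real^'n \<Rightarrow> real^'n" where
  "set_coord b s x = (\<chi> a. if a = b then s else x $ a)"

text \<open>Interpolates between \<open>x\<close> and \<open>y\<close>, so that the passage from one
  to the other can be made one coordinate at a time by induction on \<open>U\<close>.\<close>

definition replace_on :: "'n set \<Rightarrow> real^'n \<Rightarrow> real^'n \<Rightarrow> real^'n" where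
  "replace_on U y x = (\<chi> a. if a \<in> U then y $ a else x $ a)"

definition indicator_vec :: "'n set \<Rightarrow> real^'n" where
  "indicator_vec A = (\<chi> a. if a \<in> A then 1 else 0)"

lemma set_coord_nth [simp]: "set_coord b s x $ a = (if a = b then s else x $ a)"
  by (simp add: set_coord_def)

lemma replace_on_nth [simp]: "replace_on U y x $ a = (if a \<in> U then y $ a else x $ a)"
  by (simp add: replace_on_def)

lemma indicator_vec_nth [simp]: "indicator_vec A $ a = (if a \<in> A then 1 else 0)"
  by (simp add: indicator_vec_def)

lemma unit_cubeD: "x \<in> unit_cube \<Longrightarrow> 0 \<le> x $ a" "x \<in> unit_cube \<Longrightarrow> x $ a \<le> 1"
  by (auto simp: unit_cube_def)

lemma replace_on_insert:
  "replace_on (insert b U) y x = set_coord b (y $ b) (replace_on U y x)"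
  by (auto simp: vec_eq_iff)

lemma replace_on_UNIV [simp]: "replace_on UNIV y x = y"
  by (simp add: vec_eq_iff)

lemma replace_on_empty [simp]: "replace_on {} y x = x"
  by (simp add: vec_eq_iff)

lemma replace_on_unit_cube:
  "x \<in> unit_cube \<Longrightarrow> y \<in> unit_cube \<Longrightarrow> replace_on U y x \<in> unit_cube"
  by (auto simp: unit_cube_def)

lemma scaleR_unit_cube:
  assumes "x \<in> unit_cube" "z \<in> {0..1}"
  shows "z *\<^sub>R x \<in> unit_cube"
  using assms by (auto simp: unit_cube_def intro: mult_le_one)

section \<open>The multilinear extension\<close>

lemma mlext_add: "mlext (\<lambda>A. h A + k A) x = mlext h x + mlext k (x :: real^'n::finite)"
  by (simp add: mlext_def algebra_simps sum.distrib)

lemma mlext_diff: "mlext (\<lambda>A. h A - k A) x = mlext h x - mlext k (x :: real^'n::finite)"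
  by (simp add: mlext_def algebra_simps sum_subtractf)

lemma mlext_cmult: "mlext (\<lambda>A. r * h A) x = r * mlext h (x :: real^'n::finite)"
  by (simp add: mlext_def algebra_simps sum_distrib_left)

lemma mlext_sum:
  "finite I \<Longrightarrow> mlext (\<lambda>A. \<Sum>i\<in>I. h i A) x = (\<Sum>i\<in>I. mlext (h i) (x :: real^'n::finite))"
  by (induction rule: finite_induct) (simp_all add: mlext_add, simp add: mlext_def)

lemma mlext_const: "mlext (\<lambda>_. r) x = (r :: real)" for x :: "real^'n::finite"
proof -
  have "(\<Prod>a\<in>UNIV. x $ a + (1 - x $ a))
      = (\<Sum>A\<in>Pow UNIV. (\<Prod>a\<in>A. x $ a) * (\<Prod>a\<in>UNIV - A. 1 - x $ a))"
    by (rule prod_add) simp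
  then have "(\<Sum>A\<in>UNIV. (\<Prod>a\<in>A. x $ a) * (\<Prod>a\<in>- A. 1 - x $ a)) = 1"
    by (simp add: Compl_eq_Diff_UNIV)
  then have "r * (\<Sum>A\<in>UNIV. (\<Prod>a\<in>A. x $ a) * (\<Prod>a\<in>- A. 1 - x $ a)) = r"
    by simp
  then show ?thesis
    by (simp add: mlext_def sum_distrib_left mult.assoc)
qed

lemma mlext_mono:
  fixes x :: "real^'n::finite"
  assumes "\<And>A. h A \<le> k A" "x \<in> unit_cube"
  shows "mlext h x \<le> mlext k x"
  unfolding mlext_def
  by (intro sum_mono mult_right_mono prod_nonneg assms)
     (auto simp: unit_cubeD[OF assms(2)])

lemma mlext_nonneg:
  fixes x :: "real^'n::finite"
  assumes "\<And>A. 0 \<le> h A" "x \<in> unit_cube"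
  shows "0 \<le> mlext h x"
  using mlext_mono[of "\<lambda>_. 0" h x] assms by (simp add: mlext_const)

lemma mlext_abs_le:
  fixes x :: "real^'n::finite"
  assumes "\<And>A. \<bar>h A\<bar> \<le> M" "x \<in> unit_cube"
  shows "\<bar>mlext h x\<bar> \<le> M"
proof -
  have "mlext h x \<le> M"
    using mlext_mono[of h "\<lambda>_. M" x] assms by (simp add: mlext_const abs_le_iff)
  moreover have "- M \<le> mlext h x"
    using mlext_mono[of "\<lambda>_. - M" h x] assms by (simp add: mlext_const abs_le_iff minus_le_iff)
  ultimately show ?thesis by simp
qed

text \<open>Expected value of \<open>h\<close> over a random set drawn without \<open>b\<close>;
  coordinate \<open>b\<close> of \<open>x\<close> does not enter.\<close>

definition mlext_off :: "'n \<Rightarrow> ('n set \<Rightarrow> real) \<Rightarrow> real^'n \<Rightarrow> real" where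
  "mlext_off b h x = (\<Sum>A | b \<notin> A. h A * (\<Prod>a\<in>A. x $ a) * (\<Prod>a\<in>- A - {b}. 1 - x $ a))"

text \<open>Conditioning on whether \<open>b\<close> belongs to the random set.\<close>

lemma mlext_split:
  fixes x :: "real^'n::finite"
  shows "mlext h x = (1 - x $ b) * mlext_off b h x + x $ b * mlext_off b (\<lambda>A. h (insert b A)) x"
proof -
  let ?t = "\<lambda>A. h A * (\<Prod>a\<in>A. x $ a) * (\<Prod>a\<in>- A. 1 - x $ a)"
  have U: "UNIV = {A. b \<notin> A} \<union> insert b ` {A. b \<notin> A}"
  proof -
    have "A = insert b (A - {b})" if "b \<in> A" for A using that by blast
    then show ?thesis by (auto intro!: image_eqI[of _ "insert b" "_ - {b}"])
  qed
  have "mlext h x = (\<Sum>A\<in>{A. b \<notin> A} \<union> insert b ` {A. b \<notin> A}. ?t A)"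
    unfolding mlext_def by (subst U[symmetric]) (rule refl)
  also have "\<dots> = (\<Sum>A | b \<notin> A. ?t A) + (\<Sum>A\<in>insert b ` {A. b \<notin> A}. ?t A)"
    by (rule sum.union_disjoint) auto
  also have "(\<Sum>A\<in>insert b ` {A. b \<notin> A}. ?t A) = (\<Sum>A | b \<notin> A. ?t (insert b A))"
    by (subst sum.reindex) (auto simp: inj_on_def)
  also have "\<dots> = x $ b * mlext_off b (\<lambda>A. h (insert b A)) x"
    unfolding mlext_off_def sum_distrib_left
  proof (rule sum.cong, rule refl)
    fix A assume "A \<in> {A. b \<notin> A}"
    moreover have "- insert b A = - A - {b}" by auto
    ultimately show "?t (insert b A) = x $ b * (h (insert b A) * (\<Prod>a\<in>A. x $ a) * (\<Prod>a\<in>- A - {b}. 1 - x $ a))"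
      by simp
  qed
  also have "(\<Sum>A | b \<notin> A. ?t A) = (1 - x $ b) * mlext_off b h x"
    unfolding mlext_off_def sum_distrib_left
  proof (rule sum.cong, rule refl)
    fix A assume "A \<in> {A. b \<notin> A}"
    then have "(\<Prod>a\<in>- A. 1 - x $ a) = (1 - x $ b) * (\<Prod>a\<in>- A - {b}. 1 - x $ a)"
      by (intro prod.remove) auto
    then show "?t A = (1 - x $ b) * (h A * (\<Prod>a\<in>A. x $ a) * (\<Prod>a\<in>- A - {b}. 1 - x $ a))"
      by simp
  qed
  finally show ?thesis .
qed

lemma mlext_marginal:
  fixes x :: "real^'n::finite"
  shows "mlext (marginal h b) x = mlext_off b (\<lambda>A. h (insert b A)) x - mlext_off b h x"
proof -
  have 1: "mlext_off b (marginal h b) x = mlext_off b (\<lambda>A. h (insert b A)) x - mlext_off b h x"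
    unfolding mlext_off_def marginal_def by (simp flip: sum_subtractf add: algebra_simps)
  have 2: "mlext_off b (\<lambda>A. marginal h b (insert b A)) x
      = mlext_off b (\<lambda>A. h (insert b A)) x - mlext_off b h x"
    unfolding mlext_off_def marginal_def by (simp flip: sum_subtractf add: algebra_simps)
  show ?thesis
    by (subst mlext_split[of _ _ b]) (simp add: 1 2 algebra_simps)
qed

lemma mlext_off_set_coord:
  fixes x :: "real^'n::finite"
  shows "mlext_off b h (set_coord b s x) = mlext_off b h x"
  unfolding mlext_off_def
  by (rule sum.cong[OF refl], intro arg_cong2[where f = "(*)"] prod.cong refl) auto

text \<open>\<open>mlext h\<close> is affine in each coordinate, and the slope does not involve that
  coordinate, because \<open>marginal h b\<close> agrees on sets that differ only in
  \<open>b\<close>. The comparisons of two points below apply this to one coordinate after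
  another.\<close>

lemma mlext_set_coord:
  fixes x :: "real^'n::finite"
  shows "mlext h (set_coord b s x) = mlext h x + (s - x $ b) * mlext (marginal h b) x"
  by (simp add: mlext_split[of h _ b] mlext_off_set_coord mlext_marginal algebra_simps)

lemma mlext_indicator_vec: "mlext h (indicator_vec A) = h A" for A :: "'n::finite set"
proof -
  have "mlext h (indicator_vec A)
      = (\<Sum>B\<in>UNIV. if B = A then h A else 0)"
    unfolding mlext_def
  proof (rule sum.cong, rule refl)
    fix B :: "'n set"
    show "h B * (\<Prod>a\<in>B. indicator_vec A $ a) * (\<Prod>a\<in>- B. 1 - indicator_vec A $ a)
        = (if B = A then h A else 0)"
    proof (cases "B = A")
      case False
      then consider a where "a \<in> B" "a \<notin> A" | a where "a \<notin> B" "a \<in> A" by blast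
      then show ?thesis
      proof cases
        case 1
        then have "(\<Prod>a\<in>B. indicator_vec A $ a) = 0"
          by (intro prod_zero) (auto intro!: bexI[of _ a])
        then show ?thesis using False by simp
      next
        case 2
        then have "(\<Prod>a\<in>- B. 1 - indicator_vec A $ a) = 0"
          by (intro prod_zero) (auto intro!: bexI[of _ a])
        then show ?thesis using False by simp
      qed
    qed simp
  qed
  then show ?thesis by simp
qed

lemma mlext_zero: "mlext h 0 = h {}" for h :: "'n::finite set \<Rightarrow> real"
  using mlext_indicator_vec[of h "{}"] by (simp add: indicator_vec_def zero_vec_def)

text \<open>Since \<open>h\<close> takes values in [0, M], its marginals lie in [-M, M]; a bound on
  the absolute value of \<open>h\<close> alone would cost a factor 2.\<close>

lemma mlext_Lipschitz:
  fixes x y :: "real^'n::finite"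
  assumes h: "\<And>A. 0 \<le> h A" "\<And>A. h A \<le> M" and x: "x \<in> unit_cube" and y: "y \<in> unit_cube"
  shows "\<bar>mlext h x - mlext h y\<bar> \<le> M * l1norm (x - y)"
proof -
  have "\<bar>mlext h x - mlext h (replace_on U y x)\<bar> \<le> M * (\<Sum>a\<in>U. \<bar>x $ a - y $ a\<bar>)" for U
    using finite[of U]
  proof (induction rule: finite_induct)
    case (insert b U)
    let ?z = "replace_on U y x"
    have "\<bar>marginal h b A\<bar> \<le> M" for A
      unfolding marginal_def using h[of "insert b A"] h[of "A - {b}"] by auto
    then have "\<bar>mlext (marginal h b) ?z\<bar> \<le> M"
      by (intro mlext_abs_le replace_on_unit_cube x y)
    then have "\<bar>(y $ b - x $ b) * mlext (marginal h b) ?z\<bar> \<le> M * \<bar>x $ b - y $ b\<bar>"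
      unfolding abs_mult by (metis abs_ge_zero abs_minus_commute mult.commute mult_right_mono)
    moreover have "mlext h (replace_on (insert b U) y x)
        = mlext h ?z + (y $ b - x $ b) * mlext (marginal h b) ?z"
      using insert by (simp add: replace_on_insert mlext_set_coord)
    ultimately show ?case
      using insert by (simp add: algebra_simps)
  qed simp
  from this[of UNIV] show ?thesis
    by (simp add: l1norm_def)
qed

lemma mlext_antimono:
  fixes x y :: "real^'n::finite"
  assumes h: "\<And>A B. A \<subseteq> B \<Longrightarrow> h B \<le> h A"
    and x: "x \<in> unit_cube" and y: "y \<in> unit_cube" and le: "\<And>a. x $ a \<le> y $ a"
  shows "mlext h y \<le> mlext h x"
proof -
  have "mlext h (replace_on U y x) \<le> mlext h x" for U
    using finite[of U]
  proof (induction rule: finite_induct)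
    case (insert b U)
    let ?z = "replace_on U y x"
    have "marginal h b A \<le> 0" for A
      using h[of "A - {b}" "insert b A"] unfolding marginal_def by auto
    then have "mlext (marginal h b) ?z \<le> 0"
      using mlext_mono[of "marginal h b" "\<lambda>_. 0" ?z] replace_on_unit_cube[OF x y]
      by (simp add: mlext_const)
    then have "(y $ b - x $ b) * mlext (marginal h b) ?z \<le> 0"
      using le[of b] by (simp add: mult_nonneg_nonpos)
    then show ?case
      using insert by (simp add: replace_on_insert mlext_set_coord)
  qed simp
  from this[of UNIV] show ?thesis by simp
qed

section \<open>Derivative of the multilinear extension\<close>

lemma differentiable_mlext: "mlext h differentiable (at x)" for x :: "real^'n::finite"
proof -
  have "(\<lambda>x. \<Prod>a\<in>A. k a (x $ a)) differentiable (at x)"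
    if "\<And>a. (\<lambda>x. k a (x $ a)) differentiable (at x)" for A :: "'n set" and k :: "'n \<Rightarrow> real \<Rightarrow> real"
    using finite[of A] by (induction rule: finite_induct) (auto intro!: differentiable_mult that)
  from this[of "\<lambda>_ u. u"] this[of "\<lambda>_ u. 1 - u"]
  have "(\<lambda>x. \<Prod>a\<in>A. x $ a) differentiable (at x)" "(\<lambda>x. \<Prod>a\<in>A. 1 - x $ a) differentiable (at x)"
    for A :: "'n set"
    by (auto simp: differentiable_def intro!: exI derivative_eq_intros
        bounded_linear.has_derivative[OF bounded_linear_vec_nth])
  then show ?thesis
    unfolding mlext_def[abs_def] by (intro differentiable_sum differentiable_mult) auto
qed

lemma nabla_mlext: "nabla (mlext h) x $ a = mlext (marginal h a) x" for x :: "real^'n::finite"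
proof -
  let ?F = "mlext h"
  have "(?F has_derivative frechet_derivative ?F (at x)) (at (x + 0 *\<^sub>R axis a 1))"
    using differentiable_mlext[of h x] by (simp add: frechet_derivative_works)
  moreover have "((\<lambda>s. x + s *\<^sub>R axis a 1) has_derivative (\<lambda>s. s *\<^sub>R axis a 1)) (at 0)"
    by (auto intro!: derivative_eq_intros)
  ultimately have "((\<lambda>s. ?F (x + s *\<^sub>R axis a 1)) has_derivative
      (\<lambda>s. frechet_derivative ?F (at x) (s *\<^sub>R axis a 1))) (at 0)"
    using has_derivative_compose[of "\<lambda>s. x + s *\<^sub>R axis a 1" _ 0 UNIV ?F "frechet_derivative ?F (at x)"]
    by simp
  moreover have "?F (x + s *\<^sub>R axis a 1) = ?F x + s * mlext (marginal h a) x" for s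
  proof -
    have "x + s *\<^sub>R axis a 1 = set_coord a (x $ a + s) x"
      by (auto simp: vec_eq_iff axis_def)
    then show ?thesis by (simp add: mlext_set_coord)
  qed
  then have "((\<lambda>s. ?F (x + s *\<^sub>R axis a 1)) has_derivative (\<lambda>s. s * mlext (marginal h a) x)) (at 0)"
    by (auto intro!: derivative_eq_intros)
  ultimately have "(\<lambda>s. frechet_derivative ?F (at x) (s *\<^sub>R axis a 1)) = (\<lambda>s. s * mlext (marginal h a) x)"
    by (rule has_derivative_unique)
  from fun_cong[OF this, of 1] show ?thesis
    by (simp add: nabla_def)
qed

lemma continuous_on_mlext: "continuous_on S (mlext h)" for S :: "(real^'n::finite) set"
  by (meson differentiable_mlext differentiable_imp_continuous_on differentiable_on_def differentiable_at_withinI)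

lemma has_derivative_mlext:
  fixes x :: "real^'n::finite"
  shows "(mlext h has_derivative (\<lambda>v. \<Sum>a\<in>UNIV. v $ a * mlext (marginal h a) x)) (at x)"
proof -
  let ?D = "frechet_derivative (mlext h) (at x)"
  have D: "(mlext h has_derivative ?D) (at x)"
    using differentiable_mlext frechet_derivative_works by blast
  then interpret bounded_linear ?D by (rule has_derivative_bounded_linear)
  have "?D v = (\<Sum>a\<in>UNIV. v $ a * mlext (marginal h a) x)" for v
  proof -
    have "?D v = ?D (\<Sum>a\<in>UNIV. v $ a *\<^sub>R axis a 1)"
      by (simp add: basis_expansion flip: scalar_mult_eq_scaleR)
    also have "\<dots> = (\<Sum>a\<in>UNIV. v $ a * nabla (mlext h) x $ a)"
      by (simp add: sum scaleR nabla_def)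
    finally show ?thesis by (simp add: nabla_mlext)
  qed
  then have "?D = (\<lambda>v. \<Sum>a\<in>UNIV. v $ a * mlext (marginal h a) x)" by blast
  with D show ?thesis by simp
qed

section \<open>Monotone submodular set functions\<close>

lemma Diff_Int_self: "(A - R) \<inter> R = {}" by blast

locale monotone_submodular =
  fixes f :: "'n::finite set \<Rightarrow> real"
  assumes nonneg: "0 \<le> f S" and empty: "f {} = 0"
    and monotone: "monotone_set_fun f" and submodular: "submodular f"
begin

lemma mono: "S \<subseteq> T \<Longrightarrow> f S \<le> f T"
  using monotone by (auto simp: monotone_set_fun_def)

lemma gain_antimono: "S \<subseteq> T \<Longrightarrow> e \<notin> T \<Longrightarrow> f (insert e T) - f T \<le> f (insert e S) - f S"
  using submodular by (auto simp: submodular_def)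

lemma marginal_nonneg: "0 \<le> marginal f a R"
  unfolding marginal_def using mono[of "R - {a}" "insert a R"] by auto

lemma marginal_antimono: "R \<subseteq> R' \<Longrightarrow> marginal f a R' \<le> marginal f a R"
  unfolding marginal_def using gain_antimono[of "R - {a}" "R' - {a}" a] by auto

lemma marginal_le_singleton: "marginal f a R \<le> f {a}"
  using marginal_antimono[of "{}" R a] by (simp add: marginal_def empty)

lemma subadditive_singletons: "f (A \<union> R) \<le> f R + (\<Sum>a\<in>A. f {a})"
  using finite[of A]
proof (induction rule: finite_induct)
  case (insert a A)
  have "f (insert a (A \<union> R)) - f (A \<union> R) \<le> f {a}"
    using gain_antimono[of "{}" "A \<union> R" a] nonneg[of "{a}"]
    by (cases "a \<in> A \<union> R") (auto simp: empty insert_absorb)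
  with insert show ?case by simp
qed simp

lemma le_sum_singletons: "f A \<le> (\<Sum>a\<in>A. f {a})"
  using subadditive_singletons[of A "{}"] by (simp add: empty)

lemma union_le_sum_marginal: "f (A \<union> R) \<le> f R + (\<Sum>a\<in>A - R. marginal f a R)"
proof -
  have "f (B \<union> R) \<le> f R + (\<Sum>a\<in>B. marginal f a R)" if "B \<inter> R = {}" for B
    using finite[of B] that
  proof (induction rule: finite_induct)
    case (insert a B)
    have "f (insert a (B \<union> R)) - f (B \<union> R) \<le> marginal f a R"
      using gain_antimono[of R "B \<union> R" a] insert by (auto simp: marginal_def)
    with insert show ?case by auto
  qed simp
  from this[of "A - R"] show ?thesis by (simp add: Un_Diff_cancel2 Diff_Int_self)
qed

text \<open>Monotonicity makes every quotient in the minimum nonnegative, hence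
  \<open>c \<le> 1\<close>. Elements with \<open>f {e} = 0\<close>, which the minimum leaves out,
  satisfy the gain bound trivially.\<close>

lemma
  assumes "curvature f = c"
  shows curvature_le_one: "c \<le> 1"
    and curvature_gain: "e \<notin> S \<Longrightarrow> (1 - c) * f {e} \<le> f (insert e S) - f S"
proof -
  let ?Q = "{(f (insert e S) - f S) / f {e} | S e. e \<notin> S \<and> f {e} \<noteq> 0}"
  have fin: "finite ?Q"
    by (rule finite_subset[OF _ finite_imageI[of UNIV "\<lambda>(S, e). (f (insert e S) - f S) / f {e}"]]) auto
  have gain: "0 \<le> f (insert e S) - f S" for e S
    using mono[of S "insert e S"] by auto
  show "c \<le> 1"
  proof (cases "\<forall>e. f {e} = 0")
    case False
    then have "?Q \<noteq> {}" by blast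
    then have "Min ?Q \<in> ?Q" using fin by (rule Min_in[rotated])
    then have "0 \<le> Min ?Q" using gain nonneg by auto
    then show ?thesis using assms False by (simp add: curvature_def)
  qed (use assms in \<open>simp add: curvature_def\<close>)
  show "(1 - c) * f {e} \<le> f (insert e S) - f S" if "e \<notin> S"
  proof (cases "f {e} = 0")
    case False
    then have "Min ?Q \<le> (f (insert e S) - f S) / f {e}"
      using that by (intro Min_le fin) auto
    moreover have "Min ?Q = 1 - c"
      using assms False by (auto simp: curvature_def)
    moreover have "0 < f {e}" using False nonneg[of "{e}"] by auto
    ultimately show ?thesis by (simp add: field_simps)
  qed (use gain in simp)
qed

lemma curvature_marginal:
  "curvature f = c \<Longrightarrow> (1 - c) * f {a} \<le> marginal f a R"
  using curvature_gain[of c a "R - {a}"] by (simp add: marginal_def)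

text \<open>Both sides are compared through \<open>f (A \<union> R)\<close>. It is at most
  \<open>f R\<close> plus the marginals over \<open>A - R\<close>, and at least \<open>f A\<close>
  plus (1 - c) times the singleton values of \<open>R - A\<close>. On \<open>A \<inter> R\<close>
  each marginal is itself at least (1 - c) \<open>f {a}\<close>, so the singletons of all of
  \<open>R\<close> appear, and subadditivity turns them into (1 - c) \<open>f R\<close>.\<close>

lemma sum_marginal_ge:
  assumes c: "curvature f = c"
  shows "f A - c * f R \<le> (\<Sum>a\<in>A. marginal f a R)"
proof -
  have c1: "c \<le> 1" using curvature_le_one[OF c] .
  have 1: "f A + (1 - c) * (\<Sum>a\<in>B. f {a}) \<le> f (B \<union> A)" if "B \<inter> A = {}" for B
    using finite[of B] that
  proof (induction rule: finite_induct)
    case (insert b B)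
    then show ?case
      using curvature_gain[OF c, of b "B \<union> A"] by (auto simp: algebra_simps)
  qed simp
  have "(\<Sum>a\<in>R. f {a}) = (\<Sum>a\<in>R - A. f {a}) + (\<Sum>a\<in>A \<inter> R. f {a})"
    by (subst Int_commute, rule sum.Int_Diff[of R _ A, THEN trans]) (auto)
  moreover have "(1 - c) * f R \<le> (1 - c) * (\<Sum>a\<in>R. f {a})"
    using c1 le_sum_singletons by (intro mult_left_mono) auto
  moreover have "f A + (1 - c) * (\<Sum>a\<in>R - A. f {a}) \<le> f (A \<union> R)"
    using 1[of "R - A"] by (simp add: Un_commute Diff_Int_self)
  moreover have "(1 - c) * (\<Sum>a\<in>A \<inter> R. f {a}) \<le> (\<Sum>a\<in>A \<inter> R. marginal f a R)"
    unfolding sum_distrib_left by (intro sum_mono curvature_marginal c)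
  moreover have "f (A \<union> R) \<le> f R + (\<Sum>a\<in>A - R. marginal f a R)"
    by (rule union_le_sum_marginal)
  moreover have "(\<Sum>a\<in>A. marginal f a R) = (\<Sum>a\<in>A \<inter> R. marginal f a R) + (\<Sum>a\<in>A - R. marginal f a R)"
    by (rule sum.Int_Diff) simp
  ultimately show ?thesis by (simp add: algebra_simps)
qed

lemma mlext_marginal_nonneg: "x \<in> unit_cube \<Longrightarrow> 0 \<le> mlext (marginal f a) x"
  by (intro mlext_nonneg marginal_nonneg)

text \<open>Splitting a vertex draw on a block into independent draws loses value, because \<open>mlext f\<close>
  is concave along nonnegative directions.\<close>

lemma mlext_block_le:
  fixes x :: "real^'n"
  assumes x: "x \<in> unit_cube" and p: "\<And>a. a \<in> U \<Longrightarrow> x $ a \<le> p a" and sum_p: "(\<Sum>a\<in>U. p a) = 1"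
  shows "mlext f x \<le> (\<Sum>a\<in>U. p a * mlext f (replace_on U (axis a 1) x))"
proof -
  \<comment> \<open>Empty the block first. Along the block \<open>mlext f\<close> lies below its
    linearisation at \<open>x0\<close>, since marginals decrease along nonnegative directions; at
    the vertices \<open>axis a 1\<close> the linearisation is exact.\<close>
  define x0 where "x0 = replace_on U 0 x"
  have zero: "(0 :: real^'n) \<in> unit_cube" by (simp add: unit_cube_def)
  have x0: "x0 \<in> unit_cube" unfolding x0_def by (intro replace_on_unit_cube x zero)
  have "mlext f (replace_on B x x0) \<le> mlext f x0 + (\<Sum>a\<in>B. x $ a * mlext (marginal f a) x0)"
    if "B \<subseteq> U" for B
    using finite[of B] that
  proof (induction rule: finite_induct)
    case (insert b B)
    let ?z = "replace_on B x x0"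
    have "mlext (marginal f b) ?z \<le> mlext (marginal f b) x0"
      by (intro mlext_antimono marginal_antimono replace_on_unit_cube x x0)
         (auto simp: x0_def unit_cubeD[OF x])
    then have "x $ b * mlext (marginal f b) ?z \<le> x $ b * mlext (marginal f b) x0"
      using unit_cubeD[OF x] by (intro mult_left_mono)
    moreover have "?z $ b = 0" using insert by (simp add: x0_def)
    ultimately show ?case
      using insert by (simp add: replace_on_insert mlext_set_coord)
  qed simp
  from this[of U] have "mlext f (replace_on U x x0) \<le> mlext f x0 + (\<Sum>a\<in>U. x $ a * mlext (marginal f a) x0)"
    by simp
  also have "replace_on U x x0 = x" by (auto simp: x0_def vec_eq_iff)
  also have "mlext f x0 + (\<Sum>a\<in>U. x $ a * mlext (marginal f a) x0)
      \<le> mlext f x0 + (\<Sum>a\<in>U. p a * mlext (marginal f a) x0)"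
    by (intro add_left_mono sum_mono mult_right_mono p mlext_marginal_nonneg x0)
  also have "\<dots> = (\<Sum>a\<in>U. p a * (mlext f x0 + mlext (marginal f a) x0))"
    by (simp add: distrib_left sum.distrib sum_p flip: sum_distrib_right)
  also have "\<dots> = (\<Sum>a\<in>U. p a * mlext f (replace_on U (axis a 1) x))"
  proof (rule sum.cong[OF refl])
    fix a assume "a \<in> U"
    then have "replace_on U (axis a 1) x = set_coord a 1 x0" "x0 $ a = 0"
      by (auto simp: vec_eq_iff axis_def x0_def)
    then show "p a * (mlext f x0 + mlext (marginal f a) x0) = p a * mlext f (replace_on U (axis a 1) x)"
      by (simp add: mlext_set_coord)
  qed
  finally show ?thesis .
qed

end

section \<open>The surrogate gradient\<close>

text \<open>The ratio is the total weight of the kernel of the surrogate gradient. This gives its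
  nonnegativity for every real \<open>c\<close> without a sign distinction.\<close>

lemma curv_ratio_integral: "((\<lambda>z. exp (c * (z - 1))) has_integral curv_ratio c) {0..1}"
proof (cases "c = 0")
  case True
  then show ?thesis using has_integral_const_real[of "1::real" 0 1] by (simp add: curv_ratio_def)
next
  case False
  have "((\<lambda>z. exp (c * (z - 1))) has_integral (exp (c * (1 - 1)) / c - exp (c * (0 - 1)) / c)) {0..1}"
    using False by (intro fundamental_theorem_of_calculus)
      (auto intro!: derivative_eq_intros simp flip: has_real_derivative_iff_has_vector_derivative)
  with False show ?thesis by (simp add: curv_ratio_def diff_divide_distrib)
qed

lemma curv_ratio_nonneg: "0 \<le> curv_ratio c"
  using has_integral_nonneg[OF curv_ratio_integral] by simp

lemma surrogate_grad_has_integral: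
  fixes x :: "real^'n::finite"
  shows "((\<lambda>z. exp (c * (z - 1)) * mlext (marginal f a) (z *\<^sub>R x))
           has_integral surrogate_grad c f x $ a) {0..1}"
proof -
  let ?h = "\<lambda>z. exp (c * (z - 1)) *\<^sub>R nabla (mlext f) (z *\<^sub>R x)"
  have "continuous_on {0..1} (\<lambda>z. mlext h (z *\<^sub>R x))" for h
    by (rule continuous_on_compose2[OF continuous_on_mlext[of UNIV h]]) (auto intro!: continuous_intros)
  then have "continuous_on {0..1} ?h"
    unfolding continuous_on_componentwise[where f = ?h] 
    by (auto simp: Basis_vec_def inner_axis nabla_mlext intro!: continuous_intros)
  then have "(?h has_integral surrogate_grad c f x) {0..1}"
    unfolding surrogate_grad_def by (intro integrable_integral integrable_continuous_real)
  then have "((\<lambda>z. ?h z $ a) has_integral surrogate_grad c f x $ a) {0..1}"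
    using has_integral_linear[OF _ bounded_linear_vec_nth, of ?h _ _ a] by (simp only: o_def)
  then show ?thesis by (simp add: nabla_mlext)
qed

context monotone_submodular
begin

lemma surrogate_grad_at_zero: "surrogate_grad c f 0 $ a = curv_ratio c * f {a}"
proof -
  have "((\<lambda>z. exp (c * (z - 1)) * f {a}) has_integral surrogate_grad c f 0 $ a) {0..1}"
    using surrogate_grad_has_integral[of c f a 0] by (simp add: mlext_zero marginal_def empty)
  moreover have "((\<lambda>z. exp (c * (z - 1)) * f {a}) has_integral curv_ratio c * f {a}) {0..1}"
    by (intro has_integral_mult_left curv_ratio_integral)
  ultimately show ?thesis by (rule has_integral_unique)
qed

text \<open>Each marginal gain of \<open>a\<close> lies between 0 and \<open>f {a}\<close>, so
  \<open>mlext_Lipschitz\<close> applies at every scale \<open>z\<close>. With the singleton bound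
  this yields the Lipschitz constant G.\<close>

lemma surrogate_grad_Lipschitz:
  assumes x: "x \<in> unit_cube" and y: "y \<in> unit_cube"
  shows "\<bar>surrogate_grad c f x $ a - surrogate_grad c f y $ a\<bar> \<le> curv_ratio c * f {a} * l1norm (x - y)"
proof -
  let ?s = "\<lambda>x. surrogate_grad c f x $ a"
  let ?e = "\<lambda>z. exp (c * (z - 1))" and ?m = "\<lambda>z x. mlext (marginal f a) (z *\<^sub>R x)"
  let ?K = "f {a} * l1norm (x - y)"
  have I: "((\<lambda>z. ?e z * ?K) has_integral curv_ratio c * ?K) {0..1}"
    by (intro has_integral_mult_left curv_ratio_integral)
  have d: "\<bar>?m z x - ?m z y\<bar> \<le> ?K" if "z \<in> {0..1}" for z
  proof -
    have "\<bar>?m z x - ?m z y\<bar> \<le> f {a} * l1norm (z *\<^sub>R x - z *\<^sub>R y)"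
      using that by (intro mlext_Lipschitz marginal_nonneg marginal_le_singleton scaleR_unit_cube x y)
    also have "l1norm (z *\<^sub>R x - z *\<^sub>R y) = z * l1norm (x - y)"
      using that by (simp add: l1norm_def sum_distrib_left abs_mult flip: right_diff_distrib)
    also have "\<dots> \<le> 1 * l1norm (x - y)"
      using that by (intro mult_right_mono) (auto simp: l1norm_def intro!: sum_nonneg)
    finally show ?thesis using nonneg[of "{a}"] by (simp add: mult_left_mono)
  qed
  have "?s x - ?s y \<le> curv_ratio c * ?K"
    by (rule has_integral_le[OF has_integral_diff[OF surrogate_grad_has_integral surrogate_grad_has_integral] I])
       (use d in \<open>force simp flip: right_diff_distrib intro!: mult_left_mono\<close>)
  moreover have "?s y - ?s x \<le> curv_ratio c * ?K"
    by (rule has_integral_le[OF has_integral_diff[OF surrogate_grad_has_integral surrogate_grad_has_integral] I])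
       (use d in \<open>force simp flip: right_diff_distrib intro!: mult_left_mono\<close>)
  ultimately show ?thesis by (simp add: mult.assoc)
qed

text \<open>Integration by parts turns \<open>\<integral> exp (c (z - 1)) (d/dz) F (z x) dz\<close> into
  \<open>F x - c \<integral> exp (c (z - 1)) F (z x) dz\<close>, and the last integral cancels against the
  curvature term of \<open>sum_marginal_ge\<close>.\<close>

lemma surrogate_grad_inner_ge:
  assumes c: "curvature f = c" and x: "x \<in> unit_cube"
  shows "curv_ratio c * f A - mlext f x
           \<le> (\<Sum>a\<in>UNIV. surrogate_grad c f x $ a * (indicator_vec A $ a - x $ a))"
proof -
  let ?e = "\<lambda>z. exp (c * (z - 1))" and ?m = "\<lambda>z a. mlext (marginal f a) (z *\<^sub>R x)"
  let ?F = "\<lambda>z. mlext f (z *\<^sub>R x)"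
  have "((\<lambda>z. \<Sum>a\<in>UNIV. ?e z * ?m z a * (indicator_vec A $ a - x $ a)) has_integral
      (\<Sum>a\<in>UNIV. surrogate_grad c f x $ a * (indicator_vec A $ a - x $ a))) {0..1}"
    by (intro has_integral_sum has_integral_mult_left surrogate_grad_has_integral) simp
  moreover have "((\<lambda>z. c * ?e z * ?F z + ?e z * (\<Sum>a\<in>UNIV. x $ a * ?m z a))
      has_integral ?e 1 * ?F 1 - ?e 0 * ?F 0) {0..1}"
  proof (rule fundamental_theorem_of_calculus)
    fix z :: real
    have "(?F has_derivative (\<lambda>s. \<Sum>a\<in>UNIV. (s *\<^sub>R x) $ a * ?m z a)) (at z within {0..1})"
      by (rule has_derivative_compose[where g = "mlext f", OF _ has_derivative_mlext])
         (auto intro!: derivative_eq_intros)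
    also have "(\<lambda>s. \<Sum>a\<in>UNIV. (s *\<^sub>R x) $ a * ?m z a) = (*) (\<Sum>a\<in>UNIV. x $ a * ?m z a)"
      by (simp add: fun_eq_iff sum_distrib_left algebra_simps)
    finally have "(?F has_real_derivative (\<Sum>a\<in>UNIV. x $ a * ?m z a)) (at z within {0..1})"
      by (simp add: has_field_derivative_def)
    moreover have "(?e has_real_derivative c * ?e z) (at z within {0..1})"
      by (auto intro!: derivative_eq_intros)
    ultimately show "((\<lambda>z. ?e z * ?F z) has_vector_derivative
        c * ?e z * ?F z + ?e z * (\<Sum>a\<in>UNIV. x $ a * ?m z a)) (at z within {0..1})"
      by (auto simp flip: has_real_derivative_iff_has_vector_derivative
          intro!: derivative_eq_intros simp: algebra_simps)
  qed simp
  then have "((\<lambda>z. c * ?e z * ?F z + ?e z * (\<Sum>a\<in>UNIV. x $ a * ?m z a)) has_integral mlext f x) {0..1}"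
    by (simp add: mlext_zero empty)
  ultimately have I: "((\<lambda>z. (\<Sum>a\<in>UNIV. ?e z * ?m z a * (indicator_vec A $ a - x $ a))
      + (c * ?e z * ?F z + ?e z * (\<Sum>a\<in>UNIV. x $ a * ?m z a))) has_integral
      (\<Sum>a\<in>UNIV. surrogate_grad c f x $ a * (indicator_vec A $ a - x $ a)) + mlext f x) {0..1}"
    by (rule has_integral_add)
  have "((\<lambda>z. ?e z * f A) has_integral curv_ratio c * f A) {0..1}"
    by (intro has_integral_mult_left curv_ratio_integral)
  then have "curv_ratio c * f A \<le> (\<Sum>a\<in>UNIV. surrogate_grad c f x $ a * (indicator_vec A $ a - x $ a)) + mlext f x"
  proof (rule has_integral_le[OF _ I])
    fix z :: real assume z: "z \<in> {0..1}"
    \<comment> \<open>The derivative of F along the ray cancels the pairing with \<open>x\<close>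
      and leaves the marginals over \<open>A\<close>, to which \<open>sum_marginal_ge\<close>
      applies set by set.\<close>
    have "(\<Sum>a\<in>UNIV. ?e z * ?m z a * (indicator_vec A $ a - x $ a)) + ?e z * (\<Sum>a\<in>UNIV. x $ a * ?m z a)
        = ?e z * (\<Sum>a\<in>UNIV. if a \<in> A then ?m z a else 0)"
      unfolding sum_distrib_left sum.distrib[symmetric]
      by (rule sum.cong) (auto simp: algebra_simps)
    also have "(\<Sum>a\<in>UNIV. if a \<in> A then ?m z a else 0) = mlext (\<lambda>R. \<Sum>a\<in>A. marginal f a R) (z *\<^sub>R x)"
      by (simp add: mlext_sum sum.If_cases)
    also have "mlext (\<lambda>R. f A - c * f R) (z *\<^sub>R x) \<le> mlext (\<lambda>R. \<Sum>a\<in>A. marginal f a R) (z *\<^sub>R x)"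
      by (intro mlext_mono sum_marginal_ge c scaleR_unit_cube x z)
    then have "?e z * (f A - c * ?F z) \<le> ?e z * mlext (\<lambda>R. \<Sum>a\<in>A. marginal f a R) (z *\<^sub>R x)"
      by (simp add: mlext_diff mlext_const mlext_cmult)
    finally show "?e z * f A \<le> (\<Sum>a\<in>UNIV. ?e z * ?m z a * (indicator_vec A $ a - x $ a))
      + (c * ?e z * ?F z + ?e z * (\<Sum>a\<in>UNIV. x $ a * ?m z a))"
      by (simp add: algebra_simps)
  qed
  then show ?thesis by simp
qed

end

section \<open>Expectations over finitely supported distributions\<close>

lemma expectation_bind_finite:
  fixes p :: "'a pmf" and q :: "'a \<Rightarrow> 'b pmf" and h :: "'b \<Rightarrow> real"
  assumes p: "finite (set_pmf p)" and q: "\<And>x. x \<in> set_pmf p \<Longrightarrow> finite (set_pmf (q x))"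
  shows "measure_pmf.expectation (bind_pmf p q) h
    = measure_pmf.expectation p (\<lambda>x. measure_pmf.expectation (q x) h)"
proof -
  have "measure_pmf.expectation p k = (\<Sum>x\<in>set_pmf p. pmf p x *\<^sub>R k x)" for k :: "'a \<Rightarrow> real"
    by (rule integral_measure_pmf[OF p])
  then show ?thesis
    using pmf_expectation_bind[OF p q order_refl, where h = h] by simp
qed

lemma expectation_mono_finite:
  fixes h k :: "'a \<Rightarrow> real"
  assumes "finite (set_pmf p)" "\<And>x. x \<in> set_pmf p \<Longrightarrow> h x \<le> k x"
  shows "measure_pmf.expectation p h \<le> measure_pmf.expectation p k"
proof -
  have "measure_pmf.expectation p g = (\<Sum>x\<in>set_pmf p. pmf p x *\<^sub>R g x)" for g :: "'a \<Rightarrow> real"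
    by (rule integral_measure_pmf[OF assms(1)])
  then show ?thesis
    by (simp add: assms(2) sum_mono mult_left_mono)
qed

lemma expectation_cong_pmf:
  fixes h k :: "'a \<Rightarrow> real"
  assumes "\<And>x. x \<in> set_pmf p \<Longrightarrow> h x = k x"
  shows "measure_pmf.expectation p h = measure_pmf.expectation p k"
proof (rule integral_cong_AE)
  show "AE x in measure_pmf p. h x = k x"
    unfolding AE_measure_pmf_iff using assms by blast
qed simp_all

text \<open>\<open>embed_pmf\<close> is meaningful only for nonnegative weights of total 1, so the
  block must carry positive mass; this is why \<open>run_invariant\<close> tracks that mass.\<close>

lemma pmf_action:
  fixes x :: "real^'n::finite"
  assumes "\<And>a. 0 \<le> x $ a" "0 < (\<Sum>a\<in>A. x $ a)"
  shows "pmf (action_pmf A x) a = (if a \<in> A then x $ a / (\<Sum>a\<in>A. x $ a) else 0)"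
  unfolding action_pmf_def
proof (rule pmf_embed_pmf)
  let ?p = "\<lambda>a. if a \<in> A then x $ a / (\<Sum>a\<in>A. x $ a) else 0"
  show nonneg: "0 \<le> ?p a" for a using assms by (auto intro!: divide_nonneg_pos)
  have "(\<integral>\<^sup>+ a. ennreal (?p a) \<partial>count_space UNIV) = ennreal (\<Sum>a\<in>UNIV. ?p a)"
    using nonneg by (simp add: nn_integral_count_space_finite)
  also have "(\<Sum>a\<in>UNIV. ?p a) = 1"
    using assms(2) by (simp add: sum.If_cases flip: sum_divide_distrib)
  finally show "(\<integral>\<^sup>+ a. ennreal (?p a) \<partial>count_space UNIV) = 1" by simp
qed

section \<open>Action blocks\<close>

locale action_blocks =
  fixes V :: "'m::finite \<Rightarrow> 'n::finite set"
  assumes V_nonempty: "V i \<noteq> {}" and V_disjoint: "disjoint_family V" and V_cover: "(\<Union>i. V i) = UNIV"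
begin

definition owner :: "'n \<Rightarrow> 'm" where
  "owner a = (THE i. a \<in> V i)"

lemma in_block_iff: "a \<in> V i \<longleftrightarrow> owner a = i"
proof -
  obtain j where j: "a \<in> V j" using V_cover by blast
  have u: "k = j" if "a \<in> V k" for k
    using V_disjoint j that by (auto simp: disjoint_family_on_def)
  with j have "owner a = j" unfolding owner_def by blast
  then show ?thesis using j u by blast
qed

lemma sum_blocks: "(\<Sum>i\<in>UNIV. \<Sum>a\<in>V i. h i a) = (\<Sum>a\<in>UNIV. h (owner a) a)"
proof -
  have "(\<Sum>a\<in>UNIV. h (owner a) a) = (\<Sum>a\<in>(\<Union>i. V i). h (owner a) a)" by (simp add: V_cover)
  also have "\<dots> = (\<Sum>i\<in>UNIV. \<Sum>a\<in>V i. h (owner a) a)"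
    using V_disjoint by (intro sum.UNION_disjoint) (auto simp: disjoint_family_on_def)
  also have "\<dots> = (\<Sum>i\<in>UNIV. \<Sum>a\<in>V i. h i a)"
    by (intro sum.cong refl) (simp add: in_block_iff)
  finally show ?thesis by simp
qed

lemma sum_blocks_subset: "(\<Sum>i\<in>UNIV. \<Sum>a\<in>A \<inter> V i. h i a) = (\<Sum>a\<in>A. h (owner a) a)"
proof -
  have "(\<Sum>i\<in>UNIV. \<Sum>a\<in>A \<inter> V i. h i a) = (\<Sum>i\<in>UNIV. \<Sum>a\<in>V i. if a \<in> A then h i a else 0)"
    by (rule sum.cong[OF refl]) (subst Int_commute, simp add: sum.inter_restrict)
  also have "\<dots> = (\<Sum>a\<in>UNIV. if a \<in> A then h (owner a) a else 0)"
    by (rule sum_blocks)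
  also have "\<dots> = (\<Sum>a\<in>A. h (owner a) a)"
    by (simp add: sum.If_cases)
  finally show ?thesis .
qed

lemma card_transversal: "(\<And>i. card (A \<inter> V i) \<le> 1) \<Longrightarrow> card A \<le> CARD('m)"
proof -
  assume le: "\<And>i. card (A \<inter> V i) \<le> 1"
  have "card A = (\<Sum>i\<in>UNIV. card (A \<inter> V i))"
    using sum_blocks_subset[of "\<lambda>_ _. 1::nat" A] by simp
  also have "\<dots> \<le> (\<Sum>i\<in>(UNIV::'m set). 1)"
    by (intro sum_mono le)
  finally show ?thesis by simp
qed

lemma feasible_unit_cube: "x \<in> feasible V \<Longrightarrow> x \<in> unit_cube"
  and feasible_sum: "x \<in> feasible V \<Longrightarrow> (\<Sum>a\<in>V i. x $ a) \<le> 1"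
  unfolding feasible_def by simp_all

lemma feasibleI:
  assumes "\<And>a. 0 \<le> x $ a" "\<And>i. (\<Sum>a\<in>V i. x $ a) \<le> 1"
  shows "x \<in> feasible V"
proof -
  have "x $ a \<le> 1" for a
  proof -
    have "x $ a \<le> (\<Sum>a\<in>V (owner a). x $ a)"
      by (rule member_le_sum) (auto simp: in_block_iff assms)
    then show ?thesis using assms(2)[of "owner a"] by simp
  qed
  with assms show ?thesis by (auto simp: feasible_def unit_cube_def)
qed

lemma feasible_l1: "x \<in> feasible V \<Longrightarrow> (\<Sum>a\<in>UNIV. x $ a) \<le> CARD('m)"
proof -
  assume "x \<in> feasible V"
  then have "(\<Sum>i\<in>(UNIV::'m set). \<Sum>a\<in>V i. x $ a) \<le> (\<Sum>i\<in>(UNIV::'m set). 1)"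
    by (intro sum_mono feasible_sum)
  then show ?thesis
    using sum_blocks[of "\<lambda>_ a. x $ a"] by simp
qed

lemma indicator_vec_feasible: "(\<And>i. card (A \<inter> V i) \<le> 1) \<Longrightarrow> indicator_vec A \<in> feasible V"
proof (rule feasibleI)
  fix i assume "\<And>i. card (A \<inter> V i) \<le> 1"
  from this[of i] show "(\<Sum>a\<in>V i. indicator_vec A $ a) \<le> 1"
    by (simp add: sum.If_cases Int_commute)
qed simp

text \<open>The explicit bound 2 N serves to absorb the initial disagreement; elsewhere the diameter
  stays symbolic.\<close>

lemma
  shows l1_le_diameter: "x \<in> feasible V \<Longrightarrow> y \<in> feasible V \<Longrightarrow> l1norm (x - y) \<le> l1_diameter (feasible V)"
    and l1_diameter_le: "l1_diameter (feasible V) \<le> 2 * CARD('m)"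
    and l1_diameter_nonneg: "0 \<le> l1_diameter (feasible V)"
proof -
  let ?D = "{l1norm (x - y) | x y. x \<in> feasible V \<and> y \<in> feasible V}"
  have le: "d \<le> 2 * CARD('m)" if "d \<in> ?D" for d
  proof -
    from that obtain x y where d: "d = l1norm (x - y)" and xy: "x \<in> feasible V" "y \<in> feasible V"
      by auto
    have "\<bar>x $ a - y $ a\<bar> \<le> x $ a + y $ a" for a
      using xy[THEN feasible_unit_cube, THEN unit_cubeD(1), of a] by linarith
    then have "d \<le> (\<Sum>a\<in>UNIV. x $ a + y $ a)"
      unfolding d l1norm_def by (intro sum_mono) simp
    then show ?thesis
      using feasible_l1[OF xy(1)] feasible_l1[OF xy(2)] by (simp add: sum.distrib)
  qed
  have zero: "(0 :: real^'n) \<in> feasible V" by (intro feasibleI) auto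
  then have "l1norm (0 - 0 :: real^'n) \<in> ?D" by blast
  then have ne: "?D \<noteq> {}" by blast
  have bdd: "bdd_above ?D" using le by (rule bdd_aboveI)
  show upper: "l1norm (x - y) \<le> l1_diameter (feasible V)" if "x \<in> feasible V" "y \<in> feasible V" for x y
    unfolding l1_diameter_def using that bdd by (intro cSup_upper) auto
  show "l1_diameter (feasible V) \<le> 2 * CARD('m)"
    unfolding l1_diameter_def using ne le by (rule cSup_least)
  show "0 \<le> l1_diameter (feasible V)"
    using upper[OF zero zero] by (simp add: l1norm_def)
qed

section \<open>Sampling one action per block\<close>

text \<open>The fractional point behind the joint draw: only the owner's copy of an entry influences
  which action is played.\<close>

definition combined :: "('m \<Rightarrow> real^'n) \<Rightarrow> real^'n" where
  "combined x = (\<chi> a. x (owner a) $ a)"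

lemma combined_nth [simp]: "combined x $ a = x (owner a) $ a"
  by (simp add: combined_def)

lemma combined_feasible: "(\<And>i. x i \<in> feasible V) \<Longrightarrow> combined x \<in> feasible V"
proof (rule feasibleI)
  assume x: "\<And>i. x i \<in> feasible V"
  show "0 \<le> combined x $ a" for a using unit_cubeD[OF feasible_unit_cube[OF x]] by simp
  have "(\<Sum>a\<in>V i. combined x $ a) = (\<Sum>a\<in>V i. x i $ a)" for i
    by (rule sum.cong) (auto simp: in_block_iff)
  then show "(\<Sum>a\<in>V i. combined x $ a) \<le> 1" for i using feasible_sum[OF x] by simp
qed

text \<open>A hybrid argument: the blocks are replaced by sampled vertices one agent at a time, and
  by \<open>mlext_block_le\<close> no replacement lowers the expectation.\<close>

lemma mlext_le_expectation_actions:
  assumes f: "monotone_submodular f" and x: "\<And>i. x i \<in> feasible V" and pos: "\<And>i. 0 < (\<Sum>a\<in>V i. x i $ a)"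
  shows "mlext f (combined x)
    \<le> measure_pmf.expectation (Pi_pmf UNIV undefined (\<lambda>i. action_pmf (V i) (x i))) (\<lambda>a. f (\<Union>i. {a i}))"
proof -
  let ?p = "\<lambda>i. action_pmf (V i) (x i)"
  interpret monotone_submodular f by fact
  have x0: "0 \<le> x i $ a" for i a using unit_cubeD[OF feasible_unit_cube[OF x]] by simp
  note p = pmf_action[OF x0 pos]
  \<comment> \<open>A hybrid point: the blocks of the agents in \<open>I\<close> hold the drawn
    vertices, the other blocks are still fractional.\<close>
  define w where "w = (\<lambda>I b. \<chi> a. if owner a \<in> I then (if b (owner a) = a then 1 else 0) else combined x $ a)"
  have cube: "w I b \<in> unit_cube" for I b
    using unit_cubeD[OF feasible_unit_cube[OF x]] by (auto simp: w_def unit_cube_def)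
  have "mlext f (combined x) \<le> measure_pmf.expectation (Pi_pmf I undefined ?p) (\<lambda>b. mlext f (w I b))" for I
    using finite[of I]
  proof (induction rule: finite_induct)
    case empty
    have "w {} b = combined x" for b by (simp add: w_def vec_eq_iff)
    then show ?case by simp
  next
    case (insert i I)
    let ?Q = "Pi_pmf I undefined ?p"
    have step: "mlext f (w I b) \<le> measure_pmf.expectation (?p i) (\<lambda>y. mlext f (w (insert i I) (b(i := y))))" for b
    proof -
      \<comment> \<open>The block sum is at most 1, so normalising by it can only enlarge the
        entries, as \<open>mlext_block_le\<close> demands.\<close>
      have "x i $ a \<le> pmf (?p i) a" if "a \<in> V i" for a
        using x0[of i a] pos[of i] feasible_sum[OF x, of i i] that
        by (simp add: p pos_le_divide_eq mult_left_le)
      moreover have "(\<Sum>a\<in>V i. pmf (?p i) a) = 1"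
        using pos[of i] by (simp add: p flip: sum_divide_distrib)
      moreover have "w I b $ a = x i $ a" if "a \<in> V i" for a
        using that insert by (auto simp: w_def in_block_iff)
      ultimately have "mlext f (w I b) \<le> (\<Sum>a\<in>V i. pmf (?p i) a * mlext f (replace_on (V i) (axis a 1) (w I b)))"
        by (intro mlext_block_le cube) auto
      also have "\<dots> = (\<Sum>a\<in>V i. pmf (?p i) a * mlext f (w (insert i I) (b(i := a))))"
      proof (rule sum.cong[OF refl])
        fix a assume "a \<in> V i"
        then have "replace_on (V i) (axis a 1) (w I b) = w (insert i I) (b(i := a))"
          using insert by (auto simp: vec_eq_iff w_def in_block_iff axis_def)
        then show "pmf (?p i) a * mlext f (replace_on (V i) (axis a 1) (w I b))
            = pmf (?p i) a * mlext f (w (insert i I) (b(i := a)))" by simp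
      qed
      also have "\<dots> = measure_pmf.expectation (?p i) (\<lambda>y. mlext f (w (insert i I) (b(i := y))))"
        by (subst integral_measure_pmf[of "V i"]) (auto simp: set_pmf_eq p split: if_splits)
      finally show ?thesis .
    qed
    have "mlext f (combined x) \<le> measure_pmf.expectation ?Q (\<lambda>b. mlext f (w I b))" by fact
    also have "\<dots> \<le> measure_pmf.expectation ?Q
        (\<lambda>b. measure_pmf.expectation (?p i) (\<lambda>y. mlext f (w (insert i I) (b(i := y)))))"
      by (intro expectation_mono_finite step) simp
    also have "\<dots> = measure_pmf.expectation (bind_pmf ?Q (\<lambda>b. map_pmf (\<lambda>y. b(i := y)) (?p i)))
        (\<lambda>b. mlext f (w (insert i I) b))"
      by (subst expectation_bind_finite) auto
    also have "bind_pmf ?Q (\<lambda>b. map_pmf (\<lambda>y. b(i := y)) (?p i)) = Pi_pmf (insert i I) undefined ?p"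
      unfolding Pi_pmf_insert'[OF insert.hyps] map_pmf_def by (rule bind_commute_pmf)
    finally show ?case .
  qed
  from this[of UNIV] have "mlext f (combined x)
      \<le> measure_pmf.expectation (Pi_pmf UNIV undefined ?p) (\<lambda>b. mlext f (w UNIV b))" .
  also have "\<dots> = measure_pmf.expectation (Pi_pmf UNIV undefined ?p) (\<lambda>a. f (\<Union>i. {a i}))"
  proof (rule expectation_cong_pmf)
    fix b assume "b \<in> set_pmf (Pi_pmf UNIV undefined ?p)"
    then have mem: "b i \<in> set_pmf (?p i)" for i
      by (auto simp: set_Pi_pmf PiE_dflt_def)
    have "b i \<in> V i" for i
      using mem[of i] by (auto simp: set_pmf_eq p split: if_splits)
    then have "b (owner a) = a \<longleftrightarrow> a \<in> (\<Union>i. {b i})" for a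
      unfolding in_block_iff by (auto intro!: exI[of _ "owner a"])
    then have "w UNIV b = indicator_vec (\<Union>i. {b i})"
      by (simp add: vec_eq_iff w_def)
    then show "mlext f (w UNIV b) = f (\<Union>i. {b i})" by (simp add: mlext_indicator_vec)
  qed
  finally show ?thesis .
qed

end

section \<open>Spectrum of a symmetric matrix\<close>

lemma symmetric_matrix_inner:
  fixes W :: "real^'m^'m"
  assumes "transpose W = W"
  shows "u \<bullet> (W *v w) = (W *v u) \<bullet> w"
  by (metis assms dot_lmul_matrix transpose_matrix_vector)

text \<open>The first-order condition at a maximum: for a small \<open>s\<close> of sign opposite to
  \<open>a\<close> the linear term would win. In the proof, \<open>k > b\<close> makes the step
  \<open>- a / k\<close> small enough.\<close>

lemma linear_coeff_eq_zero:
  fixes a b :: real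
  assumes "\<And>s. 0 \<le> 2 * s * a + s\<^sup>2 * b"
  shows "a = 0"
proof (rule ccontr)
  assume a: "a \<noteq> 0"
  define k where "k = \<bar>b\<bar> + 1"
  have k: "0 < k" "b < k" by (auto simp: k_def)
  have "0 \<le> 2 * (- a / k) * a + (- a / k)\<^sup>2 * b" by (rule assms)
  also have "\<dots> = a\<^sup>2 / k * (b / k - 2)"
    using k by (simp add: field_simps power2_eq_square)
  finally have "0 \<le> a\<^sup>2 / k * (b / k - 2)" .
  moreover have "0 < a\<^sup>2 / k" using a k by simp
  ultimately have "0 \<le> b / k - 2" by (metis linorder_not_le mult_pos_neg)
  with k show False by (simp add: field_simps)
qed

text \<open>\<open>v\<close> maximises the quadratic form on the unit sphere of \<open>S\<close>.
  The first-order condition makes \<open>W *v v - d *\<^sub>R v\<close> orthogonal to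
  \<open>S\<close>; by invariance this residual lies in \<open>S\<close>, so it is zero.\<close>

lemma symmetric_matrix_eigenvector:
  fixes W :: "real^'m^'m"
  assumes sym: "transpose W = W" and S: "subspace S" and inv: "\<And>v. v \<in> S \<Longrightarrow> W *v v \<in> S"
    and dim: "dim S \<noteq> 0"
  obtains v d where "v \<in> S" "norm v = 1" "W *v v = d *\<^sub>R v"
proof -
  let ?K = "S \<inter> sphere 0 1" and ?q = "\<lambda>v. v \<bullet> (W *v v)"
  have "\<not> S \<subseteq> {0}" using dim by simp
  then obtain u where u: "u \<in> S" "u \<noteq> 0" by blast
  then have "(1 / norm u) *\<^sub>R u \<in> ?K"
    using S by (auto simp: subspace_scale)
  then have "?K \<noteq> {}" by blast
  moreover have "compact ?K"
    using S by (intro closed_Int_compact closed_subspace) auto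
  moreover have "continuous_on ?K ?q"
    by (intro continuous_intros linear_continuous_on linear_conv_bounded_linear[THEN iffD1]) auto
  ultimately obtain v where v: "v \<in> ?K" and max: "\<And>w. w \<in> ?K \<Longrightarrow> ?q w \<le> ?q v"
    using continuous_attains_sup[of ?K ?q] by blast
  define d where "d = ?q v"
  have vS: "v \<in> S" and vv: "v \<bullet> v = 1" using v by (auto simp: norm_eq_1)
  have le: "?q w \<le> d * (w \<bullet> w)" if "w \<in> S" for w
  proof (cases "w = 0")
    case False
    let ?w = "(1 / norm w) *\<^sub>R w"
    have "?q ?w \<le> d"
      unfolding d_def using that False S by (intro max) (auto simp: subspace_scale)
    moreover have "?q ?w = ?q w / (norm w)\<^sup>2"
      by (simp add: matrix_vector_mult_scaleR power2_eq_square)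
    ultimately have "?q w / (norm w)\<^sup>2 \<le> d" by linarith
    then show ?thesis
      using False by (simp add: pos_divide_le_eq power2_norm_eq_inner)
  qed (simp add: d_def)
  have "(W *v v - d *\<^sub>R v) \<bullet> w = 0" if w: "w \<in> S" for w
  proof -
    have "0 \<le> 2 * s * (d * (v \<bullet> w) - (W *v v) \<bullet> w) + s\<^sup>2 * (d * (w \<bullet> w) - ?q w)" for s
    proof -
      have "v + s *\<^sub>R w \<in> S" using S vS w by (simp add: subspace_add subspace_scale)
      from le[OF this] have "?q (v + s *\<^sub>R w) \<le> d * ((v + s *\<^sub>R w) \<bullet> (v + s *\<^sub>R w))" .
      moreover have "?q (v + s *\<^sub>R w) = d + 2 * s * ((W *v v) \<bullet> w) + s\<^sup>2 * ?q w"
        using symmetric_matrix_inner[OF sym, of v w]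
        by (simp add: d_def matrix_vector_mult_add_rdistrib matrix_vector_mult_scaleR inner_add_left
            inner_add_right power2_eq_square inner_commute algebra_simps)
      ultimately show ?thesis
        by (simp add: vv inner_add_left inner_add_right power2_eq_square inner_commute algebra_simps)
    qed
    from linear_coeff_eq_zero[OF this] show ?thesis
      by (simp add: inner_diff_left)
  qed
  from this[of "W *v v - d *\<^sub>R v"] have "W *v v = d *\<^sub>R v"
    using S vS inv by (simp add: subspace_diff subspace_scale)
  with v that show ?thesis by auto
qed

text \<open>Stated for an invariant subspace because it is applied to the hyperplane orthogonal to
  the all-ones vector. By symmetry the complement of an eigenvector stays invariant, which drives
  the induction on the dimension.\<close>

lemma symmetric_matrix_eigenbasis:
  fixes W :: "real^'m^'m"
  assumes sym: "transpose W = W" and S: "subspace S" and inv: "\<And>v. v \<in> S \<Longrightarrow> W *v v \<in> S"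
  shows "\<exists>B. finite B \<and> card B = dim S \<and> B \<subseteq> S \<and> pairwise orthogonal B
           \<and> (\<forall>b\<in>B. norm b = 1 \<and> (\<exists>d. W *v b = d *\<^sub>R b))"
  using S inv
proof (induction "dim S" arbitrary: S)
  case 0
  then show ?case by (intro exI[of _ "{}"]) auto
next
  case (Suc k)
  from Suc.hyps(2) have "dim S \<noteq> 0" by linarith
  from symmetric_matrix_eigenvector[OF sym Suc.prems this]
  obtain v d where v: "v \<in> S" "norm v = 1" "W *v v = d *\<^sub>R v" .
  let ?S' = "{w \<in> S. \<forall>u\<in>span {v}. orthogonal u w}"
  have S': "?S' = {w \<in> S. v \<bullet> w = 0}"
    by (auto simp: orthogonal_def span_singleton)
  have "dim ?S' + dim (span {v}) = dim S"
    using v by (intro dim_subspace_orthogonal_to_vectors Suc.prems span_minimal) auto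
  moreover have "dim (span {v}) = 1"
    using v by (auto simp: dim_singleton)
  ultimately have "k = dim ?S'" using Suc.hyps by simp
  moreover have "subspace ?S'"
    using Suc.prems(1) unfolding S' by (auto simp: subspace_def inner_add_right)
  moreover have "W *v w \<in> ?S'" if "w \<in> ?S'" for w
    using that Suc.prems(2) v(3) unfolding S' by (auto simp: symmetric_matrix_inner[OF sym])
  ultimately obtain B where B: "finite B" "card B = dim ?S'" "B \<subseteq> ?S'" "pairwise orthogonal B"
    "\<forall>b\<in>B. norm b = 1 \<and> (\<exists>d. W *v b = d *\<^sub>R b)"
    using Suc.hyps(1)[of ?S'] by blast
  have "v \<notin> B" using v B(3) unfolding S' by (auto simp: norm_eq_1)
  moreover have "pairwise orthogonal (insert v B)"
    using B(3,4) unfolding S' by (auto simp: pairwise_insert orthogonal_def inner_commute)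
  ultimately show ?case
    using B v \<open>k = dim ?S'\<close> Suc.hyps(2) by (intro exI[of _ "insert v B"]) auto
qed

section \<open>Characteristic polynomial of an orthogonally diagonalised matrix\<close>

definition const_mat :: "real^'m^'k \<Rightarrow> real poly^'m^'k" where
  "const_mat A = (\<chi> i j. [:A $ i $ j:])"

lemma const_mat_mult:
  fixes A B :: "real^'m::finite^'m"
  shows "const_mat (A ** B) = const_mat A ** const_mat B"
proof -
  have "[:x * y:] = [:x:] * [:y:]" for x y :: real by simp
  then show ?thesis
    by (simp only: vec_eq_iff const_mat_def matrix_matrix_mult_def vec_lambda_beta sum_to_poly[symmetric])
       simp
qed

lemma const_mat_one: "const_mat (mat 1 :: real^'m^'m) = mat 1"
  by (auto simp: vec_eq_iff const_mat_def mat_def)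

lemma charpoly_eq: "charpoly W = det (mat [:0, 1:] - const_mat W)"
  unfolding charpoly_def const_mat_def by (rule arg_cong[of _ _ det]) (simp add: vec_eq_iff mat_def)

lemma mat_commute: "mat c ** A = A ** mat c" for A :: "'a::comm_semiring_1^'m::finite^'m"
proof -
  have 1: "(if i = j then c else 0) * x = (if i = j then c * x else 0)"
     "x * (if i = j then c else 0) = (if i = j then x * c else 0)" for i j :: 'm and x
    by auto
  show ?thesis
    by (simp add: vec_eq_iff matrix_matrix_mult_def mat_def 1 mult.commute)
qed

lemma matrix_diff_ldistrib: "A ** (B - C) = A ** B - A ** C"
  and matrix_diff_rdistrib: "(B - C) ** A = B ** A - C ** A"
  for A B C :: "'a::comm_ring_1^'m::finite^'m"
  by (simp_all add: vec_eq_iff matrix_matrix_mult_def algebra_simps sum_subtractf)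

text \<open>Conjugation by \<open>P\<close> is carried out over polynomial matrices, where the
  determinant of X - W lives; det \<open>?Q\<close> and det \<open>?P\<close> cancel because their
  product is 1.\<close>

lemma charpoly_eigenbasis:
  fixes W :: "real^'m^'m"
  assumes orth: "orthogonal_matrix P" and eig: "W ** P = P ** (\<chi> i j. if i = j then d i else 0)"
  shows "charpoly W = (\<Prod>i\<in>UNIV. [:- d i, 1:])"
proof -
  let ?D = "\<chi> i j. if i = j then d i else 0" and ?X = "mat [:0, 1:] :: real poly^'m^'m"
  let ?P = "const_mat P" and ?Q = "const_mat (transpose P)"
  have QP: "?Q ** ?P = mat 1"
    using orth by (simp add: orthogonal_matrix_def const_mat_one flip: const_mat_mult)
  have "(?X - const_mat W) ** ?P = ?P ** (?X - const_mat ?D)"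
    by (simp add: matrix_diff_ldistrib matrix_diff_rdistrib mat_commute[of _ ?P] eig flip: const_mat_mult)
  then have "?Q ** ((?X - const_mat W) ** ?P) = ?X - const_mat ?D"
    by (simp add: matrix_mul_assoc QP)
  then have "det ?Q * (det (?X - const_mat W) * det ?P) = det (?X - const_mat ?D)"
    by (simp only: det_mul[symmetric])
  moreover have "det ?Q * det ?P = 1"
    by (simp only: det_mul[symmetric] QP det_I)
  then have "det (?X - const_mat W) = det ?Q * (det (?X - const_mat W) * det ?P)"
    by (simp add: mult.left_commute[of "det ?Q"])
  ultimately have "charpoly W = det (?X - const_mat ?D)"
    by (simp only: charpoly_eq)
  also have "\<dots> = (\<Prod>i\<in>UNIV. (?X - const_mat ?D) $ i $ i)"
    by (rule det_diagonal) (simp add: mat_def const_mat_def)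
  finally show ?thesis by (simp add: mat_def const_mat_def)
qed

text \<open>Links the sorted root list behind \<open>mixing_rate\<close> to the eigenvalues of a
  concrete basis, with multiplicities.\<close>

lemma proots_charpoly_eigenbasis:
  fixes W :: "real^'m^'m"
  assumes "orthogonal_matrix P" "W ** P = P ** (\<chi> i j. if i = j then d i else 0)"
  shows "proots (charpoly W) = image_mset d (mset_set UNIV)"
proof -
  have "proots (\<Prod>i\<in>UNIV. [:- d i, 1:]) = (\<Sum>i\<in>UNIV. proots [:- d i, 1:])"
    by (rule proots_prod) auto
  also have "\<dots> = (\<Sum>i\<in>UNIV. {#d i#})" by simp
  also have "\<dots> = image_mset d (mset_set UNIV)"
    by (simp add: sum_unfold_sum_mset)
  finally show ?thesis by (simp add: charpoly_eigenbasis[OF assms])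
qed

section \<open>Consensus rate of a doubly stochastic matrix\<close>

context
  fixes W :: "real^'m::finite^'m"
  assumes sym: "transpose W = W" and ds: "doubly_stochastic W"
begin

lemma W_nonneg: "0 \<le> W $ i $ j" and W_row_sum: "(\<Sum>j\<in>UNIV. W $ i $ j) = 1"
  and W_col_sum: "(\<Sum>i\<in>UNIV. W $ i $ j) = 1"
  using ds by (auto simp: doubly_stochastic_def)

lemma W_one: "W *v 1 = 1"
  by (simp add: vec_eq_iff matrix_vector_mult_def W_row_sum)

text \<open>Read the eigenvalue equation at an entry of largest modulus: a row of \<open>W\<close>
  forms a convex combination.\<close>

lemma eigenvalue_abs_le_one:
  assumes "W *v b = d *\<^sub>R b" "b \<noteq> 0"
  shows "\<bar>d\<bar> \<le> 1"
proof -
  have "Max (range (\<lambda>j. \<bar>b $ j\<bar>)) \<in> range (\<lambda>j. \<bar>b $ j\<bar>)" by (rule Max_in) auto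
  then obtain i where "Max (range (\<lambda>j. \<bar>b $ j\<bar>)) = \<bar>b $ i\<bar>" unfolding image_iff by blast
  then have max: "\<bar>b $ j\<bar> \<le> \<bar>b $ i\<bar>" for j
    using Max_ge[of "range (\<lambda>j. \<bar>b $ j\<bar>)" "\<bar>b $ j\<bar>"] by simp
  obtain j where "b $ j \<noteq> 0" using assms(2) by (auto simp: vec_eq_iff)
  then have pos: "0 < \<bar>b $ i\<bar>" using max[of j] by auto
  have "\<bar>d\<bar> * \<bar>b $ i\<bar> = \<bar>\<Sum>j\<in>UNIV. W $ i $ j * b $ j\<bar>"
    using arg_cong[OF assms(1), of "\<lambda>v. v $ i"] by (simp add: matrix_vector_mult_def abs_mult)
  also have "\<dots> \<le> (\<Sum>j\<in>UNIV. W $ i $ j * \<bar>b $ i\<bar>)"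
    by (rule order_trans[OF sum_abs])
       (auto intro!: sum_mono mult_left_mono max simp: abs_mult W_nonneg)
  also have "\<dots> = \<bar>b $ i\<bar>" by (simp add: W_row_sum flip: sum_distrib_right)
  finally show ?thesis using pos by simp
qed

text \<open>The index \<open>i0\<close> carries the normalised all-ones vector, so one copy of the
  eigenvalue 1 is singled out even when 1 is a multiple eigenvalue. Indexing by the agents makes the
  basis a square matrix.\<close>

lemma consensus_eigenbasis:
  obtains e d i0 where
    "\<And>i j :: 'm. e i \<bullet> e j = (if i = j then 1 else 0)" "\<And>i. W *v e i = d i *\<^sub>R e i"
    "d i0 = 1" "\<And>v. v \<bullet> 1 = 0 \<Longrightarrow> e i0 \<bullet> v = 0"
proof -
  let ?S = "{v :: real^'m. 1 \<bullet> v = 0}"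
  have one: "(1 :: real^'m) \<noteq> 0" by (simp add: vec_eq_iff)
  have "1 \<bullet> (W *v v) = 0" if "1 \<bullet> v = 0" for v
    using that by (simp add: symmetric_matrix_inner[OF sym] W_one)
  then obtain B where B: "finite B" "card B = dim ?S" "B \<subseteq> ?S" "pairwise orthogonal B"
    "\<forall>b\<in>B. norm b = 1 \<and> (\<exists>d. W *v b = d *\<^sub>R b)"
    using symmetric_matrix_eigenbasis[OF sym subspace_hyperplane[of 1]] by blast
  define u where "u = (1 / norm (1 :: real^'m)) *\<^sub>R (1 :: real^'m)"
  have u: "norm u = 1" "W *v u = 1 *\<^sub>R u" using one by (auto simp: u_def matrix_vector_mult_scaleR W_one)
  have uB: "u \<bullet> b = 0" if "b \<in> B" for b using B(3) that by (auto simp: u_def)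
  then have "u \<notin> B" using u by (auto simp: norm_eq_1)
  then have "card (insert u B) = CARD('m)"
    using B(1,2) dim_hyperplane[OF one] by simp
  then obtain e where e: "bij_betw e (UNIV :: 'm set) (insert u B)"
    using B(1) by (metis finite finite_insert finite_same_card_bij)
  then obtain i0 where i0: "e i0 = u" by (metis bij_betw_iff_bijections insertI1)
  have eB: "e i \<in> insert u B" for i using e by (auto simp: bij_betw_def)
  have "\<exists>d. W *v e i = d *\<^sub>R e i" for i
    using eB[of i] B(5) u(2) by (metis insertE)
  then obtain d where d: "\<And>i. W *v e i = d i *\<^sub>R e i" by metis
  have "d i0 *\<^sub>R u = 1 *\<^sub>R u" using d[of i0] u i0 by simp
  moreover have "u \<noteq> 0" using u by auto
  ultimately have "d i0 = 1" using scaleR_cancel_right by blast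
  moreover have "e i \<bullet> e j = (if i = j then 1 else 0)" for i j
  proof (cases "i = j")
    case True
    then show ?thesis using eB[of i] u B(5) by (auto simp: norm_eq_1)
  next
    case False
    then have "e i \<noteq> e j" using e by (auto simp: bij_betw_def inj_def)
    then show ?thesis
      using False eB[of i] eB[of j] uB uB[THEN inner_commute[THEN trans]] B(4)
      by (auto simp: pairwise_def orthogonal_def)
  qed
  moreover have "e i0 \<bullet> v = 0" if "v \<bullet> 1 = 0" for v
    using that by (simp add: i0 u_def inner_commute)
  ultimately show ?thesis using that d by blast
qed

lemma
  assumes N: "2 \<le> CARD('m)"
  shows mixing_rate_le_one: "mixing_rate W \<le> 1"
    and mixing_rate_contraction: "v \<bullet> 1 = 0 \<Longrightarrow> norm (W *v v) \<le> mixing_rate W * norm v"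
proof -
  obtain e d i0 where e: "\<And>i j :: 'm. e i \<bullet> e j = (if i = j then 1 else 0)"
    and d: "\<And>i. W *v e i = d i *\<^sub>R e i"
    and i0: "d i0 = 1" "\<And>v. v \<bullet> 1 = 0 \<Longrightarrow> e i0 \<bullet> v = 0"
    using consensus_eigenbasis by blast
  define P where "P = (\<chi> i j. e j $ i)"
  have Pt: "transpose P *v w = (\<chi> i. e i \<bullet> w)" for w
    by (simp add: vec_eq_iff P_def transpose_def matrix_vector_mult_def inner_vec_def)
  have orth: "orthogonal_matrix P"
    unfolding orthogonal_matrix
    using e by (simp add: vec_eq_iff P_def transpose_def matrix_matrix_mult_def mat_def inner_vec_def)
  have "W ** P = P ** (\<chi> i j. if i = j then d i else 0)"
  proof -
    have "(\<Sum>k\<in>UNIV. W $ i $ k * e j $ k) = e j $ i * d j" for i j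
      using arg_cong[OF d[of j], of "\<lambda>v. v $ i"] by (simp add: matrix_vector_mult_def)
    then show ?thesis
      by (simp add: vec_eq_iff P_def matrix_matrix_mult_def if_distrib cong: if_cong)
  qed
  from proots_charpoly_eigenbasis[OF orth this]
  have roots: "proots (charpoly W) = image_mset d (mset_set UNIV)" .
  have "e i \<noteq> 0" for i
    using e[of i i] by auto
  then have d1: "\<bar>d i\<bar> \<le> 1" for i
    by (rule eigenvalue_abs_le_one[OF d])
  define ds where "ds = rev (sorted_list_of_multiset (proots (charpoly W)))"
  have mset_ds: "mset ds = image_mset d (mset_set UNIV)" by (simp add: ds_def roots)
  have sorted: "sorted (rev ds)" by (simp add: ds_def)
  have len: "length ds = CARD('m)"
    using arg_cong[OF mset_ds, of size] by simp
  have set_ds: "set ds = range d"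
    using arg_cong[OF mset_ds, of set_mset] by simp
  \<comment> \<open>\<open>nth_eigenvalue\<close> counts from 1 and list positions from 0, so the
    second and the last eigenvalue sit at positions 1 and \<open>CARD('m) - 1\<close>.\<close>
  have \<beta>: "mixing_rate W = max \<bar>ds ! 1\<bar> \<bar>ds ! (CARD('m) - 1)\<bar>"
    by (simp add: mixing_rate_def nth_eigenvalue_def ds_def)
  have "ds ! k \<in> range d" if "k < CARD('m)" for k
    using that len set_ds nth_mem by metis
  then have "\<bar>ds ! k\<bar> \<le> 1" if "k < CARD('m)" for k
    using that d1 by fastforce
  with N show "mixing_rate W \<le> 1" unfolding \<beta> by auto
  \<comment> \<open>The head of the decreasing list is 1. Deleting it removes exactly one copy of
    \<open>d i0\<close>, so every other \<open>d i\<close> occurs at a position from 1 on and lies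
    between the entries at positions 1 and \<open>CARD('m) - 1\<close>.\<close>
  have d_le: "\<bar>d i\<bar> \<le> mixing_rate W" if "i \<noteq> i0" for i
  proof -
    obtain x ds' where ds': "ds = x # ds'" using len N by (cases ds) auto
    have "1 \<in> set ds" using i0(1) set_ds by (metis rangeI)
    then obtain k where "k < length ds" "ds ! k = 1" by (metis in_set_conv_nth)
    then have "1 \<le> x" using sorted_rev_nth_mono[OF sorted, of 0 k] ds' by simp
    moreover have "x \<le> 1" using d1 set_ds ds' by (metis abs_le_D1 image_iff list.set_intros(1))
    ultimately have "x = 1" by simp
    moreover have "mset ds = add_mset 1 (image_mset d (mset_set (UNIV - {i0})))"
      unfolding mset_ds by (subst mset_set.remove[of _ i0]) (simp_all add: i0)
    ultimately have "mset ds' = image_mset d (mset_set (UNIV - {i0}))"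
      using ds' by simp
    from arg_cong[OF this, of set_mset] have "d i \<in> set ds'" using that by auto
    then obtain k where "k < length ds'" "ds' ! k = d i" by (metis in_set_conv_nth)
    then have k: "Suc k < length ds" "ds ! Suc k = d i" using ds' by auto
    have "d i \<le> ds ! 1" "ds ! (CARD('m) - 1) \<le> d i"
      using sorted_rev_nth_mono[OF sorted, of 1 "Suc k"] sorted_rev_nth_mono[OF sorted, of "Suc k" "CARD('m) - 1"]
        k len by auto
    then show ?thesis unfolding \<beta> by auto
  qed
  show "norm (W *v v) \<le> mixing_rate W * norm v" if v: "v \<bullet> 1 = 0"
  proof -
    have \<beta>0: "0 \<le> mixing_rate W" by (simp add: mixing_rate_def)
    have parseval: "(norm w)\<^sup>2 = (\<Sum>i\<in>UNIV. (e i \<bullet> w)\<^sup>2)" for w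
    proof -
      have "orthogonal_transformation ((*v) (transpose P))"
        using orth orthogonal_matrix_transpose[of P] by (simp add: orthogonal_transformation_matrix)
      then have "norm (transpose P *v w) = norm w" by (rule orthogonal_transformation_norm)
      then show ?thesis
        unfolding Pt by (simp add: norm_vec_def L2_set_def sum_nonneg flip: power2_eq_iff)
    qed
    have "(norm (W *v v))\<^sup>2 = (\<Sum>i\<in>UNIV. (d i * (e i \<bullet> v))\<^sup>2)"
      by (simp add: parseval symmetric_matrix_inner[OF sym] d)
    also have "\<dots> \<le> (\<Sum>i\<in>UNIV. (mixing_rate W * (e i \<bullet> v))\<^sup>2)"
    proof (rule sum_mono)
      fix i
      show "(d i * (e i \<bullet> v))\<^sup>2 \<le> (mixing_rate W * (e i \<bullet> v))\<^sup>2"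
      proof (cases "i = i0")
        case False
        then have "\<bar>d i * (e i \<bullet> v)\<bar> \<le> \<bar>mixing_rate W * (e i \<bullet> v)\<bar>"
          using d_le[of i] by (auto simp: abs_mult intro!: mult_right_mono)
        then show ?thesis by (simp only: abs_le_square_iff)
      qed (simp add: i0(2)[OF v])
    qed
    also have "\<dots> = (mixing_rate W * norm v)\<^sup>2"
      by (simp add: parseval power_mult_distrib sum_distrib_left)
    finally show ?thesis
      by (rule power2_le_imp_le) (simp add: \<beta>0)
  qed
qed

end

section \<open>The exponentiated gradient step\<close>

locale exp_step =
  fixes U :: "'n::finite set" and y g :: "real^'n" and \<eta> G :: real
  assumes y_pos: "\<And>a. a \<in> U \<Longrightarrow> 0 < y $ a" and y_sum: "(\<Sum>a\<in>U. y $ a) \<le> 1"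
    and g_nonneg: "\<And>a. a \<in> U \<Longrightarrow> 0 \<le> g $ a" and g_le: "\<And>a. a \<in> U \<Longrightarrow> g $ a \<le> G"
    and \<eta>_nonneg: "0 \<le> \<eta>" and G_nonneg: "0 \<le> G"
begin

definition total :: real where
  "total = (\<Sum>a\<in>U. y $ a * exp (\<eta> * g $ a))"

text \<open>The logarithm of the normaliser, or 0 if none is applied; with it both cases of the
  update read \<open>y $ a * exp (k a)\<close>.\<close>

definition shift :: real where
  "shift = (if total \<le> 1 then 0 else ln total)"

definition new :: "real^'n" where
  "new = exp_update U \<eta> y g"

definition k :: "'n \<Rightarrow> real" where
  "k a = \<eta> * g $ a - shift"

lemma new_outside: "a \<notin> U \<Longrightarrow> new $ a = y $ a"
  by (simp add: new_def exp_update_def Let_def)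

lemma new_inside: "a \<in> U \<Longrightarrow> new $ a = y $ a * exp (k a)"
  by (simp add: new_def exp_update_def Let_def k_def shift_def total_def[symmetric] exp_diff)

lemma new_pos: "a \<in> U \<Longrightarrow> 0 < new $ a"
  by (simp add: new_inside y_pos)

lemma shift_nonneg: "0 \<le> shift"
  by (simp add: shift_def)

lemma gain_bounds: "a \<in> U \<Longrightarrow> 0 \<le> \<eta> * g $ a" "a \<in> U \<Longrightarrow> \<eta> * g $ a \<le> \<eta> * G"
  using \<eta>_nonneg by (auto intro!: mult_left_mono g_nonneg g_le mult_nonneg_nonneg)

lemma new_sum: "(\<Sum>a\<in>U. new $ a) = total * exp (- shift)"
  by (simp add: new_inside k_def exp_diff total_def exp_minus sum_distrib_right divide_inverse mult.assoc)

text \<open>Complementary slackness: \<open>shift\<close> acts as the multiplier of the constraint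
  that the block mass is at most 1, and it is nonzero only when the new mass equals 1.\<close>

lemma new_sum_le: "(\<Sum>a\<in>U. new $ a) \<le> 1" and shift_new_sum: "shift * (\<Sum>a\<in>U. new $ a) = shift"
  by (auto simp: new_sum shift_def exp_minus)

lemma shift_le: "shift \<le> \<eta> * G"
proof (cases "total \<le> 1")
  case False
  have "total \<le> (\<Sum>a\<in>U. y $ a * exp (\<eta> * G))"
    unfolding total_def by (intro sum_mono mult_left_mono) (auto simp: gain_bounds less_imp_le y_pos)
  also have "\<dots> \<le> 1 * exp (\<eta> * G)"
    unfolding sum_distrib_right[symmetric] using y_sum by (rule mult_right_mono) simp
  finally show ?thesis
    using False ln_mono[of total "exp (\<eta> * G)"] by (simp add: shift_def)
qed (simp add: shift_def \<eta>_nonneg G_nonneg)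

lemma new_diff: "a \<in> U \<Longrightarrow> new $ a - y $ a = new $ a * (1 - exp (- k a))"
  by (simp add: new_inside algebra_simps exp_minus)

text \<open>An entry that grows moves by at most its new value times \<eta> G -
  \<open>shift\<close>, one that shrinks by at most its old value times \<open>shift\<close>. Both
  vectors have mass at most 1 on the block, so the two bounds add up to \<eta> G.\<close>

lemma l1_step: "(\<Sum>a\<in>U. \<bar>new $ a - y $ a\<bar>) \<le> \<eta> * G"
proof -
  have "\<bar>new $ a - y $ a\<bar> \<le> new $ a * (\<eta> * G - shift) + y $ a * shift" if a: "a \<in> U" for a
  proof (cases "0 \<le> k a")
    case True
    have "0 \<le> new $ a - y $ a"
      using True new_pos[OF a] by (simp add: new_diff[OF a])
    moreover have "new $ a - y $ a \<le> new $ a * (\<eta> * G - shift)"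
    proof -
      have "1 - exp (- k a) \<le> \<eta> * G - shift"
        using exp_ge_add_one_self[of "- k a"] gain_bounds(2)[OF a] unfolding k_def by linarith
      then show ?thesis
        unfolding new_diff[OF a] using new_pos[OF a] by (intro mult_left_mono) auto
    qed
    moreover have "0 \<le> y $ a * shift" using y_pos[OF a] shift_nonneg by simp
    ultimately show ?thesis by simp
  next
    case False
    have eq: "y $ a - new $ a = y $ a * (1 - exp (k a))"
      by (simp add: new_inside[OF a] algebra_simps)
    have "0 \<le> y $ a - new $ a"
      using False y_pos[OF a] by (simp add: eq)
    moreover have "y $ a - new $ a \<le> y $ a * shift"
    proof -
      have "1 - exp (k a) \<le> shift"
        using exp_ge_add_one_self[of "k a"] gain_bounds(1)[OF a] unfolding k_def by linarith
      then show ?thesis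
        unfolding eq using y_pos[OF a] by (intro mult_left_mono) auto
    qed
    moreover have "0 \<le> new $ a * (\<eta> * G - shift)" using new_pos[OF a] shift_le by simp
    ultimately show ?thesis by simp
  qed
  then have "(\<Sum>a\<in>U. \<bar>new $ a - y $ a\<bar>) \<le> (\<Sum>a\<in>U. new $ a * (\<eta> * G - shift) + y $ a * shift)"
    by (rule sum_mono)
  also have "\<dots> = (\<Sum>a\<in>U. new $ a) * (\<eta> * G - shift) + (\<Sum>a\<in>U. y $ a) * shift"
    by (simp add: sum.distrib sum_distrib_right)
  also have "\<dots> \<le> 1 * (\<eta> * G - shift) + 1 * shift"
    using new_sum_le y_sum shift_le shift_nonneg by (intro add_mono mult_right_mono) auto
  finally show ?thesis by simp
qed

text \<open>Up to a common constant, the two pairs of sums are the Bregman divergences of the negative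
  entropy from the indicator vector of \<open>A \<inter> U\<close> to \<open>new\<close> and to \<open>y\<close>.\<close>

lemma divergence_step:
  assumes A: "card (A \<inter> U) \<le> 1"
  shows "(\<Sum>a\<in>A \<inter> U. - ln (new $ a)) + (\<Sum>a\<in>U. new $ a)
    \<le> (\<Sum>a\<in>A \<inter> U. - ln (y $ a)) + (\<Sum>a\<in>U. y $ a)
      - \<eta> * ((\<Sum>a\<in>A \<inter> U. g $ a) - (\<Sum>a\<in>U. g $ a * y $ a)) + (\<eta> * G)\<^sup>2"
proof -
  let ?h = "\<lambda>a. \<eta> * g $ a"
  have "(\<Sum>a\<in>A \<inter> U. - ln (new $ a)) = (\<Sum>a\<in>A \<inter> U. - ln (y $ a) - ?h a + shift)"
  proof (rule sum.cong[OF refl])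
    fix a assume "a \<in> A \<inter> U"
    then show "- ln (new $ a) = - ln (y $ a) - ?h a + shift"
      using y_pos[of a] by (simp add: new_inside ln_mult_pos k_def)
  qed
  also have "\<dots> = (\<Sum>a\<in>A \<inter> U. - ln (y $ a)) - \<eta> * (\<Sum>a\<in>A \<inter> U. g $ a) + card (A \<inter> U) * shift"
    by (simp add: sum.distrib sum_subtractf sum_distrib_left)
  \<comment> \<open>At most one chosen action of the block pays the log-normaliser;
    \<open>shift_new_sum\<close> gives the same amount back in the estimate of the masses.\<close>
  also have "card (A \<inter> U) * shift \<le> 1 * shift"
    using A shift_nonneg by (intro mult_right_mono) auto
  finally have 1: "(\<Sum>a\<in>A \<inter> U. - ln (new $ a))
      \<le> (\<Sum>a\<in>A \<inter> U. - ln (y $ a)) - \<eta> * (\<Sum>a\<in>A \<inter> U. g $ a) + shift" by simp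
  have "(\<Sum>a\<in>U. new $ a) - (\<Sum>a\<in>U. y $ a) = (\<Sum>a\<in>U. new $ a * (1 - exp (- k a)))"
    by (simp add: new_diff flip: sum_subtractf)
  also have "\<dots> \<le> (\<Sum>a\<in>U. new $ a * k a)"
  proof (intro sum_mono mult_left_mono)
    fix a assume "a \<in> U"
    then show "0 \<le> new $ a" using new_pos[of a] by simp
    show "1 - exp (- k a) \<le> k a" using exp_ge_add_one_self[of "- k a"] by linarith
  qed
  also have "\<dots> = (\<Sum>a\<in>U. new $ a * ?h a) - shift * (\<Sum>a\<in>U. new $ a)"
    by (simp add: k_def right_diff_distrib sum_subtractf mult.commute flip: sum_distrib_left)
  finally have 2: "(\<Sum>a\<in>U. new $ a) + shift \<le> (\<Sum>a\<in>U. y $ a) + (\<Sum>a\<in>U. new $ a * ?h a)"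
    by (simp add: shift_new_sum)
  \<comment> \<open>Measuring the gain at \<open>new\<close> instead of \<open>y\<close> is a
    second-order error: \<open>1 - exp (- k a)\<close> and \<open>?h a\<close> are each at most
    \<eta> G.\<close>
  have "(\<Sum>a\<in>U. new $ a * ?h a) - (\<Sum>a\<in>U. y $ a * ?h a) = (\<Sum>a\<in>U. new $ a * ((1 - exp (- k a)) * ?h a))"
    by (simp add: new_diff[symmetric] left_diff_distrib[symmetric] mult.assoc[symmetric] flip: sum_subtractf)
  also have "\<dots> \<le> (\<Sum>a\<in>U. new $ a * (\<eta> * G)\<^sup>2)"
  proof (intro sum_mono mult_left_mono)
    fix a assume a: "a \<in> U"
    have "1 - exp (- k a) \<le> ?h a"
      using exp_ge_add_one_self[of "- k a"] shift_nonneg unfolding k_def by linarith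
    then have "(1 - exp (- k a)) * ?h a \<le> (\<eta> * G) * (\<eta> * G)"
      by - (rule mult_mono; use gain_bounds[OF a] in linarith)
    then show "(1 - exp (- k a)) * ?h a \<le> (\<eta> * G)\<^sup>2" by (simp add: power2_eq_square)
  qed (simp add: new_pos less_imp_le)
  also have "\<dots> = (\<Sum>a\<in>U. new $ a) * (\<eta> * G)\<^sup>2" by (simp add: sum_distrib_right)
  also have "\<dots> \<le> 1 * (\<eta> * G)\<^sup>2" by (intro mult_right_mono new_sum_le) simp
  finally have 3: "(\<Sum>a\<in>U. new $ a * ?h a) \<le> (\<Sum>a\<in>U. y $ a * ?h a) + (\<eta> * G)\<^sup>2" by simp
  have "(\<Sum>a\<in>U. y $ a * ?h a) = \<eta> * (\<Sum>a\<in>U. g $ a * y $ a)"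
    by (simp add: sum_distrib_left algebra_simps)
  with 1 2 3 show ?thesis by (simp add: right_diff_distrib)
qed

end

section \<open>Disagreement between the agents\<close>

text \<open>Orthogonal projection onto the complement of the all-ones vector, the subspace on which
  \<open>mixing_rate_contraction\<close> applies.\<close>

definition deviation :: "real^'m::finite \<Rightarrow> real^'m" where
  "deviation v = v - ((\<Sum>i\<in>UNIV. v $ i) / CARD('m)) *\<^sub>R 1"

lemma deviation_add: "deviation (u + v) = deviation u + deviation v"
  by (simp add: deviation_def sum.distrib add_divide_distrib scaleR_add_left)

lemma deviation_scaleR: "deviation (r *\<^sub>R v) = r *\<^sub>R deviation v"
  by (simp add: deviation_def scaleR_diff_right flip: sum_distrib_left)

lemma deviation_one: "deviation (1 :: real^'m::finite) = 0"
  by (simp add: deviation_def)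

lemma deviation_orthogonal: "deviation v \<bullet> 1 = 0"
  by (simp add: deviation_def inner_vec_def sum_subtractf)

lemma norm_deviation_le: "norm (deviation v) \<le> norm v"
proof -
  define m where "m = ((\<Sum>i\<in>UNIV. v $ i) / CARD('a))"
  have v: "v = deviation v + m *\<^sub>R 1" by (simp add: deviation_def m_def)
  have "orthogonal (deviation v) (m *\<^sub>R 1)"
    by (simp add: orthogonal_def deviation_orthogonal)
  from norm_add_Pythagorean[OF this]
  have "(norm (deviation v))\<^sup>2 \<le> (norm v)\<^sup>2"
    by (simp flip: v)
  then show ?thesis
    by (rule power2_le_imp_le) simp
qed

text \<open>Two entries are involved, and (p - q)^2 \<le> 2 (p^2 + q^2). The resulting sqrt 2 is
  later absorbed by sqrt N.\<close>

lemma entry_diff_le_deviation: "\<bar>v $ i - v $ j\<bar> \<le> sqrt 2 * norm (deviation v)"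
proof (cases "i = j")
  case False
  let ?u = "deviation v"
  have "v $ i - v $ j = ?u $ i - ?u $ j" by (simp add: deviation_def)
  moreover have "(?u $ i - ?u $ j)\<^sup>2 \<le> 2 * (norm ?u)\<^sup>2"
  proof -
    have "(?u $ i)\<^sup>2 + (?u $ j)\<^sup>2 = (\<Sum>k\<in>{i, j}. (?u $ k)\<^sup>2)" using False by simp
    also have "\<dots> \<le> (\<Sum>k\<in>UNIV. (?u $ k)\<^sup>2)" by (rule sum_mono2) auto
    also have "\<dots> = (norm ?u)\<^sup>2" by (simp add: norm_vec_def L2_set_def sum_nonneg)
    finally show ?thesis
      using zero_le_power2[of "?u $ i + ?u $ j"] by (simp add: power2_diff power2_sum)
  qed
  ultimately have "\<bar>v $ i - v $ j\<bar>\<^sup>2 \<le> (sqrt 2 * norm ?u)\<^sup>2" by (simp add: power_mult_distrib)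
  then show ?thesis by (rule power2_le_imp_le) simp
qed simp

locale consensus = action_blocks V
  for V :: "'m::finite \<Rightarrow> 'n::finite set" +
  fixes nbr :: "'m \<Rightarrow> 'm \<Rightarrow> bool" and W :: "real^'m^'m" and \<gamma> :: real
  assumes agents: "2 \<le> CARD('m)" and sym: "transpose W = W" and ds: "doubly_stochastic W"
    and support: "\<not> nbr i j \<Longrightarrow> j \<noteq> i \<Longrightarrow> W $ i $ j = 0"
    and \<gamma>_pos: "0 < \<gamma>" and \<gamma>_less: "\<gamma> < 1"
begin

abbreviation \<beta> :: real where "\<beta> \<equiv> mixing_rate W"
abbreviation mix :: "('m \<Rightarrow> real^'n) \<Rightarrow> 'm \<Rightarrow> real^'n" where "mix \<equiv> y_mix nbr W \<gamma>"

lemma \<beta>_nonneg: "0 \<le> \<beta>"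
  by (simp add: mixing_rate_def)

lemma \<beta>_le_one: "\<beta> \<le> 1"
  by (rule mixing_rate_le_one[OF sym ds agents])

lemma N_ge_2: "2 \<le> real CARD('m)" and n_pos: "0 < real CARD('n)"
  using agents by auto

definition column :: "('m \<Rightarrow> real^'n) \<Rightarrow> 'n \<Rightarrow> real^'m" where
  "column x a = (\<chi> i. x i $ a)"

definition disagreement :: "('m \<Rightarrow> real^'n) \<Rightarrow> real" where
  "disagreement x = (\<Sum>a\<in>UNIV. norm (deviation (column x a)))"

lemma column_nth [simp]: "column x a $ i = x i $ a"
  by (simp add: column_def)

lemma disagreement_nonneg: "0 \<le> disagreement x"
  by (simp add: disagreement_def sum_nonneg)

lemma x_hat_nth: "x_hat \<gamma> v $ a = (1 - \<gamma>) * v $ a + \<gamma> / real CARD('n)" for v :: "real^'n"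
  by (simp add: x_hat_def)

lemma mix_nth: "mix x i $ a = (\<Sum>j\<in>UNIV. W $ i $ j * x_hat \<gamma> (x j) $ a)"
proof -
  have "mix x i = (\<Sum>j\<in>UNIV. (W $ i $ j) *\<^sub>R x_hat \<gamma> (x j))"
    unfolding y_mix_def by (rule sum.mono_neutral_left) (auto simp: support)
  then show ?thesis by simp
qed

lemma mix_nth_column: "mix x i $ a = (1 - \<gamma>) * (W *v column x a) $ i + \<gamma> / real CARD('n)"
  using W_row_sum[OF sym ds, of i]
  by (simp add: mix_nth x_hat_nth distrib_left sum.distrib matrix_vector_mult_def sum_distrib_left
      mult.left_commute flip: sum_distrib_right sum_divide_distrib)

lemma x_hat_feasible:
  assumes "v \<in> feasible V"
  shows "x_hat \<gamma> v \<in> feasible V"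
proof (rule feasibleI)
  note v = unit_cubeD[OF feasible_unit_cube[OF assms]]
  show "0 \<le> x_hat \<gamma> v $ a" for a
    using v \<gamma>_pos \<gamma>_less by (simp add: x_hat_nth)
  show "(\<Sum>a\<in>V i. x_hat \<gamma> v $ a) \<le> 1" for i
  proof -
    have "(\<Sum>a\<in>V i. x_hat \<gamma> v $ a) = (1 - \<gamma>) * (\<Sum>a\<in>V i. v $ a) + \<gamma> * (card (V i) / real CARD('n))"
      by (simp add: x_hat_nth sum.distrib sum_distrib_left)
    also have "\<dots> \<le> (1 - \<gamma>) * 1 + \<gamma> * 1"
      using \<gamma>_pos \<gamma>_less feasible_sum[OF assms] n_pos card_mono[of UNIV "V i"]
      by (intro add_mono mult_left_mono) auto
    finally show ?thesis by simp
  qed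
qed

lemma mix_feasible:
  assumes "\<And>i. x i \<in> feasible V"
  shows "mix x i \<in> feasible V"
proof (rule feasibleI)
  note W = W_nonneg[OF sym ds] W_row_sum[OF sym ds]
  note hat = x_hat_feasible[OF assms]
  show "0 \<le> mix x i $ a" for a
    unfolding mix_nth using unit_cubeD[OF feasible_unit_cube[OF hat]] W by (intro sum_nonneg mult_nonneg_nonneg)
  show "(\<Sum>a\<in>V k. mix x i $ a) \<le> 1" for k
  proof -
    have "(\<Sum>a\<in>V k. mix x i $ a) = (\<Sum>j\<in>UNIV. W $ i $ j * (\<Sum>a\<in>V k. x_hat \<gamma> (x j) $ a))"
      unfolding mix_nth sum_distrib_left by (rule sum.swap)
    also have "\<dots> \<le> (\<Sum>j\<in>UNIV. W $ i $ j * 1)"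
      by (intro sum_mono mult_left_mono feasible_sum hat W)
    finally show ?thesis by (simp add: W)
  qed
qed

lemma mix_ge:
  assumes "\<And>i. x i \<in> feasible V"
  shows "\<gamma> / real CARD('n) \<le> mix x i $ a"
proof -
  have "0 \<le> (W *v column x a) $ i"
    unfolding matrix_vector_mult_def using unit_cubeD[OF feasible_unit_cube[OF assms]] W_nonneg[OF sym ds]
    by (auto intro!: sum_nonneg)
  then show ?thesis using \<gamma>_less by (simp add: mix_nth_column)
qed

lemma mix_pos: "(\<And>i. x i \<in> feasible V) \<Longrightarrow> 0 < mix x i $ a"
  using mix_ge[of x i a] \<gamma>_pos n_pos by (smt (verit) divide_pos_pos)

lemma deviation_mult: "deviation (W *v v) = W *v deviation v"
proof -
  have "(\<Sum>i\<in>UNIV. (W *v v) $ i) = (\<Sum>j\<in>UNIV. (\<Sum>i\<in>UNIV. W $ i $ j) * v $ j)"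
    unfolding matrix_vector_mult_def by (simp add: sum_distrib_right) (rule sum.swap)
  then have "(\<Sum>i\<in>UNIV. (W *v v) $ i) = (\<Sum>j\<in>UNIV. v $ j)"
    by (simp add: W_col_sum[OF sym ds])
  then show ?thesis
    by (simp add: deviation_def matrix_vector_mult_diff_distrib matrix_vector_mult_scaleR W_one[OF sym ds])
qed

lemma norm_deviation_mult: "norm (W *v deviation v) \<le> \<beta> * norm (deviation v)"
  by (rule mixing_rate_contraction[OF sym ds agents deviation_orthogonal])

text \<open>The price of measuring the gain at mixed vectors although the gradients are sampled at
  unmixed ones. \<open>W\<close> fixes the mean of each column, which cancels; the deviations before
  and after averaging remain, hence the factor 2, and the uniform part adds \<gamma>.\<close>

lemma inner_mix_le:
  assumes x: "\<And>i. x i \<in> feasible V" and g: "\<And>i a. 0 \<le> g i $ a" "\<And>i a. g i $ a \<le> G"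
  shows "(\<Sum>i\<in>UNIV. \<Sum>a\<in>V i. g i $ a * (mix x i $ a - x i $ a)) \<le> G * (2 * disagreement x + \<gamma>)"
proof -
  have "g i $ a * (mix x i $ a - x i $ a) \<le> G * (2 * norm (deviation (column x a)) + \<gamma> / real CARD('n))" for i a
  proof -
    let ?c = "column x a" and ?d = "deviation (column x a)"
    define m where "m = (\<Sum>i\<in>UNIV. ?c $ i) / CARD('m)"
    have c: "?c = ?d + m *\<^sub>R 1" by (simp add: deviation_def m_def)
    then have "W *v ?c = W *v ?d + m *\<^sub>R 1"
      by (metis W_one[OF sym ds] matrix_vector_mult_scaleR matrix_vector_right_distrib)
    then have "(W *v ?c) $ i - ?c $ i = (W *v ?d) $ i - ?d $ i"
      by (subst (2) c) simp
    also have "\<dots> \<le> norm (W *v ?d) + norm ?d"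
      using component_le_norm_cart[of "W *v ?d" i] component_le_norm_cart[of ?d i] by linarith
    also have "\<dots> \<le> 1 * norm ?d + norm ?d"
      using order_trans[OF norm_deviation_mult mult_right_mono[OF \<beta>_le_one norm_ge_zero]] by simp
    finally have "(W *v ?c) $ i - x i $ a \<le> 2 * norm ?d" by simp
    then have "(1 - \<gamma>) * ((W *v ?c) $ i - x i $ a) \<le> (1 - \<gamma>) * (2 * norm ?d)"
      using \<gamma>_less by (intro mult_left_mono) auto
    also have "\<dots> \<le> 1 * (2 * norm ?d)"
      using \<gamma>_pos by (intro mult_right_mono) auto
    finally have "(1 - \<gamma>) * ((W *v ?c) $ i - x i $ a) \<le> 2 * norm ?d" by simp
    moreover have "0 \<le> \<gamma> * x i $ a"
      using \<gamma>_pos unit_cubeD(1)[OF feasible_unit_cube[OF x]] by simp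
    ultimately have le: "mix x i $ a - x i $ a \<le> 2 * norm ?d + \<gamma> / real CARD('n)"
      by (simp add: mix_nth_column algebra_simps)
    have "g i $ a * (mix x i $ a - x i $ a) \<le> g i $ a * (2 * norm ?d + \<gamma> / real CARD('n))"
      by (intro mult_left_mono le g)
    also have "\<dots> \<le> G * (2 * norm ?d + \<gamma> / real CARD('n))"
      using \<gamma>_pos by (intro mult_right_mono g) (auto intro!: add_nonneg_nonneg)
    finally show ?thesis .
  qed
  then have "(\<Sum>i\<in>UNIV. \<Sum>a\<in>V i. g i $ a * (mix x i $ a - x i $ a))
      \<le> (\<Sum>i\<in>UNIV. \<Sum>a\<in>V i. G * (2 * norm (deviation (column x a)) + \<gamma> / real CARD('n)))"
    by (intro sum_mono)
  also have "\<dots> = G * (2 * disagreement x + \<gamma>)"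
    unfolding sum_blocks[of "\<lambda>_ a. G * (2 * norm (deviation (column x a)) + \<gamma> / real CARD('n))"]
    by (simp add: disagreement_def sum.distrib sum_distrib_left algebra_simps)
  finally show ?thesis .
qed

lemma l1_combined_le: "l1norm (combined x - x i) \<le> sqrt 2 * disagreement x"
proof -
  have "l1norm (combined x - x i) = (\<Sum>a\<in>UNIV. \<bar>column x a $ owner a - column x a $ i\<bar>)"
    by (simp add: l1norm_def)
  also have "\<dots> \<le> sqrt 2 * disagreement x"
    unfolding disagreement_def sum_distrib_left by (intro sum_mono entry_diff_le_deviation)
  finally show ?thesis .
qed

text \<open>Only the owner of an action perturbs the corresponding column, so the perturbation of the
  column has the same norm as the owner's step.\<close>

lemma disagreement_step:
  assumes step: "\<And>i a. a \<notin> V i \<Longrightarrow> x' i $ a = mix x i $ a"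
  shows "disagreement x'
    \<le> (\<beta> - \<beta> * \<gamma>) * disagreement x + (\<Sum>i\<in>UNIV. \<Sum>a\<in>V i. \<bar>x' i $ a - mix x i $ a\<bar>)"
proof -
  have "norm (deviation (column x' a))
      \<le> (\<beta> - \<beta> * \<gamma>) * norm (deviation (column x a)) + \<bar>x' (owner a) $ a - mix x (owner a) $ a\<bar>" for a
  proof -
    define r where "r = x' (owner a) $ a - mix x (owner a) $ a"
    let ?d = "deviation (column x a)"
    have "column x' a = (1 - \<gamma>) *\<^sub>R (W *v column x a) + (\<gamma> / real CARD('n)) *\<^sub>R 1 + r *\<^sub>R axis (owner a) 1"
    proof -
      have "x' i $ a = mix x i $ a + (if i = owner a then r else 0)" for i
        using step[of a i] by (auto simp: in_block_iff r_def)
      then show ?thesis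
        by (auto simp: vec_eq_iff mix_nth_column axis_def)
    qed
    then have "deviation (column x' a) = (1 - \<gamma>) *\<^sub>R (W *v ?d) + r *\<^sub>R deviation (axis (owner a) 1)"
      by (simp only: deviation_add deviation_scaleR deviation_one deviation_mult scaleR_zero_right add_0_right)
    then have "norm (deviation (column x' a))
        \<le> norm ((1 - \<gamma>) *\<^sub>R (W *v ?d)) + norm (r *\<^sub>R deviation (axis (owner a) (1::real) :: real^'m))"
      by (metis norm_triangle_ineq)
    also have "\<dots> = (1 - \<gamma>) * norm (W *v ?d) + \<bar>r\<bar> * norm (deviation (axis (owner a) (1::real) :: real^'m))"
      using \<gamma>_less by simp
    also have "\<dots> \<le> (1 - \<gamma>) * (\<beta> * norm ?d) + \<bar>r\<bar> * norm (axis (owner a) (1::real) :: real^'m)"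
      using \<gamma>_less by (intro add_mono mult_left_mono norm_deviation_mult norm_deviation_le) auto
    finally show ?thesis by (simp add: algebra_simps r_def)
  qed
  then have "disagreement x' \<le> (\<Sum>a\<in>UNIV. (\<beta> - \<beta> * \<gamma>) * norm (deviation (column x a))
      + \<bar>x' (owner a) $ a - mix x (owner a) $ a\<bar>)"
    unfolding disagreement_def by (rule sum_mono)
  then show ?thesis
    unfolding sum_blocks[of "\<lambda>i a. \<bar>x' i $ a - mix x i $ a\<bar>"]
    by (simp add: disagreement_def sum.distrib sum_distrib_left)
qed

text \<open>Initially an action has weight only in its owner's vector, so its column has norm 1 / |V
  i| and each block contributes at most 1.\<close>

lemma disagreement_init: "disagreement (x_init V) \<le> real CARD('m)"
proof -
  have "norm (deviation (column (x_init V) a)) \<le> 1 / card (V (owner a))" for a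
  proof -
    have "column (x_init V) a = (1 / card (V (owner a))) *\<^sub>R axis (owner a) 1"
      by (auto simp: vec_eq_iff x_init_def in_block_iff axis_def)
    then have "norm (column (x_init V) a) \<le> 1 / card (V (owner a))" by simp
    then show ?thesis using norm_deviation_le order_trans by blast
  qed
  then have "disagreement (x_init V) \<le> (\<Sum>a\<in>UNIV. 1 / card (V (owner a)))"
    unfolding disagreement_def by (rule sum_mono)
  also have "\<dots> = (\<Sum>i\<in>UNIV. \<Sum>a\<in>V i. 1 / card (V i))"
    by (rule sum_blocks[symmetric])
  also have "\<dots> = real CARD('m)" using V_nonempty by (simp add: card_eq_0_iff)
  finally show ?thesis .
qed

end

section \<open>The Bregman potential\<close>

context consensus
begin

text \<open>The sum over the agents of the Bregman divergence of the negative entropy between the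
  indicator vector of \<open>A\<close> and the agent's vector.\<close>

definition potential :: "'n set \<Rightarrow> ('m \<Rightarrow> real^'n) \<Rightarrow> real" where
  "potential A y = (\<Sum>i\<in>UNIV. (\<Sum>a\<in>A. - ln (y i $ a) - 1) + (\<Sum>a\<in>UNIV. y i $ a))"

lemma sum_W_average: "(\<Sum>i\<in>UNIV. \<Sum>j\<in>UNIV. W $ i $ j * h j) = (\<Sum>j\<in>UNIV. h j)"
  by (subst sum.swap) (simp add: W_col_sum[OF sym ds] flip: sum_distrib_right)

text \<open>Jensen's inequality for the logarithm along a row of \<open>W\<close>; the shrinking by
  1 - \<gamma> inside \<open>x_hat\<close> costs \<open>- ln (1 - \<gamma>)\<close>.\<close>

lemma minus_ln_mix_le:
  assumes x: "\<And>i. x i \<in> feasible V" and pos: "\<And>i. 0 < x i $ a"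
  shows "- ln (mix x i $ a) \<le> (\<Sum>j\<in>UNIV. W $ i $ j * (- ln (x j $ a) - ln (1 - \<gamma>)))"
proof -
  let ?h = "\<lambda>j. x_hat \<gamma> (x j) $ a"
  have ge: "(1 - \<gamma>) * x j $ a \<le> ?h j" for j
    using \<gamma>_pos by (simp add: x_hat_nth)
  have "0 < (1 - \<gamma>) * x j $ a" for j using pos \<gamma>_less by simp
  then have hpos: "0 < ?h j" for j using ge[of j] by (meson less_le_trans)
  have "(\<Sum>j\<in>UNIV. W $ i $ j * ln (?h j)) \<le> ln (\<Sum>j\<in>UNIV. W $ i $ j *\<^sub>R ?h j)"
    using hpos W_row_sum[OF sym ds] W_nonneg[OF sym ds]
    by (intro concave_on_sum[OF _ _ ln_concave]) auto
  then have "- ln (mix x i $ a) \<le> (\<Sum>j\<in>UNIV. W $ i $ j * (- ln (?h j)))"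
    by (simp add: mix_nth sum_negf)
  also have "\<dots> \<le> (\<Sum>j\<in>UNIV. W $ i $ j * (- ln (x j $ a) - ln (1 - \<gamma>)))"
  proof (intro sum_mono mult_left_mono W_nonneg[OF sym ds])
    fix j
    have "ln ((1 - \<gamma>) * x j $ a) \<le> ln (?h j)"
      using ge hpos pos \<gamma>_less by simp
    moreover have "ln ((1 - \<gamma>) * x j $ a) = ln (1 - \<gamma>) + ln (x j $ a)"
      using pos[of j] \<gamma>_less by (simp add: ln_mult_pos)
    ultimately show "- ln (?h j) \<le> - ln (x j $ a) - ln (1 - \<gamma>)" by simp
  qed
  finally show ?thesis .
qed

text \<open>The source of \<open>C3\<close>. Column sums 1 make the averaged logarithms add up to
  the original ones. The shrinking is paid by N agents for at most N chosen actions each, and the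
  uniform part adds mass at most \<gamma> per agent.\<close>

lemma potential_mix_le:
  assumes x: "\<And>i. x i \<in> feasible V" and pos: "\<And>i a. 0 < x i $ a" and A: "card A \<le> CARD('m)"
  shows "potential A (mix x)
    \<le> potential A x + (real CARD('m))\<^sup>2 * (- ln (1 - \<gamma>)) + real CARD('m) * \<gamma>"
proof -
  let ?l = "- ln (1 - \<gamma>)"
  have l: "0 \<le> ?l" using \<gamma>_pos \<gamma>_less by simp
  have "(\<Sum>i\<in>UNIV. \<Sum>a\<in>A. - ln (mix x i $ a)) = (\<Sum>a\<in>A. \<Sum>i\<in>UNIV. - ln (mix x i $ a))"
    by (rule sum.swap)
  also have "\<dots> \<le> (\<Sum>a\<in>A. \<Sum>i\<in>UNIV. \<Sum>j\<in>UNIV. W $ i $ j * (- ln (x j $ a) - ln (1 - \<gamma>)))"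
    by (intro sum_mono minus_ln_mix_le x pos)
  also have "\<dots> = (\<Sum>a\<in>A. \<Sum>j\<in>UNIV. - ln (x j $ a) - ln (1 - \<gamma>))"
    unfolding sum_W_average ..
  also have "\<dots> = (\<Sum>j\<in>UNIV. \<Sum>a\<in>A. - ln (x j $ a)) + card A * (real CARD('m) * ?l)"
    by (subst sum.swap) (simp add: sum_subtractf algebra_simps)
  also have "\<dots> \<le> (\<Sum>j\<in>UNIV. \<Sum>a\<in>A. - ln (x j $ a)) + real CARD('m) * (real CARD('m) * ?l)"
    using l A by (intro add_left_mono mult_right_mono mult_nonneg_nonneg) auto
  finally have 1: "(\<Sum>i\<in>UNIV. \<Sum>a\<in>A. - ln (mix x i $ a))
      \<le> (\<Sum>j\<in>UNIV. \<Sum>a\<in>A. - ln (x j $ a)) + (real CARD('m))\<^sup>2 * ?l"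
    by (simp add: power2_eq_square)
  have "(\<Sum>i\<in>UNIV. \<Sum>a\<in>UNIV. mix x i $ a) = (\<Sum>a\<in>UNIV. \<Sum>i\<in>UNIV. mix x i $ a)"
    by (rule sum.swap)
  also have "\<dots> = (\<Sum>a\<in>UNIV. \<Sum>j\<in>UNIV. x_hat \<gamma> (x j) $ a)"
    unfolding mix_nth sum_W_average ..
  also have "\<dots> = (\<Sum>j\<in>UNIV. \<Sum>a\<in>UNIV. x_hat \<gamma> (x j) $ a)"
    by (rule sum.swap)
  also have "\<dots> \<le> (\<Sum>j\<in>UNIV. (\<Sum>a\<in>UNIV. x j $ a) + \<gamma>)"
  proof (rule sum_mono)
    fix j
    have "(\<Sum>a\<in>UNIV. x_hat \<gamma> (x j) $ a) = (1 - \<gamma>) * (\<Sum>a\<in>UNIV. x j $ a) + \<gamma>"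
      by (simp add: x_hat_nth sum.distrib sum_distrib_left)
    moreover have "0 \<le> \<gamma> * (\<Sum>a\<in>UNIV. x j $ a)"
      using \<gamma>_pos pos by (intro mult_nonneg_nonneg sum_nonneg) (auto intro: less_imp_le)
    ultimately show "(\<Sum>a\<in>UNIV. x_hat \<gamma> (x j) $ a) \<le> (\<Sum>a\<in>UNIV. x j $ a) + \<gamma>"
      by (simp add: algebra_simps)
  qed
  also have "\<dots> = (\<Sum>j\<in>UNIV. \<Sum>a\<in>UNIV. x j $ a) + real CARD('m) * \<gamma>"
    by (simp add: sum.distrib)
  finally show ?thesis
    using 1 by (simp add: potential_def sum.distrib sum_subtractf)
qed

lemma sum_split_block: "(\<Sum>a\<in>A. h a) = (\<Sum>a\<in>A \<inter> U. h a) + (\<Sum>a\<in>A - U. h a)" for A U :: "'n set" and h :: "'n \<Rightarrow> real"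
  by (rule sum.Int_Diff) simp

lemma potential_exp_step:
  assumes y: "\<And>i. y i \<in> feasible V" and pos: "\<And>i a. 0 < y i $ a"
    and g: "\<And>i a. 0 \<le> g i $ a" "\<And>i a. g i $ a \<le> G" and \<eta>: "0 \<le> \<eta>"
    and A: "\<And>i. card (A \<inter> V i) \<le> 1"
  shows "potential A (\<lambda>i. exp_update (V i) \<eta> (y i) (g i))
    \<le> potential A y - \<eta> * (\<Sum>i\<in>UNIV. (\<Sum>a\<in>A \<inter> V i. g i $ a) - (\<Sum>a\<in>V i. g i $ a * y i $ a))
      + real CARD('m) * (\<eta> * G)\<^sup>2"
proof -
  let ?D = "\<lambda>v. (\<Sum>a\<in>A. - ln (v $ a) - 1) + (\<Sum>a\<in>UNIV. v $ a)"
  have "?D (exp_update (V i) \<eta> (y i) (g i))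
      \<le> ?D (y i) - \<eta> * ((\<Sum>a\<in>A \<inter> V i. g i $ a) - (\<Sum>a\<in>V i. g i $ a * y i $ a)) + (\<eta> * G)\<^sup>2" for i
  proof -
    interpret exp_step "V i" "y i" "g i" \<eta> G
      using feasible_sum[OF y] pos g \<eta> order_trans[OF g] by unfold_locales auto
    have out: "(\<Sum>a\<in>B - V i. h (new $ a)) = (\<Sum>a\<in>B - V i. h (y i $ a))" for B and h :: "real \<Rightarrow> real"
      by (rule sum.cong) (auto simp: new_outside)
    have "(\<Sum>a\<in>A. - ln (new $ a)) + (\<Sum>a\<in>UNIV. new $ a)
      \<le> (\<Sum>a\<in>A. - ln (y i $ a)) + (\<Sum>a\<in>UNIV. y i $ a)
        - \<eta> * ((\<Sum>a\<in>A \<inter> V i. g i $ a) - (\<Sum>a\<in>V i. g i $ a * y i $ a)) + (\<eta> * G)\<^sup>2"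
      using divergence_step[OF A] out[of "\<lambda>r. - ln r" A] out[of "\<lambda>r. r" UNIV]
        sum_split_block[of "\<lambda>a. - ln (new $ a)" A "V i"] sum_split_block[of "\<lambda>a. new $ a" UNIV "V i"]
        sum_split_block[of "\<lambda>a. - ln (y i $ a)" A "V i"] sum_split_block[of "\<lambda>a. y i $ a" UNIV "V i"]
      unfolding Int_UNIV_left by linarith
    then show ?thesis by (simp add: new_def sum_subtractf)
  qed
  then have "potential A (\<lambda>i. exp_update (V i) \<eta> (y i) (g i))
    \<le> (\<Sum>i\<in>UNIV. ?D (y i) - \<eta> * ((\<Sum>a\<in>A \<inter> V i. g i $ a) - (\<Sum>a\<in>V i. g i $ a * y i $ a)) + (\<eta> * G)\<^sup>2)"
    unfolding potential_def by (rule sum_mono)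
  also have "\<dots> = (\<Sum>i\<in>UNIV. ?D (y i))
      - (\<Sum>i\<in>UNIV. \<eta> * ((\<Sum>a\<in>A \<inter> V i. g i $ a) - (\<Sum>a\<in>V i. g i $ a * y i $ a)))
      + real CARD('m) * (\<eta> * G)\<^sup>2"
    by (subst sum.distrib, subst sum_subtractf) simp
  finally show ?thesis by (simp add: potential_def sum_distrib_left)
qed

lemma minus_ln_le:
  assumes "\<gamma> / real CARD('n) \<le> r"
  shows "- ln r \<le> ln (real CARD('n) / \<gamma>)"
proof -
  have "0 < \<gamma> / real CARD('n)" using \<gamma>_pos n_pos by simp
  with assms have "ln (\<gamma> / real CARD('n)) \<le> ln r"
    by (rule ln_mono)
  then show ?thesis using \<gamma>_pos by (simp add: ln_div)
qed

text \<open>With l = ln (n / \<gamma>), each agent contributes at most N (l - 1) from the logarithms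
  and at most N from its mass, together N l. The bound l \<ge> 1 lets N replace
  \<open>card A\<close>.\<close>

lemma potential_le:
  assumes y: "\<And>i. y i \<in> feasible V" and ge: "\<And>i a. \<gamma> / real CARD('n) \<le> y i $ a"
    and A: "card A \<le> CARD('m)" and ln: "1 \<le> ln (real CARD('n) / \<gamma>)"
  shows "potential A y \<le> real CARD('m) * (real CARD('m) * ln (real CARD('n) / \<gamma>))"
proof -
  let ?l = "ln (real CARD('n) / \<gamma>)"
  have "(\<Sum>a\<in>A. - ln (y i $ a) - 1) + (\<Sum>a\<in>UNIV. y i $ a) \<le> real CARD('m) * ?l" for i
  proof -
    have "(\<Sum>a\<in>A. - ln (y i $ a) - 1) \<le> (\<Sum>a\<in>A. ?l - 1)"
      by (intro sum_mono diff_right_mono minus_ln_le ge)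
    also have "\<dots> \<le> real CARD('m) * (?l - 1)"
      using A ln by (simp add: mult_right_mono)
    finally show ?thesis using feasible_l1[OF y, of i] by (simp add: right_diff_distrib)
  qed
  then have "potential A y \<le> (\<Sum>i\<in>(UNIV :: 'm set). real CARD('m) * ?l)"
    unfolding potential_def by (rule sum_mono)
  then show ?thesis by simp
qed

lemma potential_nonneg:
  assumes pos: "\<And>i a. 0 < y i $ a"
  shows "0 \<le> potential A y"
  unfolding potential_def
proof (rule sum_nonneg)
  fix i
  have "(\<Sum>a\<in>A. - (y i $ a)) \<le> (\<Sum>a\<in>A. - ln (y i $ a) - 1)"
  proof (rule sum_mono)
    fix a
    show "- (y i $ a) \<le> - ln (y i $ a) - 1" using ln_le_minus_one[OF pos[of i a]] by linarith
  qed
  moreover have "(\<Sum>a\<in>A. y i $ a) \<le> (\<Sum>a\<in>UNIV. y i $ a)"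
    using pos by (intro sum_mono2) (auto intro: less_imp_le)
  ultimately show "0 \<le> (\<Sum>a\<in>A. - ln (y i $ a) - 1) + (\<Sum>a\<in>UNIV. y i $ a)"
    by (simp add: sum_negf)
qed

text \<open>Per agent, an action entering the comparator adds at most ln (n / \<gamma>), since
  entries are at least \<gamma> / n. An action leaving it removes a term no lower than -1, and
  \<open>ln\<close> makes the same allowance cover that.\<close>

lemma potential_path_le:
  assumes y: "\<And>i. y i \<in> feasible V" and ge: "\<And>i a. \<gamma> / real CARD('n) \<le> y i $ a"
    and ln: "1 \<le> ln (real CARD('n) / \<gamma>)"
  shows "potential A' y
    \<le> potential A y + real CARD('m) * ln (real CARD('n) / \<gamma>) * card (sym_diff A' A)"
proof -
  let ?l = "ln (real CARD('n) / \<gamma>)"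
  have "(\<Sum>a\<in>A'. - ln (y i $ a) - 1) \<le> (\<Sum>a\<in>A. - ln (y i $ a) - 1) + card (sym_diff A' A) * ?l" for i
  proof -
    let ?h = "\<lambda>a. - ln (y i $ a) - 1"
    have pos: "0 < y i $ a" for a
      using ge[of i a] \<gamma>_pos n_pos by (meson divide_pos_pos less_le_trans)
    have "(\<Sum>a\<in>A' - A. ?h a) \<le> (\<Sum>a\<in>A' - A. ?l)"
    proof (rule sum_mono)
      fix a
      show "?h a \<le> ?l" using minus_ln_le[OF ge[of i a]] by linarith
    qed
    moreover have "- (\<Sum>a\<in>A - A'. ?h a) \<le> (\<Sum>a\<in>A - A'. ?l)"
      unfolding sum_negf[symmetric]
    proof (rule sum_mono)
      fix a
      have "ln (y i $ a) \<le> 0"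
        using pos unit_cubeD[OF feasible_unit_cube[OF y]] by simp
      with ln show "- ?h a \<le> ?l" by simp
    qed
    moreover have "(\<Sum>a\<in>A' - A. ?l) + (\<Sum>a\<in>A - A'. ?l) = card (sym_diff A' A) * ?l"
      by (subst card_Un_disjoint) (auto simp: algebra_simps)
    ultimately show ?thesis
      using sum_split_block[of ?h A' A] sum_split_block[of ?h A A', unfolded Int_commute[of A A']]
      by linarith
  qed
  then have "potential A' y \<le> (\<Sum>i\<in>UNIV. (\<Sum>a\<in>A. - ln (y i $ a) - 1) + card (sym_diff A' A) * ?l
      + (\<Sum>a\<in>UNIV. y i $ a))"
    unfolding potential_def by (intro sum_mono add_right_mono)
  also have "\<dots> = potential A y + real CARD('m) * ?l * card (sym_diff A' A)"
    by (simp add: potential_def sum.distrib)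
  finally show ?thesis .
qed

section \<open>Decentralised gradients\<close>

text \<open>Each coordinate's gradient is moved from \<open>combined x\<close> to its owner's
  vector, at l1 distance at most sqrt 2 times the disagreement. This error is uniform over the
  coordinates and is paired with a difference of two feasible points, which brings in the
  diameter.\<close>

lemma decentralised_gradient:
  assumes x: "\<And>i. x i \<in> feasible V" and A: "\<And>i. card (A \<inter> V i) \<le> 1" and K: "0 \<le> K"
    and Lip: "\<And>u v a. u \<in> unit_cube \<Longrightarrow> v \<in> unit_cube \<Longrightarrow> \<bar>s u $ a - s v $ a\<bar> \<le> K * l1norm (u - v)"
  shows "(\<Sum>a\<in>UNIV. s (combined x) $ a * (indicator_vec A $ a - combined x $ a))
    \<le> (\<Sum>i\<in>UNIV. (\<Sum>a\<in>A \<inter> V i. s (x i) $ a) - (\<Sum>a\<in>V i. s (x i) $ a * x i $ a))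
      + K * (sqrt 2 * disagreement x) * l1_diameter (feasible V)"
proof -
  let ?w = "combined x" and ?u = "indicator_vec A :: real^'n"
  let ?e = "K * (sqrt 2 * disagreement x)"
  have wf: "?w \<in> feasible V" by (rule combined_feasible[OF x])
  have e: "0 \<le> ?e" using K disagreement_nonneg by simp
  have "(\<Sum>a\<in>UNIV. s ?w $ a * (?u $ a - ?w $ a)) \<le> (\<Sum>a\<in>UNIV. s (x (owner a)) $ a * (?u $ a - ?w $ a) + ?e * \<bar>?u $ a - ?w $ a\<bar>)"
  proof (rule sum_mono)
    fix a
    have "\<bar>s ?w $ a - s (x (owner a)) $ a\<bar> \<le> K * l1norm (?w - x (owner a))"
      by (intro Lip feasible_unit_cube wf x)
    also have "\<dots> \<le> ?e" by (intro mult_left_mono l1_combined_le K)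
    finally have "\<bar>s ?w $ a - s (x (owner a)) $ a\<bar> * \<bar>?u $ a - ?w $ a\<bar> \<le> ?e * \<bar>?u $ a - ?w $ a\<bar>"
      by (intro mult_right_mono) auto
    moreover have "(s ?w $ a - s (x (owner a)) $ a) * (?u $ a - ?w $ a)
        \<le> \<bar>s ?w $ a - s (x (owner a)) $ a\<bar> * \<bar>?u $ a - ?w $ a\<bar>"
      by (metis abs_ge_self abs_mult)
    ultimately have "(s ?w $ a - s (x (owner a)) $ a) * (?u $ a - ?w $ a) \<le> ?e * \<bar>?u $ a - ?w $ a\<bar>"
      by linarith
    then show "s ?w $ a * (?u $ a - ?w $ a) \<le> s (x (owner a)) $ a * (?u $ a - ?w $ a) + ?e * \<bar>?u $ a - ?w $ a\<bar>"
      by (simp only: left_diff_distrib)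
  qed
  also have "\<dots> = (\<Sum>a\<in>UNIV. s (x (owner a)) $ a * (?u $ a - ?w $ a)) + ?e * l1norm (?u - ?w)"
    by (simp only: sum.distrib sum_distrib_left l1norm_def vector_minus_component)
  also have "\<dots> \<le> (\<Sum>a\<in>UNIV. s (x (owner a)) $ a * (?u $ a - ?w $ a)) + ?e * l1_diameter (feasible V)"
    by (intro add_left_mono mult_left_mono l1_le_diameter indicator_vec_feasible A wf e)
  also have "(\<Sum>a\<in>UNIV. s (x (owner a)) $ a * (?u $ a - ?w $ a))
      = (\<Sum>a\<in>A. s (x (owner a)) $ a) - (\<Sum>a\<in>UNIV. s (x (owner a)) $ a * x (owner a) $ a)"
  proof -
    have "(\<Sum>a\<in>UNIV. s (x (owner a)) $ a * (?u $ a - ?w $ a))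
        = (\<Sum>a\<in>UNIV. (if a \<in> A then s (x (owner a)) $ a else 0) - s (x (owner a)) $ a * x (owner a) $ a)"
      by (rule sum.cong) (auto simp: right_diff_distrib)
    then show ?thesis by (simp add: sum_subtractf sum.If_cases)
  qed
  also have "\<dots> = (\<Sum>i\<in>UNIV. \<Sum>a\<in>A \<inter> V i. s (x i) $ a) - (\<Sum>i\<in>UNIV. \<Sum>a\<in>V i. s (x i) $ a * x i $ a)"
    by (simp only: sum_blocks[of "\<lambda>i a. s (x i) $ a * x i $ a"] sum_blocks_subset[of "\<lambda>i a. s (x i) $ a"])
  finally show ?thesis by (simp only: sum_subtractf)
qed

end

section \<open>The run of the algorithm\<close>

lemma finite_stoch_grad: "finite (set_pmf (stoch_grad_pmf c h x))" for x :: "real^'n::finite"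
  by (simp add: stoch_grad_pmf_def)

text \<open>Finite support makes every real function integrable and every expectation a finite sum,
  although the scale z is drawn continuously.\<close>

lemma finite_run: "finite (set_pmf (ma_osea nbr W V f c \<gamma> \<eta> t))"
  for V :: "'m::finite \<Rightarrow> 'n::finite set"
  by (induction t) (auto simp: set_Pi_pmf finite_PiE_dflt finite_stoch_grad)

text \<open>Assumption (A5) in the form the potential argument consumes: \<open>singleton_le\<close>
  bounds the gradients surely, and \<open>K\<close> stands for the reduced Lipschitz constant.
  Indices reach \<open>T+1\<close> because a round ends with the comparator and step size of the
  next one.\<close>

locale ma_osea_run = consensus V nbr W \<gamma>
  for V :: "'m::finite \<Rightarrow> 'n::finite set" and nbr W \<gamma> +
  fixes f :: "nat \<Rightarrow> 'n set \<Rightarrow> real" and Astar :: "nat \<Rightarrow> 'n set" and T :: nat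
    and \<eta> :: "nat \<Rightarrow> real" and c G K :: real
  assumes f_submodular: "t \<in> {1..T} \<Longrightarrow> monotone_submodular (f t)"
    and f_curvature: "t \<in> {1..T} \<Longrightarrow> curvature (f t) = c"
    and transversal: "t \<in> {1..T+1} \<Longrightarrow> card (Astar t \<inter> V i) \<le> 1"
    and \<eta>_pos: "t \<in> {1..T+1} \<Longrightarrow> 0 < \<eta> t" and \<eta>_antimono: "t \<in> {1..T} \<Longrightarrow> \<eta> (t+1) \<le> \<eta> t"
    and unbiased: "t \<in> {1..T} \<Longrightarrow> x \<in> unit_cube \<Longrightarrow>
          measure_pmf.expectation (stoch_grad_pmf c (f t) x) (\<lambda>g. g) = surrogate_grad c (f t) x"
    and singleton_le: "t \<in> {1..T} \<Longrightarrow> curv_ratio c * f t {a} \<le> G"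
    and K_nonneg: "0 \<le> K"
    and Lipschitz: "t \<in> {1..T} \<Longrightarrow> x \<in> unit_cube \<Longrightarrow> y \<in> unit_cube \<Longrightarrow>
          \<bar>surrogate_grad c (f t) x $ a - surrogate_grad c (f t) y $ a\<bar> \<le> K * l1norm (x - y)"
    and G_nonneg: "0 \<le> G"
    and ln_ge_one: "1 \<le> ln (real CARD('n) / \<gamma>)"
begin

abbreviation run :: "nat \<Rightarrow> ((nat \<Rightarrow> 'm \<Rightarrow> 'n) \<times> ('m \<Rightarrow> real^'n)) pmf" where
  "run \<equiv> ma_osea nbr W V f c \<gamma> \<eta>"

abbreviation actions :: "('m \<Rightarrow> real^'n) \<Rightarrow> ('m \<Rightarrow> 'n) pmf" where
  "actions x \<equiv> Pi_pmf UNIV undefined (\<lambda>i. action_pmf (V i) (x i))"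

abbreviation gradients :: "nat \<Rightarrow> ('m \<Rightarrow> real^'n) \<Rightarrow> ('m \<Rightarrow> real^'n) pmf" where
  "gradients t x \<equiv> Pi_pmf UNIV 0 (\<lambda>i. stoch_grad_pmf c (f t) (x i))"

definition advance :: "nat \<Rightarrow> ('m \<Rightarrow> real^'n) \<Rightarrow> ('m \<Rightarrow> real^'n) \<Rightarrow> 'm \<Rightarrow> real^'n" where
  "advance t x g = (\<lambda>i. exp_update (V i) (\<eta> t) (mix x i) (g i))"

text \<open>A deterministic majorant: the gradients are bounded by G on every sample path, so the
  disagreement can be controlled without expectations.\<close>

primrec disagreement_bound :: "nat \<Rightarrow> real" where
  "disagreement_bound 0 = real CARD('m)"
| "disagreement_bound (Suc t) =
     (\<beta> - \<beta> * \<gamma>) * disagreement_bound t + real CARD('m) * (\<eta> (Suc t) * G)"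

lemma \<beta>_mix_nonneg: "0 \<le> \<beta> - \<beta> * \<gamma>"
  using \<beta>_nonneg \<gamma>_less by (simp add: mult_left_le)

lemma card_transversal_le: "t \<in> {1..T+1} \<Longrightarrow> card (Astar t) \<le> CARD('m)"
  by (rule card_transversal[OF transversal])

lemma set_gradients: "g \<in> set_pmf (gradients t x) \<Longrightarrow> g i \<in> set_pmf (stoch_grad_pmf c (f t) (x i))"
  by (auto simp: set_Pi_pmf PiE_dflt_def)

lemma finite_gradients: "finite (set_pmf (gradients t x))"
  by (simp add: set_Pi_pmf finite_PiE_dflt finite_stoch_grad)

lemma stoch_grad_bounds:
  assumes t: "t \<in> {1..T}" and g: "g \<in> set_pmf (stoch_grad_pmf c (f t) x)"
  shows "0 \<le> g $ a" "g $ a \<le> G"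
proof -
  interpret monotone_submodular "f t" by (rule f_submodular[OF t])
  from g obtain R where "g = (\<chi> a. curv_ratio c * (f t (insert a R) - f t (R - {a})))"
    by (auto simp: stoch_grad_pmf_def)
  then have "g $ a = curv_ratio c * marginal (f t) a R"
    by (simp add: marginal_def)
  moreover have "curv_ratio c * marginal (f t) a R \<le> curv_ratio c * f t {a}"
    by (intro mult_left_mono marginal_le_singleton curv_ratio_nonneg)
  ultimately show "0 \<le> g $ a" "g $ a \<le> G"
    using singleton_le[OF t, of a] marginal_nonneg[of a R] curv_ratio_nonneg[of c] by auto
qed

lemmas gradients_bounds = stoch_grad_bounds[OF _ set_gradients]

lemma
  assumes t: "t \<in> {1..T}" and x: "\<And>i. x i \<in> feasible V" and g: "g \<in> set_pmf (gradients t x)"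
  shows advance_feasible: "advance t x g i \<in> feasible V"
    and advance_pos: "0 < advance t x g i $ a"
    and advance_disagreement: "disagreement (advance t x g)
      \<le> (\<beta> - \<beta> * \<gamma>) * disagreement x + real CARD('m) * (\<eta> t * G)"
proof -
  note y = mix_feasible[of x, OF x] and pos = mix_pos[of x, OF x]
  have \<eta>: "0 \<le> \<eta> t" using \<eta>_pos[of t] t by simp
  have step: "exp_step (V i) (mix x i) (g i) (\<eta> t) G" for i
    using feasible_sum[OF y] pos gradients_bounds[OF t g] \<eta> G_nonneg by unfold_locales auto
  have new: "exp_step.new (V i) (mix x i) (g i) (\<eta> t) = advance t x g i" for i
    using exp_step.new_def[OF step] by (simp add: advance_def)
  have out: "advance t x g i $ a = mix x i $ a" if "a \<notin> V i" for i a
    using exp_step.new_outside[OF step[of i] that] by (simp only: new)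
  show all_pos: "0 < advance t x g i $ a" for i a
    using exp_step.new_pos[OF step[of i], of a] out[of a i] pos[of i a] by (cases "a \<in> V i") (auto simp: new)
  show "advance t x g i \<in> feasible V"
  proof (rule feasibleI)
    show "0 \<le> advance t x g i $ a" for a using all_pos less_imp_le by blast
    show "(\<Sum>a\<in>V j. advance t x g i $ a) \<le> 1" for j :: 'm
    proof (cases "j = i")
      case True
      then show ?thesis using exp_step.new_sum_le[OF step[of i]] by (simp add: new)
    next
      case False
      then have "(\<Sum>a\<in>V j. advance t x g i $ a) = (\<Sum>a\<in>V j. mix x i $ a)"
        by (intro sum.cong refl out) (auto simp: in_block_iff)
      then show ?thesis using feasible_sum[OF y] by simp
    qed
  qed
  have "disagreement (advance t x g)
      \<le> (\<beta> - \<beta> * \<gamma>) * disagreement x + (\<Sum>i\<in>UNIV. \<Sum>a\<in>V i. \<bar>advance t x g i $ a - mix x i $ a\<bar>)"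
    by (rule disagreement_step[OF out])
  also have "(\<Sum>i\<in>UNIV. \<Sum>a\<in>V i. \<bar>advance t x g i $ a - mix x i $ a\<bar>) \<le> (\<Sum>i\<in>(UNIV :: 'm set). \<eta> t * G)"
    using exp_step.l1_step[OF step] by (intro sum_mono) (simp add: new)
  finally show "disagreement (advance t x g)
      \<le> (\<beta> - \<beta> * \<gamma>) * disagreement x + real CARD('m) * (\<eta> t * G)"
    by simp
qed

lemma x_init_feasible: "x_init V i \<in> feasible V" and x_init_sum: "(\<Sum>a\<in>V i. x_init V i $ a) = 1"
proof -
  have "(\<Sum>a\<in>V j. x_init V i $ a) = (if j = i then 1 else 0)" for j
  proof -
    have "(\<Sum>a\<in>V j. x_init V i $ a) = (\<Sum>a\<in>V j. if j = i then 1 / card (V i) else 0)"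
      by (rule sum.cong) (auto simp: x_init_def in_block_iff)
    then show ?thesis using V_nonempty[of i] by (auto simp: card_eq_0_iff)
  qed
  then show "(\<Sum>a\<in>V i. x_init V i $ a) = 1" "x_init V i \<in> feasible V"
    by (auto intro!: feasibleI) (simp add: x_init_def)
qed

text \<open>The initial vectors vanish outside the own block, so positivity is demanded only of the
  mass on that block; entrywise positivity comes from mixing.\<close>

lemma run_invariant:
  assumes "t \<le> T" "(acts, x) \<in> set_pmf (run t)"
  shows "(\<forall>i. x i \<in> feasible V) \<and> (\<forall>i. 0 < (\<Sum>a\<in>V i. x i $ a)) \<and> disagreement x \<le> disagreement_bound t"
  using assms
proof (induction t arbitrary: acts x)
  case 0
  then show ?case by (simp add: x_init_feasible x_init_sum disagreement_init)
next
  case (Suc t)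
  then obtain acts0 x0 g where x0: "(acts0, x0) \<in> set_pmf (run t)"
    and g: "g \<in> set_pmf (gradients (Suc t) x0)" and x: "x = advance (Suc t) x0 g"
    by (auto simp: advance_def)
  have t: "Suc t \<in> {1..T}" using Suc.prems by simp
  have IH: "\<And>i. x0 i \<in> feasible V" "disagreement x0 \<le> disagreement_bound t"
    using Suc.IH[OF _ x0] Suc.prems by auto
  note adv = advance_feasible[of _ x0, OF t IH(1) g] advance_pos[of _ x0, OF t IH(1) g] advance_disagreement[of _ x0, OF t IH(1) g]
  have "0 < (\<Sum>a\<in>V i. x i $ a)" for i
    unfolding x using adv(2) V_nonempty by (intro sum_pos) auto
  moreover have "disagreement x \<le> disagreement_bound (Suc t)"
    using adv(3) mult_left_mono[OF IH(2) \<beta>_mix_nonneg] unfolding x by simp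
  ultimately show ?case using adv(1) unfolding x by blast
qed

section \<open>The expected potential decreases\<close>

lemma expectation_gradient:
  assumes t: "t \<in> {1..T}" and x: "x i \<in> unit_cube"
  shows "measure_pmf.expectation (gradients t x) (\<lambda>g. g i $ a) = surrogate_grad c (f t) (x i) $ a"
proof -
  let ?p = "stoch_grad_pmf c (f t) (x i)"
  have "measure_pmf.expectation (gradients t x) (\<lambda>g. g i $ a)
      = measure_pmf.expectation (map_pmf (\<lambda>g. g i) (gradients t x)) (\<lambda>v. v $ a)"
    by simp
  also have "map_pmf (\<lambda>g. g i) (gradients t x) = ?p"
    by (subst Pi_pmf_component) auto
  also have "measure_pmf.expectation ?p (\<lambda>v. v $ a) = measure_pmf.expectation ?p (\<lambda>v. v) $ a"
    by (intro integral_bounded_linear bounded_linear_vec_nth integrable_measure_pmf_finite finite_stoch_grad)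
  finally show ?thesis by (simp add: unbiased[OF t x])
qed

lemma expectation_linear_gain:
  assumes t: "t \<in> {1..T}" and x: "\<And>i. x i \<in> unit_cube"
  shows "measure_pmf.expectation (gradients t x)
      (\<lambda>g. \<Sum>i\<in>UNIV. (\<Sum>a\<in>A \<inter> V i. g i $ a) - (\<Sum>a\<in>V i. g i $ a * x i $ a))
    = (\<Sum>i\<in>UNIV. (\<Sum>a\<in>A \<inter> V i. surrogate_grad c (f t) (x i) $ a)
        - (\<Sum>a\<in>V i. surrogate_grad c (f t) (x i) $ a * x i $ a))"
proof -
  have int: "integrable (measure_pmf (gradients t x)) h" for h :: "_ \<Rightarrow> real"
    by (rule integrable_measure_pmf_finite[OF finite_gradients])
  show ?thesis
    by (simp add: Bochner_Integration.integral_sum Bochner_Integration.integral_diff int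
        expectation_gradient[OF t x])
qed

definition comparator_bound :: real where
  "comparator_bound = real CARD('m) * ln (real CARD('n) / \<gamma>)"

text \<open>In this order: second-order error of the step; growth of the divergence under mixing;
  gain measured at mixed instead of unmixed vectors; gradients taken at the owners' vectors instead
  of the combined one.\<close>

definition round_error :: "nat \<Rightarrow> real" where
  "round_error t = real CARD('m) * \<eta> (Suc t) * G\<^sup>2
    + ((real CARD('m))\<^sup>2 * (- ln (1 - \<gamma>)) + real CARD('m) * \<gamma>) / \<eta> (Suc t)
    + G * (2 * disagreement_bound t + \<gamma>)
    + K * (sqrt 2 * disagreement_bound t) * l1_diameter (feasible V)"

text \<open>A round leads from mixed vectors through the exponential step to the next mixing. In
  this order \<open>potential_mix_le\<close> meets strictly positive vectors, although the initial
  ones have zeros.\<close>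

lemma expected_potential_step:
  assumes t: "Suc t \<in> {1..T}" and x: "\<And>i. x i \<in> feasible V"
  shows "measure_pmf.expectation (gradients (Suc t) x)
      (\<lambda>g. potential (Astar (Suc t)) (mix (advance (Suc t) x g)) / \<eta> (Suc t))
    \<le> potential (Astar (Suc t)) (mix x) / \<eta> (Suc t)
      - (\<Sum>i\<in>UNIV. (\<Sum>a\<in>Astar (Suc t) \<inter> V i. surrogate_grad c (f (Suc t)) (x i) $ a)
          - (\<Sum>a\<in>V i. surrogate_grad c (f (Suc t)) (x i) $ a * x i $ a))
      + G * (2 * disagreement x + \<gamma>) + real CARD('m) * \<eta> (Suc t) * G\<^sup>2
      + ((real CARD('m))\<^sup>2 * (- ln (1 - \<gamma>)) + real CARD('m) * \<gamma>) / \<eta> (Suc t)"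
proof -
  let ?t = "Suc t" and ?A = "Astar (Suc t)"
  let ?p = "gradients ?t x"
  let ?h = "\<eta> ?t"
  let ?M = "(real CARD('m))\<^sup>2 * (- ln (1 - \<gamma>)) + real CARD('m) * \<gamma>"
  let ?L = "\<lambda>g. \<Sum>i\<in>UNIV. (\<Sum>a\<in>?A \<inter> V i. g i $ a) - (\<Sum>a\<in>V i. g i $ a * x i $ a)"
  define R where "R = potential ?A (mix x) / ?h + G * (2 * disagreement x + \<gamma>) + real CARD('m) * ?h * G\<^sup>2 + ?M / ?h"
  have h: "0 < ?h" using \<eta>_pos[of ?t] t by simp
  have A: "\<And>i. card (?A \<inter> V i) \<le> 1" "card ?A \<le> CARD('m)"
    using transversal[of ?t] card_transversal_le[of ?t] t by auto
  have int: "integrable (measure_pmf ?p) u" for u :: "_ \<Rightarrow> real"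
    by (rule integrable_measure_pmf_finite[OF finite_gradients])
  have "potential ?A (mix (advance ?t x g)) / ?h \<le> R - ?L g" if g: "g \<in> set_pmf ?p" for g
  proof -
    let ?Y = "\<Sum>i\<in>UNIV. (\<Sum>a\<in>?A \<inter> V i. g i $ a) - (\<Sum>a\<in>V i. g i $ a * mix x i $ a)"
    let ?E = "\<Sum>i\<in>UNIV. \<Sum>a\<in>V i. g i $ a * (mix x i $ a - x i $ a)"
    have "potential ?A (mix (advance ?t x g)) \<le> potential ?A (advance ?t x g) + ?M"
      using potential_mix_le[of "advance ?t x g", OF advance_feasible[of _ x, OF t x g] advance_pos[of _ x, OF t x g] A(2)]
      by simp
    also have "\<dots> \<le> potential ?A (mix x) - ?h * ?Y + real CARD('m) * (?h * G)\<^sup>2 + ?M"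
      unfolding advance_def
      using h by (intro add_right_mono potential_exp_step mix_feasible x mix_pos gradients_bounds[OF t g] A) auto
    finally have "potential ?A (mix (advance ?t x g)) / ?h
        \<le> (potential ?A (mix x) - ?h * ?Y + real CARD('m) * (?h * G)\<^sup>2 + ?M) / ?h"
      using h by (intro divide_right_mono) auto
    also have "\<dots> = potential ?A (mix x) / ?h - ?Y + real CARD('m) * ?h * G\<^sup>2 + ?M / ?h"
      using h by (simp add: add_divide_distrib diff_divide_distrib power2_eq_square)
    \<comment> \<open>The step yields the gain at the mixed vectors; \<open>?E\<close> moves it to
      the unmixed ones, to match the pairing in \<open>decentralised_gradient\<close>.\<close>
    also have "?Y = ?L g - ?E"
      by (simp add: right_diff_distrib sum_subtractf)
    finally show ?thesis
      using inner_mix_le[of x g G, OF x gradients_bounds[OF t g]] unfolding R_def by linarith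
  qed
  then have "measure_pmf.expectation ?p (\<lambda>g. potential ?A (mix (advance ?t x g)) / ?h)
      \<le> measure_pmf.expectation ?p (\<lambda>g. R - ?L g)"
    by (rule expectation_mono_finite[OF finite_gradients])
  also have "\<dots> = R - measure_pmf.expectation ?p ?L"
    by (subst Bochner_Integration.integral_diff) (auto simp: int)
  finally show ?thesis
    unfolding expectation_linear_gain[of _ x, OF t feasible_unit_cube[OF x]] R_def by linarith
qed

lemma expected_round:
  assumes t: "Suc t \<in> {1..T}" and x: "\<And>i. x i \<in> feasible V"
    and pos: "\<And>i. 0 < (\<Sum>a\<in>V i. x i $ a)" and dis: "disagreement x \<le> disagreement_bound t"
  shows "curv_ratio c * f (Suc t) (Astar (Suc t))
      - measure_pmf.expectation (actions x) (\<lambda>a. f (Suc t) (\<Union>i. {a i}))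
      + measure_pmf.expectation (gradients (Suc t) x)
          (\<lambda>g. potential (Astar (Suc t)) (mix (advance (Suc t) x g)) / \<eta> (Suc t))
    \<le> potential (Astar (Suc t)) (mix x) / \<eta> (Suc t) + round_error t"
proof -
  let ?t = "Suc t" and ?A = "Astar (Suc t)" and ?s = "surrogate_grad c (f (Suc t))"
  interpret monotone_submodular "f ?t" by (rule f_submodular[OF t])
  have A: "\<And>i. card (?A \<inter> V i) \<le> 1" using transversal[of ?t] t by auto
  have "curv_ratio c * f ?t ?A - measure_pmf.expectation (actions x) (\<lambda>a. f ?t (\<Union>i. {a i}))
      \<le> curv_ratio c * f ?t ?A - mlext (f ?t) (combined x)"
    using mlext_le_expectation_actions[of _ x, OF f_submodular[OF t] x pos] by simp
  also have "\<dots> \<le> (\<Sum>a\<in>UNIV. ?s (combined x) $ a * (indicator_vec ?A $ a - combined x $ a))"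
    by (intro surrogate_grad_inner_ge f_curvature[OF t] feasible_unit_cube combined_feasible x)
  also have "\<dots> \<le> (\<Sum>i\<in>UNIV. (\<Sum>a\<in>?A \<inter> V i. ?s (x i) $ a) - (\<Sum>a\<in>V i. ?s (x i) $ a * x i $ a))
      + K * (sqrt 2 * disagreement x) * l1_diameter (feasible V)"
    by (intro decentralised_gradient x A K_nonneg Lipschitz[OF t])
  finally have 1: "curv_ratio c * f ?t ?A - measure_pmf.expectation (actions x) (\<lambda>a. f ?t (\<Union>i. {a i}))
      \<le> (\<Sum>i\<in>UNIV. (\<Sum>a\<in>?A \<inter> V i. ?s (x i) $ a) - (\<Sum>a\<in>V i. ?s (x i) $ a * x i $ a))
        + K * (sqrt 2 * disagreement x) * l1_diameter (feasible V)" .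
  have "K * (sqrt 2 * disagreement x) * l1_diameter (feasible V)
      \<le> K * (sqrt 2 * disagreement_bound t) * l1_diameter (feasible V)"
    by (intro mult_right_mono mult_left_mono dis K_nonneg l1_diameter_nonneg) simp
  moreover have "G * (2 * disagreement x + \<gamma>) \<le> G * (2 * disagreement_bound t + \<gamma>)"
    using dis by (intro mult_left_mono G_nonneg) simp
  ultimately show ?thesis
    using 1 expected_potential_step[of _ x, OF t x] unfolding round_error_def by linarith
qed

text \<open>A smaller step size enlarges potential / \<eta>. A uniform bound on the potential turns
  the increments of 1 / \<eta>, nonnegative by monotonicity, into a telescoping sum that ends in N
  \<open>C2\<close> / \<eta> at time T + 1.\<close>

lemma potential_change:
  assumes t: "t \<in> {1..T}" and x: "\<And>i. x i \<in> feasible V"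
  shows "potential (Astar (Suc t)) (mix x) / \<eta> (Suc t)
    \<le> potential (Astar t) (mix x) / \<eta> t
      + real CARD('m) * comparator_bound * (1 / \<eta> (Suc t) - 1 / \<eta> t)
      + comparator_bound * (card (sym_diff (Astar (Suc t)) (Astar t)) / \<eta> (Suc t))"
proof -
  let ?P = "potential (Astar t) (mix x)" and ?d = "card (sym_diff (Astar (Suc t)) (Astar t))"
  have \<eta>: "0 < \<eta> t" "0 < \<eta> (Suc t)" "\<eta> (Suc t) \<le> \<eta> t"
    using \<eta>_pos[of t] \<eta>_pos[of "Suc t"] \<eta>_antimono[of t] t by auto
  have "potential (Astar (Suc t)) (mix x) / \<eta> (Suc t) \<le> (?P + comparator_bound * ?d) / \<eta> (Suc t)"
    unfolding comparator_bound_def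
    using potential_path_le[of "mix x", OF mix_feasible[of x, OF x] mix_ge[of x, OF x] ln_ge_one] \<eta>
    by (intro divide_right_mono) auto
  also have "\<dots> = ?P / \<eta> t + ?P * (1 / \<eta> (Suc t) - 1 / \<eta> t) + comparator_bound * (?d / \<eta> (Suc t))"
    by (simp add: add_divide_distrib right_diff_distrib)
  also have "?P * (1 / \<eta> (Suc t) - 1 / \<eta> t) \<le> real CARD('m) * comparator_bound * (1 / \<eta> (Suc t) - 1 / \<eta> t)"
  proof (rule mult_right_mono)
    show "?P \<le> real CARD('m) * comparator_bound"
      unfolding comparator_bound_def using card_transversal_le[of t] t
      by (intro potential_le mix_feasible mix_ge x ln_ge_one) auto
    show "0 \<le> 1 / \<eta> (Suc t) - 1 / \<eta> t" using \<eta> by (simp add: frac_le)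
  qed
  finally show ?thesis by simp
qed

definition regret :: "nat \<Rightarrow> (nat \<Rightarrow> 'm \<Rightarrow> 'n) \<Rightarrow> real" where
  "regret t acts = (\<Sum>s=1..t. curv_ratio c * f s (Astar s) - f s (\<Union>i. {acts s i}))"

lemma regret_Suc:
  "regret (Suc t) (acts(Suc t := a))
    = regret t acts + (curv_ratio c * f (Suc t) (Astar (Suc t)) - f (Suc t) (\<Union>i. {a i}))"
  by (simp add: regret_def)

lemma expected_regret_potential:
  assumes "t \<le> T"
  shows "measure_pmf.expectation (run t)
      (\<lambda>(acts, x). regret t acts + potential (Astar (Suc t)) (mix x) / \<eta> (Suc t))
    \<le> real CARD('m) * comparator_bound / \<eta> (Suc t)
      + (\<Sum>s<t. round_error s)
      + comparator_bound * (\<Sum>s=1..t. card (sym_diff (Astar (s+1)) (Astar s)) / \<eta> (s+1))"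
  using assms
proof (induction t)
  case 0
  have "potential (Astar 1) (mix (x_init V)) \<le> real CARD('m) * comparator_bound"
    unfolding comparator_bound_def
    by (intro potential_le mix_feasible mix_ge x_init_feasible ln_ge_one card_transversal_le) auto
  moreover have "0 < \<eta> 1" using \<eta>_pos[of 1] by simp
  ultimately show ?case by (simp add: regret_def divide_right_mono)
next
  case (Suc t)
  let ?t = "Suc t" and ?q = "\<lambda>x. gradients (Suc t) x"
  let ?C = "real CARD('m) * comparator_bound * (1 / \<eta> (Suc ?t) - 1 / \<eta> ?t)
      + comparator_bound * (card (sym_diff (Astar (Suc ?t)) (Astar ?t)) / \<eta> (Suc ?t))"
  let ?F = "\<lambda>(acts, x). regret ?t acts + potential (Astar (Suc ?t)) (mix x) / \<eta> (Suc ?t)"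
  let ?H = "\<lambda>(acts, x). regret t acts + potential (Astar ?t) (mix x) / \<eta> ?t + (round_error t + ?C)"
  let ?next = "\<lambda>(acts, x). bind_pmf (actions x) (\<lambda>a. bind_pmf (?q x) (\<lambda>g. return_pmf (acts(?t := a), advance ?t x g)))"
  have t: "?t \<in> {1..T}" using Suc.prems by simp
  have run: "run ?t = bind_pmf (run t) ?next" by (simp add: advance_def)
  have int: "integrable (measure_pmf p) u" if "finite (set_pmf p)" for p :: "'b pmf" and u :: "'b \<Rightarrow> real"
    by (rule integrable_measure_pmf_finite[OF that])
  have fin: "finite (set_pmf (?next z))" for z
    by (cases z) (simp add: finite_gradients)
  have "measure_pmf.expectation (run ?t) ?F = measure_pmf.expectation (run t) (\<lambda>z. measure_pmf.expectation (?next z) ?F)"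
    unfolding run by (rule expectation_bind_finite[OF finite_run fin])
  also have "\<dots> \<le> measure_pmf.expectation (run t) ?H"
  proof (rule expectation_mono_finite[OF finite_run])
    fix z assume "z \<in> set_pmf (run t)"
    moreover obtain acts x where z: "z = (acts, x)" by (cases z)
    ultimately have inv: "\<And>i. x i \<in> feasible V" "\<And>i. 0 < (\<Sum>a\<in>V i. x i $ a)" "disagreement x \<le> disagreement_bound t"
      using run_invariant[of t acts x] Suc.prems by auto
    define r where "r = regret t acts + curv_ratio c * f ?t (Astar ?t)"
    define P where "P = (\<lambda>g. potential (Astar ?t) (mix (advance ?t x g)) / \<eta> ?t)"
    have "measure_pmf.expectation (?next z) ?F
        = measure_pmf.expectation (actions x) (\<lambda>a. measure_pmf.expectation (?q x) (\<lambda>g. ?F (acts(?t := a), advance ?t x g)))"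
      unfolding z prod.case by (simp add: expectation_bind_finite finite_gradients)
    also have "\<dots> \<le> measure_pmf.expectation (actions x) (\<lambda>a. measure_pmf.expectation (?q x)
        (\<lambda>g. (r - f ?t (\<Union>i. {a i}) + ?C) + P g))"
    proof (intro expectation_mono_finite finite_gradients)
      fix a g assume "g \<in> set_pmf (?q x)"
      from potential_change[of _ "advance ?t x g", OF t advance_feasible[of _ x, OF t inv(1) this]]
      show "?F (acts(?t := a), advance ?t x g) \<le> (r - f ?t (\<Union>i. {a i}) + ?C) + P g"
        unfolding prod.case regret_Suc r_def P_def by linarith
    qed simp
    \<comment> \<open>Given the vectors, the potential depends on the gradients alone and the payoff
      on the actions alone, so the two expectations separate.\<close>
    also have "\<dots> = measure_pmf.expectation (actions x) (\<lambda>a. (r + ?C + measure_pmf.expectation (?q x) P) - f ?t (\<Union>i. {a i}))"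
      by (subst Bochner_Integration.integral_add) (auto simp: int finite_gradients algebra_simps)
    also have "\<dots> = r + ?C + measure_pmf.expectation (?q x) P - measure_pmf.expectation (actions x) (\<lambda>a. f ?t (\<Union>i. {a i}))"
      by (subst Bochner_Integration.integral_diff) (auto simp: int)
    also have "\<dots> \<le> ?H z"
      using expected_round[of _ x, OF t inv] unfolding z prod.case r_def P_def by linarith
    finally show "measure_pmf.expectation (?next z) ?F \<le> ?H z" .
  qed
  also have "\<dots> = measure_pmf.expectation (run t) (\<lambda>(acts, x). regret t acts + potential (Astar ?t) (mix x) / \<eta> ?t)
      + (round_error t + ?C)"
    unfolding case_prod_beta by (subst Bochner_Integration.integral_add) (auto simp: int finite_run)
  also have "\<dots> \<le> real CARD('m) * comparator_bound / \<eta> ?t + (\<Sum>s<t. round_error s)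
      + comparator_bound * (\<Sum>s=1..t. card (sym_diff (Astar (s+1)) (Astar s)) / \<eta> (s+1)) + (round_error t + ?C)"
    using Suc.IH Suc.prems by (intro add_right_mono) auto
  also have "\<dots> = real CARD('m) * comparator_bound / \<eta> (Suc ?t) + (\<Sum>s<?t. round_error s)
      + comparator_bound * (\<Sum>s=1..?t. card (sym_diff (Astar (s+1)) (Astar s)) / \<eta> (s+1))"
    by (simp add: right_diff_distrib distrib_left)
  finally show ?case .
qed

lemma expected_regret:
  "measure_pmf.expectation (run T) (\<lambda>(acts, x). regret T acts)
    \<le> real CARD('m) * comparator_bound / \<eta> (T+1)
      + (\<Sum>s<T. round_error s)
      + comparator_bound * (\<Sum>s=1..T. card (sym_diff (Astar (s+1)) (Astar s)) / \<eta> (s+1))"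
proof -
  have "measure_pmf.expectation (run T) (\<lambda>(acts, x). regret T acts) \<le> measure_pmf.expectation (run T)
      (\<lambda>(acts, x). regret T acts + potential (Astar (Suc T)) (mix x) / \<eta> (Suc T))"
  proof (rule expectation_mono_finite[OF finite_run])
    fix z assume "z \<in> set_pmf (run T)"
    then show "(case z of (acts, x) \<Rightarrow> regret T acts)
        \<le> (case z of (acts, x) \<Rightarrow> regret T acts + potential (Astar (Suc T)) (mix x) / \<eta> (Suc T))"
      using run_invariant[of T] \<eta>_pos[of "Suc T"]
      by (auto intro!: divide_nonneg_pos potential_nonneg mix_pos split: prod.split)
  qed
  with expected_regret_potential[of T] show ?thesis by simp
qed

end

section \<open>Summing the errors\<close>

lemma sum_powers_reversed: "(\<Sum>\<tau>=1..t. b ^ (t - \<tau>)) = (\<Sum>s<t. b ^ s)" for b :: real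
  by (rule sum.reindex_bij_witness[of _ "\<lambda>s. t - s" "\<lambda>\<tau>. t - \<tau>"]) auto

text \<open>The inner sums are partial sums of a nonincreasing sequence, hence concave in t, so
  their average is at least half the last one. This trades a geometric sum without step sizes for
  the double sum of the bound.\<close>

lemma geometric_double_sum:
  fixes b :: real
  assumes "0 \<le> b" "b \<le> 1"
  shows "real T / 2 * (\<Sum>s<T. b ^ s) \<le> (\<Sum>t=1..T. \<Sum>\<tau>=1..t. b ^ (t - \<tau>))"
proof (induction T)
  case (Suc T)
  have "(\<Sum>s<T. b ^ T) \<le> (\<Sum>s<T. b ^ s)"
    using assms by (intro sum_mono power_decreasing) auto
  then have "real T * b ^ T \<le> (\<Sum>s<T. b ^ s)" by simp
  moreover have "0 \<le> b ^ T" using assms by simp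
  moreover have "real (Suc T) / 2 * (\<Sum>s<Suc T. b ^ s)
      = real T / 2 * (\<Sum>s<T. b ^ s) + (\<Sum>s<T. b ^ s) / 2 + real T * b ^ T / 2 + b ^ T / 2"
    by (simp add: field_simps)
  moreover have "(\<Sum>t=1..Suc T. \<Sum>\<tau>=1..t. b ^ (t - \<tau>))
      = (\<Sum>t=1..T. \<Sum>\<tau>=1..t. b ^ (t - \<tau>)) + ((\<Sum>s<T. b ^ s) + b ^ T)"
    using sum_powers_reversed[of b "Suc T"] by (simp del: sum.cl_ivl_Suc add: sum.nat_ivl_Suc')
  ultimately show ?case using Suc.IH by linarith
qed simp

lemma minus_ln_one_minus_le:
  fixes \<gamma> :: real
  assumes "0 \<le> \<gamma>" "\<gamma> \<le> 1 / 32"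
  shows "- ln (1 - \<gamma>) \<le> 32 / 31 * \<gamma>"
proof -
  have "- ln (1 - \<gamma>) = ln (1 / (1 - \<gamma>))" using assms by (simp add: ln_div)
  also have "\<dots> \<le> 1 / (1 - \<gamma>) - 1" using assms by (intro ln_le_minus_one) auto
  also have "\<dots> = \<gamma> / (1 - \<gamma>)" using assms by (simp add: field_simps)
  also have "\<dots> \<le> \<gamma> / (31 / 32)" using assms by (intro divide_left_mono) auto
  finally show ?thesis by simp
qed

context ma_osea_run
begin

definition step_sum :: "nat \<Rightarrow> real" where
  "step_sum t = (\<Sum>\<tau>=1..t. (\<beta> - \<beta> * \<gamma>) ^ (t - \<tau>) * \<eta> \<tau>)"

lemma step_sum_Suc: "step_sum (Suc t) = (\<beta> - \<beta> * \<gamma>) * step_sum t + \<eta> (Suc t)"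
proof -
  have "step_sum (Suc t) = (\<Sum>\<tau>=1..t. (\<beta> - \<beta> * \<gamma>) ^ (Suc t - \<tau>) * \<eta> \<tau>) + \<eta> (Suc t)"
    unfolding step_sum_def by simp
  also have "(\<Sum>\<tau>=1..t. (\<beta> - \<beta> * \<gamma>) ^ (Suc t - \<tau>) * \<eta> \<tau>) = (\<beta> - \<beta> * \<gamma>) * step_sum t"
    unfolding step_sum_def sum_distrib_left by (rule sum.cong) (auto simp: Suc_diff_le mult.assoc)
  finally show ?thesis .
qed

lemma disagreement_bound_eq:
  "disagreement_bound t = real CARD('m) * (\<beta> - \<beta> * \<gamma>) ^ t + real CARD('m) * G * step_sum t"
proof (induction t)
  case 0
  show ?case by (simp add: step_sum_def)
next
  case (Suc t)
  then show ?case by (simp add: step_sum_Suc algebra_simps)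
qed

lemma \<beta>_mix_le_one: "\<beta> - \<beta> * \<gamma> \<le> 1"
  using \<beta>_le_one \<beta>_nonneg \<gamma>_pos by (simp add: add_increasing2 algebra_simps)

lemma step_sum_nonneg: "t \<le> T \<Longrightarrow> 0 \<le> step_sum t"
  unfolding step_sum_def using \<beta>_mix_nonneg \<eta>_pos by (intro sum_nonneg mult_nonneg_nonneg) (auto intro: less_imp_le)

lemma \<eta>_last_le:
  assumes "t \<in> {1..T}"
  shows "\<eta> (T+1) \<le> \<eta> t"
proof -
  have "t \<le> s \<Longrightarrow> s \<le> T+1 \<Longrightarrow> \<eta> s \<le> \<eta> t" for s
  proof (induction s rule: dec_induct)
    case (step s)
    then show ?case using \<eta>_antimono[of s] assms by auto
  qed simp
  then show ?thesis using assms by simp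
qed

text \<open>The initial disagreement contributes a geometric sum without a step size. It is absorbed
  because the assumption on \<open>\<eta> (T+1)\<close> bounds all step sizes from below.\<close>

lemma sum_round_error_le:
  assumes \<gamma>: "\<gamma> \<le> 1 / 32" and KG: "K \<le> G" and ln4: "4 \<le> ln (real CARD('n) / \<gamma>)"
    and last: "real CARD('m) * ln (real CARD('n) / \<gamma>) \<le> G * real T * \<eta> (T+1)"
  shows "(\<Sum>s<T. round_error s)
    \<le> (4 * G\<^sup>2 + K * l1_diameter (feasible V) * G) * (real CARD('m) * sqrt (real CARD('m))) * (\<Sum>t=1..T. step_sum t)
      + (\<Sum>t=1..T. 2 * (real CARD('m))\<^sup>2 * \<gamma> / \<eta> t)"
proof -
  define N D S where "N = real CARD('m)" and "D = l1_diameter (feasible V)" and "S = (\<Sum>t=1..T. step_sum t)"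
  define b where "b = \<beta> - \<beta> * \<gamma>"
  define B where "B = (\<Sum>s<T. b ^ s)"
  define M where "M = N\<^sup>2 * (- ln (1 - \<gamma>)) + N * \<gamma>"
  have N: "2 \<le> N" using N_ge_2 by (simp add: N_def)
  have D: "0 \<le> D" "D \<le> 2 * N" using l1_diameter_nonneg l1_diameter_le by (auto simp: D_def N_def)
  have b: "0 \<le> b" "b \<le> 1" using \<beta>_mix_nonneg \<beta>_mix_le_one by (auto simp: b_def)
  have B0: "0 \<le> B" using b by (auto simp: B_def intro: sum_nonneg)
  have S0: "0 \<le> S" unfolding S_def by (intro sum_nonneg step_sum_nonneg) auto
  have G: "0 \<le> G" by (rule G_nonneg)
  have M: "M + \<gamma> \<le> 2 * N\<^sup>2 * \<gamma>"
  proof -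
    \<comment> \<open>In units of \<open>p\<close> the three contributions are at most 32/31, 1/2
      and 1/4, as N \<ge> 2; their sum stays below the 2 of \<open>C3\<close>.\<close>
    define p where "p = N\<^sup>2 * \<gamma>"
    have "N\<^sup>2 * (- ln (1 - \<gamma>)) \<le> N\<^sup>2 * (32 / 31 * \<gamma>)"
      using minus_ln_one_minus_le[OF _ \<gamma>] \<gamma>_pos by (intro mult_left_mono) auto
    then have "N\<^sup>2 * (- ln (1 - \<gamma>)) \<le> 32 / 31 * p" by (simp add: p_def)
    moreover have "2 * N * \<gamma> \<le> N\<^sup>2 * \<gamma>" "2 * 2 * \<gamma> \<le> N\<^sup>2 * \<gamma>"
      using N \<gamma>_pos mult_mono[OF N N] by (auto intro!: mult_right_mono simp: power2_eq_square)
    moreover have "0 \<le> p" using \<gamma>_pos by (simp add: p_def)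
    moreover have "2 * N\<^sup>2 * \<gamma> = 2 * p" by (simp add: p_def)
    ultimately show ?thesis unfolding M_def p_def[symmetric] by linarith
  qed
  have one: "round_error s \<le> 2 * N\<^sup>2 * \<gamma> / \<eta> (Suc s) + (N + 1) * G\<^sup>2 * step_sum (Suc s)
      + (2 * N * G\<^sup>2 + sqrt 2 * K * D * N * G) * step_sum s + (2 * N * G + sqrt 2 * K * D * N) * b ^ s"
    if s: "s < T" for s
  proof -
    define h where "h = \<eta> (Suc s)"
    have h: "0 < h" using \<eta>_pos[of "Suc s"] s by (simp add: h_def)
    \<comment> \<open>A term G \<gamma> arises in every round. The square gives G \<le> 1 / h + G^2
      h, which distributes it over the drift \<gamma> / h and the step sums.\<close>
    have "0 \<le> (G * h - 1)\<^sup>2 / h" using h by simp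
    also have "\<dots> = G\<^sup>2 * h - 2 * G + 1 / h"
      using h by (simp add: field_simps power2_eq_square)
    finally have "\<gamma> * G \<le> \<gamma> * (1 / h + G\<^sup>2 * h)"
      using \<gamma>_pos G by (intro mult_left_mono) auto
    also have "\<dots> \<le> \<gamma> / h + 1 * (G\<^sup>2 * h)"
      unfolding distrib_left using \<gamma>_less h by (intro add_mono mult_right_mono) auto
    finally have "G * \<gamma> \<le> \<gamma> / h + G\<^sup>2 * h" by (simp add: mult.commute)
    moreover have "M / h + \<gamma> / h \<le> 2 * N\<^sup>2 * \<gamma> / h"
      using M h unfolding add_divide_distrib[symmetric] by (intro divide_right_mono) auto
    moreover have "(N + 1) * G\<^sup>2 * h \<le> (N + 1) * G\<^sup>2 * step_sum (Suc s)"
      using N b step_sum_nonneg[of s] s unfolding step_sum_Suc b_def[symmetric] h_def[symmetric]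
      by (intro mult_left_mono) auto
    moreover have "round_error s = N * h * G\<^sup>2 + M / h + G * \<gamma>
        + (2 * N * G\<^sup>2 + sqrt 2 * K * D * N * G) * step_sum s + (2 * N * G + sqrt 2 * K * D * N) * b ^ s"
      unfolding round_error_def disagreement_bound_eq
      unfolding N_def[symmetric] D_def[symmetric] M_def[symmetric] b_def[symmetric] h_def[symmetric]
      by (simp add: algebra_simps power2_eq_square)
    ultimately show ?thesis unfolding h_def[symmetric] by (simp add: algebra_simps)
  qed
  have sum_shift: "(\<Sum>s<T. u (Suc s)) = (\<Sum>t=1..T. u t)" for u :: "nat \<Rightarrow> real"
    by (rule sum.reindex_bij_witness[of _ "\<lambda>t. t - 1" Suc]) auto
  have step_sum_0: "step_sum 0 = 0" by (simp add: step_sum_def)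
  have "(\<Sum>s<T. step_sum s) \<le> S"
  proof -
    \<comment> \<open>Disagreement lags one round behind the steps; adding the term at
      \<open>T\<close> and using \<open>step_sum_0\<close> recovers \<open>S\<close>.\<close>
    have "(\<Sum>s<T. step_sum s) \<le> (\<Sum>s\<le>T. step_sum s)"
      by (intro sum_mono2) (auto intro: step_sum_nonneg)
    also have "\<dots> = S" by (simp add: S_def sum.atMost_shift step_sum_0 sum_shift)
    finally show ?thesis .
  qed
  then have shifted: "(2 * N * G\<^sup>2 + sqrt 2 * K * D * N * G) * (\<Sum>s<T. step_sum s)
      \<le> (2 * N * G\<^sup>2 + sqrt 2 * K * D * N * G) * S"
    using N D K_nonneg G by (intro mult_left_mono) auto
  have "(\<Sum>s<T. round_error s) \<le> (\<Sum>s<T. 2 * N\<^sup>2 * \<gamma> / \<eta> (Suc s) + (N + 1) * G\<^sup>2 * step_sum (Suc s)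
      + (2 * N * G\<^sup>2 + sqrt 2 * K * D * N * G) * step_sum s + (2 * N * G + sqrt 2 * K * D * N) * b ^ s)"
    using one by (intro sum_mono) auto
  also have "\<dots> = (\<Sum>s<T. 2 * N\<^sup>2 * \<gamma> / \<eta> (Suc s)) + (N + 1) * G\<^sup>2 * (\<Sum>s<T. step_sum (Suc s))
      + (2 * N * G\<^sup>2 + sqrt 2 * K * D * N * G) * (\<Sum>s<T. step_sum s) + (2 * N * G + sqrt 2 * K * D * N) * B"
    by (simp only: sum.distrib sum_distrib_left[symmetric] B_def)
  also have "\<dots> \<le> (\<Sum>t=1..T. 2 * N\<^sup>2 * \<gamma> / \<eta> t) + (N + 1) * G\<^sup>2 * S
      + (2 * N * G\<^sup>2 + sqrt 2 * K * D * N * G) * S + (2 * N * G + sqrt 2 * K * D * N) * B"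
    using shifted unfolding sum_shift[of "\<lambda>t. 2 * N\<^sup>2 * \<gamma> / \<eta> t"] sum_shift[of step_sum] S_def by linarith
  finally have total: "(\<Sum>s<T. round_error s) \<le> (\<Sum>t=1..T. 2 * N\<^sup>2 * \<gamma> / \<eta> t) + (N + 1) * G\<^sup>2 * S
      + (2 * N * G\<^sup>2 + sqrt 2 * K * D * N * G) * S + (2 * N * G + sqrt 2 * K * D * N) * B" .
  have sqrt2: "sqrt 2 \<le> 3 / 2" by (rule real_le_lsqrt) (auto simp: power2_eq_square)
  have initial: "(2 * N * G + sqrt 2 * K * D * N) * B \<le> 2 * N * G\<^sup>2 * S"
  proof -
    \<comment> \<open>With sqrt 2 \<le> 3/2, the bounds K \<le> G and D \<le> 2 N give 3 N^2 G, and
      the other summand is at most N^2 G. This is where the reduced Lipschitz constant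
      enters.\<close>
    have "sqrt 2 * K * D * N \<le> 3 / 2 * G * (2 * N) * N"
      using sqrt2 KG K_nonneg D N G by (intro mult_mono) auto
    moreover have "2 * N * G \<le> N * N * G"
      using N G by (intro mult_right_mono) auto
    ultimately have "2 * N * G + sqrt 2 * K * D * N \<le> 4 * N * N * G"
      by (simp add: algebra_simps)
    then have "(2 * N * G + sqrt 2 * K * D * N) * B \<le> 4 * N * N * G * B"
      by (rule mult_right_mono[OF _ B0])
    \<comment> \<open>T B / 2 is below the double sum of powers, and every step size is at least
      \<eta> at time T + 1. Then \<open>last\<close> and \<open>ln4\<close> together supply 4 N
      \<le> G T \<eta>, which pays for the missing step size.\<close>
    moreover have "2 * N * G * B \<le> G\<^sup>2 * S"
    proof -
      have "\<eta> (T+1) * (real T / 2 * B) \<le> \<eta> (T+1) * (\<Sum>t=1..T. \<Sum>\<tau>=1..t. b ^ (t - \<tau>))"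
        unfolding B_def using \<eta>_pos[of "T+1"] by (intro mult_left_mono geometric_double_sum b) auto
      also have "\<dots> = (\<Sum>t=1..T. \<Sum>\<tau>=1..t. b ^ (t - \<tau>) * \<eta> (T+1))"
        by (simp add: sum_distrib_left mult.commute)
      also have "\<dots> \<le> S"
        unfolding S_def step_sum_def b_def[symmetric]
        using b by (intro sum_mono mult_left_mono \<eta>_last_le) auto
      finally have le: "\<eta> (T+1) * (real T / 2 * B) \<le> S" .
      have "N * 4 \<le> N * ln (real CARD('n) / \<gamma>)" using N ln4 by (intro mult_left_mono) auto
      then have "N * 4 \<le> G * real T * \<eta> (T+1)" using last unfolding N_def by linarith
      then have "N * 4 * (G * B / 2) \<le> G * real T * \<eta> (T+1) * (G * B / 2)"
        using G B0 by (intro mult_right_mono) auto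
      also have "\<dots> = G\<^sup>2 * (\<eta> (T+1) * (real T / 2 * B))"
        by (simp add: power2_eq_square)
      also have "\<dots> \<le> G\<^sup>2 * S" using le by (rule mult_left_mono) simp
      finally show ?thesis by (simp add: mult_ac)
    qed
    then have "(2 * N) * (2 * N * G * B) \<le> (2 * N) * (G\<^sup>2 * S)"
      using N by (intro mult_left_mono) auto
    moreover have "4 * N * N * G * B = (2 * N) * (2 * N * G * B)" "(2 * N) * (G\<^sup>2 * S) = 2 * N * G\<^sup>2 * S"
      by simp_all
    ultimately show ?thesis by linarith
  qed
  have sqrtN: "sqrt 2 \<le> sqrt N" using N by simp
  \<comment> \<open>N + 1 stems from the step and the G \<gamma> terms, 2 N from the gain at mixed
    vectors, 2 N from the initial disagreement. It suffices that sqrt N \<ge> 7/5: then 4 N sqrt N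
    \<ge> 28/5 N \<ge> 5 N + 1.\<close>
  have "(N + 1) * G\<^sup>2 * S + 2 * N * G\<^sup>2 * S + 2 * N * G\<^sup>2 * S \<le> 4 * (N * sqrt N) * G\<^sup>2 * S"
  proof -
    have "7 / 5 \<le> sqrt 2" by (rule real_le_rsqrt) (simp add: power2_eq_square)
    then have "7 / 5 \<le> sqrt N" using sqrtN by (rule order_trans)
    then have "N * (7 / 5) \<le> N * sqrt N" using N by (intro mult_left_mono) auto
    then have "5 * N + 1 \<le> 4 * (N * sqrt N)" using N by linarith
    then have "(5 * N + 1) * (G\<^sup>2 * S) \<le> (4 * (N * sqrt N)) * (G\<^sup>2 * S)"
      using S0 by (intro mult_right_mono) auto
    then show ?thesis by (simp add: algebra_simps)
  qed
  moreover have "sqrt 2 * (K * D * N * G * S) \<le> sqrt N * (K * D * N * G * S)"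
    using sqrtN K_nonneg D N G S0 by (intro mult_right_mono) auto
  ultimately have "(\<Sum>s<T. round_error s) \<le> (4 * G\<^sup>2 + K * D * G) * (N * sqrt N) * S
      + (\<Sum>t=1..T. 2 * N\<^sup>2 * \<gamma> / \<eta> t)"
    using total initial by (simp add: algebra_simps)
  then show ?thesis by (simp add: N_def D_def S_def)
qed

end

section \<open>The regret bound\<close>

lemma expectation_le_const_pmf:
  fixes h :: "'a \<Rightarrow> real"
  assumes "finite (set_pmf p)" "\<And>x. x \<in> set_pmf p \<Longrightarrow> h x \<le> r"
  shows "measure_pmf.expectation p h \<le> r"
  using expectation_mono_finite[of p h "\<lambda>_. r"] assms by simp

text \<open>The unbiasedness assumption at \<open>x = 0\<close> turns the second moment bound into a bound on the
  singleton values, hence into an almost sure bound on the stochastic gradients.\<close>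

lemma singleton_le_of_second_moment:
  assumes "monotone_submodular f" and "0 \<le> G"
    and unbiased: "measure_pmf.expectation (stoch_grad_pmf c f 0) (\<lambda>g. g) = surrogate_grad c f 0"
    and bounded: "measure_pmf.expectation (stoch_grad_pmf c f 0) (\<lambda>g. (infnorm g)\<^sup>2) \<le> G\<^sup>2"
  shows "curv_ratio c * f {a} \<le> G"
proof -
  let ?p = "stoch_grad_pmf c f 0"
  let ?E = "measure_pmf.expectation ?p"
  have int: "integrable (measure_pmf ?p) h" for h :: "_ \<Rightarrow> real"
    by (rule integrable_measure_pmf_finite[OF finite_stoch_grad])
  have "?E (\<lambda>g. g $ a) = ?E (\<lambda>g. g) $ a"
    by (intro integral_bounded_linear bounded_linear_vec_nth integrable_measure_pmf_finite finite_stoch_grad)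
  also have "\<dots> = curv_ratio c * f {a}"
    unfolding unbiased by (rule monotone_submodular.surrogate_grad_at_zero[OF assms(1)])
  finally have mean: "?E (\<lambda>g. g $ a) = curv_ratio c * f {a}" .
  have "0 \<le> measure_pmf.variance ?p (\<lambda>g. g $ a)" by simp
  also have "\<dots> = ?E (\<lambda>g. (g $ a)\<^sup>2) - (?E (\<lambda>g. g $ a))\<^sup>2"
    by (intro measure_pmf.variance_eq int)
  finally have "(?E (\<lambda>g. g $ a))\<^sup>2 \<le> ?E (\<lambda>g. (g $ a)\<^sup>2)" by simp
  also have "\<dots> \<le> ?E (\<lambda>g. (infnorm g)\<^sup>2)"
  proof (rule expectation_mono_finite[OF finite_stoch_grad])
    fix g :: "real^'a"
    have "\<bar>g $ a\<bar> \<le> \<bar>infnorm g\<bar>"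
      using component_le_infnorm_cart[of g a] by linarith
    then show "(g $ a)\<^sup>2 \<le> (infnorm g)\<^sup>2" by (simp only: abs_le_square_iff)
  qed
  also have "\<dots> \<le> G\<^sup>2" by (rule bounded)
  finally show ?thesis unfolding mean by (rule power2_le_imp_le) fact
qed

text \<open>Subadditivity bounds \<alpha> f of the comparator by at most N singleton values, each at
  most G after scaling. The vectors do not enter, so the estimate holds for every \<gamma>,
  including 1.\<close>

lemma (in action_blocks) expected_regret_trivial:
  assumes f: "\<And>t. t \<in> {1..T} \<Longrightarrow> monotone_submodular (f t)"
    and A: "\<And>t i. t \<in> {1..T} \<Longrightarrow> card (A t \<inter> V i) \<le> 1"
    and le: "\<And>t a. t \<in> {1..T} \<Longrightarrow> curv_ratio c * f t {a} \<le> G" and G: "0 \<le> G"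
  shows "measure_pmf.expectation (ma_osea nbr W V f c \<gamma> \<eta> T)
      (\<lambda>(acts, x). \<Sum>t=1..T. curv_ratio c * f t (A t) - f t (\<Union>i. {acts t i}))
    \<le> (\<Sum>t=1..T. real CARD('m) * G)"
proof (rule expectation_le_const_pmf[OF finite_run])
  have "curv_ratio c * f t (A t) - f t B \<le> real CARD('m) * G" if t: "t \<in> {1..T}" for t B
  proof -
    interpret monotone_submodular "f t" by (rule f[OF t])
    have "curv_ratio c * f t (A t) \<le> curv_ratio c * (\<Sum>a\<in>A t. f t {a})"
      by (intro mult_left_mono le_sum_singletons curv_ratio_nonneg)
    also have "\<dots> \<le> (\<Sum>a\<in>A t. G)"
      unfolding sum_distrib_left by (intro sum_mono le t)
    also have "\<dots> \<le> real CARD('m) * G"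
      using card_transversal[OF A[OF t]] G by (simp add: mult_right_mono)
    finally show ?thesis using nonneg[of B] by linarith
  qed
  then have "(\<Sum>t=1..T. curv_ratio c * f t (A t) - f t (B t)) \<le> (\<Sum>t=1..T. real CARD('m) * G)" for B
    by (rule sum_mono)
  then show "(case z of (acts, x) \<Rightarrow> \<Sum>t=1..T. curv_ratio c * f t (A t) - f t (\<Union>i. {acts t i}))
      \<le> (\<Sum>t=1..T. real CARD('m) * G)" for z
    by (cases z) simp
qed

text \<open>AM-GM: the two terms on the right have a product independent of \<open>h\<close>. The 32
  in the threshold is chosen so that, with equality there, twice the root of the product is exactly
  N G.\<close>

lemma large_mixing_round:
  fixes N G \<gamma> h :: real
  assumes N: "0 < N" and h: "0 < h" and \<gamma>: "1 / (32 * (N * sqrt N)) \<le> \<gamma>"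
  shows "N * G \<le> 4 * G\<^sup>2 * (N * sqrt N) * h + 2 * N\<^sup>2 * \<gamma> / h"
proof -
  define r where "r = sqrt N"
  have r: "0 < r" "N = r\<^sup>2" using N by (auto simp: r_def)
  have "2 * N\<^sup>2 * (1 / (32 * (N * r))) / h \<le> 2 * N\<^sup>2 * \<gamma> / h"
    using \<gamma> h by (intro divide_right_mono mult_left_mono) (auto simp: r_def)
  also have "2 * N\<^sup>2 * (1 / (32 * (N * r))) / h = r / (16 * h)"
    using r h by (simp add: field_simps power2_eq_square)
  finally have 1: "r / (16 * h) \<le> 2 * N\<^sup>2 * \<gamma> / h" .
  have "0 \<le> r / (16 * h) * (8 * G * r * h - 1)\<^sup>2" using r h by simp
  also have "\<dots> = 4 * G\<^sup>2 * (N * r) * h + r / (16 * h) - N * G"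
    using r h by (simp add: field_simps power2_eq_square)
  finally show ?thesis using 1 by (simp add: r_def)
qed

theorem theorem5:
  fixes nbr :: "'m::finite \<Rightarrow> 'm \<Rightarrow> bool"
    and W :: "real^'m^'m"
    and V :: "'m \<Rightarrow> 'n::finite set"
    and f :: "nat \<Rightarrow> 'n set \<Rightarrow> real"
    and Astar :: "nat \<Rightarrow> 'n set"
    and T :: nat
    and \<eta> :: "nat \<Rightarrow> real"
    and c \<gamma> G L :: real
  assumes agents: "CARD('m) \<ge> 2"
    and action_sets: "\<forall>i. V i \<noteq> {}" "disjoint_family V" "(\<Union>i. V i) = UNIV"
    and set_functions: "\<forall>t\<in>{1..T+1}. (\<forall>S. f t S \<ge> 0) \<and> f t {} = 0 \<and>
          monotone_set_fun (f t) \<and> submodular (f t) \<and> curvature (f t) = c"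
    and maximizers: "\<forall>t\<in>{1..T+1}.
          is_arg_max (f t) (\<lambda>A. \<forall>i. card (A \<inter> V i) \<le> 1) (Astar t)"
    and mixing: "0 < \<gamma>" "\<gamma> \<le> 1"
    and step_sizes: "\<forall>t\<in>{1..T+1}. \<eta> t > 0" "\<forall>t\<in>{1..T}. \<eta> (t+1) \<le> \<eta> t"
    and A1: "strongly_convex_on {0..1} entropy_gen" "continuous_on {0..1} entropy_gen"
          "\<forall>u\<in>{0<..1}. entropy_gen differentiable (at u)"
    and A2_graph: "symp nbr" "\<forall>i j. nbr\<^sup>*\<^sup>* i j"
    and A2_support: "\<forall>i j. \<not> nbr i j \<and> j \<noteq> i \<longrightarrow> W $ i $ j = 0"
    and A2_weights: "transpose W = W" "doubly_stochastic W" "\<forall>i. W $ i $ i > 0"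
    and A3: "\<forall>(x :: real^'n) (y :: 'm \<Rightarrow> real^'n) w.
          x \<in> unit_cube \<and> (\<forall>i. y i \<in> unit_cube \<and> (\<forall>a. y i $ a > 0)) \<and>
          (\<forall>i. w i \<ge> 0) \<and> (\<Sum>i\<in>UNIV. w i) = 1 \<longrightarrow>
          bregman entropy_map x (\<Sum>i\<in>UNIV. w i *\<^sub>R y i)
            \<le> (\<Sum>i\<in>UNIV. w i * bregman entropy_map x (y i))"
    and G_nonneg: "G \<ge> 0"
    and A5_unbiased: "\<forall>t\<in>{1..T}. \<forall>x\<in>unit_cube.
          measure_pmf.expectation (stoch_grad_pmf c (f t) x) (\<lambda>g. g) = surrogate_grad c (f t) x"
    and A5_bounded: "\<forall>t\<in>{1..T}. \<forall>x\<in>unit_cube.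
          measure_pmf.expectation (stoch_grad_pmf c (f t) x) (\<lambda>g. (infnorm g)\<^sup>2) \<le> G\<^sup>2"
    and A5_Lipschitz: "\<forall>t\<in>{1..T}. \<forall>x\<in>unit_cube. \<forall>y\<in>unit_cube.
          infnorm (surrogate_grad c (f t) x - surrogate_grad c (f t) y) \<le> L * l1norm (x - y)"
  shows "let N = real CARD('m); n = real CARD('n);
             \<alpha> = curv_ratio c;
             \<beta> = mixing_rate W;
             D = l1_diameter (feasible V);
             C1 = (4 * G\<^sup>2 + L * D * G) * N powr (3/2);
             C2 = N * ln (n / \<gamma>);
             C3 = 2 * N\<^sup>2 * \<gamma>
         in measure_pmf.expectation (ma_osea nbr W V f c \<gamma> \<eta> T)
              (\<lambda>(acts, x). \<alpha> * (\<Sum>t=1..T. f t (Astar t)) - (\<Sum>t=1..T. f t (\<Union>i. {acts t i})))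
            \<le> C1 * (\<Sum>t=1..T. \<Sum>\<tau>=1..t. (\<beta> - \<beta> * \<gamma>) ^ (t - \<tau>) * \<eta> \<tau>)
              + N * C2 / \<eta> (T+1)
              + C2 * (\<Sum>t=1..T. real (card (sym_diff (Astar (t+1)) (Astar t))) / \<eta> (t+1))
              + N * G / 2 * (\<Sum>t=1..T. \<eta> t)
              + (\<Sum>t=1..T. C3 / \<eta> t)
              + G * D * \<gamma>"
proof -
  define N n D l S where "N = real CARD('m)" and "n = real CARD('n)" and "D = l1_diameter (feasible V)"
    and "l = ln (n / \<gamma>)"
    and "S = (\<Sum>t=1..T. \<Sum>\<tau>=1..t. (mixing_rate W - mixing_rate W * \<gamma>) ^ (t - \<tau>) * \<eta> \<tau>)"
  define P where "P = (\<Sum>t=1..T. real (card (sym_diff (Astar (t+1)) (Astar t))) / \<eta> (t+1))"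
  define reg where "reg = measure_pmf.expectation (ma_osea nbr W V f c \<gamma> \<eta> T)
      (\<lambda>(acts, x). \<Sum>t=1..T. curv_ratio c * f t (Astar t) - f t (\<Union>i. {acts t i}))"
  interpret action_blocks V
    using action_sets by unfold_locales auto
  have f: "monotone_submodular (f t)" "curvature (f t) = c" if "t \<in> {1..T+1}" for t
    using set_functions that by (auto simp: monotone_submodular_def)
  have A: "card (Astar t \<inter> V i) \<le> 1" if "t \<in> {1..T+1}" for t i
    using maximizers that by (auto simp: is_arg_max_def)
  have \<eta>: "0 < \<eta> t" if "t \<in> {1..T+1}" for t using step_sizes that by auto
  have zero: "(0 :: real^'n) \<in> unit_cube" by (simp add: unit_cube_def)
  have single: "curv_ratio c * f t {a} \<le> G" if "t \<in> {1..T}" for t a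
    using that zero A5_unbiased A5_bounded f
    by (intro singleton_le_of_second_moment G_nonneg) auto
  have N: "2 \<le> N" using agents by (simp add: N_def)
  have D: "0 \<le> D" by (simp add: D_def l1_diameter_nonneg)
  have Nn: "N \<le> n"
  proof -
    have "(\<Sum>i\<in>(UNIV::'m set). 1) \<le> (\<Sum>i\<in>UNIV. \<Sum>a\<in>V i. 1::nat)"
      using action_sets(1) by (intro sum_mono) (simp add: Suc_le_eq card_gt_0_iff)
    then show ?thesis using sum_blocks[of "\<lambda>_ _. 1::nat"] by (simp add: N_def n_def)
  qed
  have l0: "0 \<le> l" using Nn N mixing by (simp add: l_def)
  have P0: "0 \<le> P" unfolding P_def
  proof (rule sum_nonneg)
    fix t assume "t \<in> {1..T}"
    then show "0 \<le> real (card (sym_diff (Astar (t+1)) (Astar t))) / \<eta> (t+1)"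
      using \<eta>[of "t+1"] by simp
  qed
  define b where "b = mixing_rate W - mixing_rate W * \<gamma>"
  have b0: "0 \<le> b" using mixing by (simp add: b_def mixing_rate_def mult_left_le)
  have \<eta>S: "(\<Sum>t=1..T. \<eta> t) \<le> S"
    unfolding S_def b_def[symmetric]
  proof (rule sum_mono)
    fix t assume t: "t \<in> {1..T}"
    have "b ^ (t - t) * \<eta> t \<le> (\<Sum>\<tau>=1..t. b ^ (t - \<tau>) * \<eta> \<tau>)"
      by (rule member_le_sum[of t "{1..t}" "\<lambda>\<tau>. b ^ (t - \<tau>) * \<eta> \<tau>"])
         (use t b0 in \<open>auto intro!: mult_nonneg_nonneg less_imp_le[OF \<eta>]\<close>)
    then show "\<eta> t \<le> (\<Sum>\<tau>=1..t. b ^ (t - \<tau>) * \<eta> \<tau>)" by simp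
  qed
  have \<eta>0: "0 \<le> (\<Sum>t=1..T. \<eta> t)" using \<eta> by (intro sum_nonneg) (auto intro: less_imp_le)
  have S0: "0 \<le> S" using \<eta>0 \<eta>S by linarith
  have L0: "0 \<le> L" if "T \<noteq> 0"
  proof -
    have "axis (undefined :: 'n) (1::real) \<in> unit_cube" by (simp add: unit_cube_def axis_def)
    moreover have "l1norm (axis (undefined :: 'n) (1::real) - 0) = 1"
      by (simp add: l1norm_def axis_def if_distrib cong: if_cong)
    ultimately have "infnorm (surrogate_grad c (f 1) (axis (undefined :: 'n) 1) - surrogate_grad c (f 1) 0) \<le> L"
      using A5_Lipschitz[rule_format, of 1 "axis (undefined :: 'n) 1" 0] zero that by auto
    then show ?thesis using infnorm_pos_le order_trans by blast
  qed
  \<comment> \<open>For T = 0 the Lipschitz hypothesis is vacuous and \<open>L\<close> may be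
    negative. Then \<open>S\<close> is 0 as well, so \<open>K = 0\<close> still gives
    \<open>KL\<close>.\<close>
  define K where "K = (if T = 0 then 0 else min L G)"
  have K0: "0 \<le> K" using L0 G_nonneg by (auto simp: K_def)
  have KG: "K \<le> G" using G_nonneg by (simp add: K_def)
  have KL: "K * (D * G * (N * sqrt N) * S) \<le> L * (D * G * (N * sqrt N) * S)"
  proof (cases "T = 0")
    case True
    then have "S = 0" by (simp add: S_def)
    then show ?thesis by simp
  next
    case False
    then show ?thesis
      using D G_nonneg N S0 by (intro mult_right_mono) (auto simp: K_def)
  qed
  have Lip: "\<bar>surrogate_grad c (f t) x $ a - surrogate_grad c (f t) y $ a\<bar> \<le> K * l1norm (x - y)"
    if t: "t \<in> {1..T}" and x: "x \<in> unit_cube" and y: "y \<in> unit_cube" for t x y a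
  proof -
    let ?d = "\<bar>surrogate_grad c (f t) x $ a - surrogate_grad c (f t) y $ a\<bar>"
    have l1: "0 \<le> l1norm (x - y)" by (simp add: l1norm_def sum_nonneg)
    have "?d \<le> curv_ratio c * f t {a} * l1norm (x - y)"
      using t f by (intro monotone_submodular.surrogate_grad_Lipschitz x y) auto
    also have "\<dots> \<le> G * l1norm (x - y)" by (intro mult_right_mono single t l1)
    finally have "?d \<le> G * l1norm (x - y)" .
    moreover have "?d \<le> L * l1norm (x - y)"
      using component_le_infnorm_cart[of "surrogate_grad c (f t) x - surrogate_grad c (f t) y" a]
        A5_Lipschitz[rule_format, OF t x y] by simp
    ultimately show ?thesis using t by (simp add: K_def min_def)
  qed
  have main: "reg \<le> (4 * G\<^sup>2 + L * D * G) * (N * sqrt N) * S + N * (N * l) / \<eta> (T+1) + N * l * P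
      + (\<Sum>t=1..T. 2 * N\<^sup>2 * \<gamma> / \<eta> t)"
  proof -
    let ?Z = "(4 * G\<^sup>2 + K * D * G) * (N * sqrt N) * S + (\<Sum>t=1..T. 2 * N\<^sup>2 * \<gamma> / \<eta> t)"
    have last: "0 \<le> N * (N * l) / \<eta> (T+1)" using N l0 \<eta>[of "T+1"] by simp
    have path: "0 \<le> N * l * P" using N l0 P0 by simp
    have drift: "0 \<le> (\<Sum>t=1..T. 2 * N\<^sup>2 * \<gamma> / \<eta> t)"
    proof (rule sum_nonneg)
      fix t assume "t \<in> {1..T}"
      then show "0 \<le> 2 * N\<^sup>2 * \<gamma> / \<eta> t" using mixing \<eta>[of t] by simp
    qed
    have extra: "0 \<le> K * D * G * (N * sqrt N) * S" using K0 D G_nonneg N S0 by simp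
    have trivial: "reg \<le> (\<Sum>t=1..T. N * G)"
      unfolding reg_def N_def using f A single G_nonneg by (intro expected_regret_trivial) auto
    \<comment> \<open>The first case contains \<gamma> = 1, so the locale's \<gamma> < 1 holds in
      the third. The trivial bound is paid by the \<open>C1\<close> and \<open>C3\<close> terms in
      the first case and by the \<open>C2\<close> term at time T + 1 in the second.\<close>
    consider (mixing) "1 / (32 * (N * sqrt N)) \<le> \<gamma>" | (short) "G * real T \<le> N * l / \<eta> (T+1)"
      | (main) "\<gamma> < 1 / (32 * (N * sqrt N))" "N * l / \<eta> (T+1) < G * real T"
      by linarith
    then have "reg \<le> ?Z + N * (N * l) / \<eta> (T+1) + N * l * P"
    proof cases
      case mixing
      have "(\<Sum>t=1..T. N * G) \<le> (\<Sum>t=1..T. 4 * G\<^sup>2 * (N * sqrt N) * \<eta> t + 2 * N\<^sup>2 * \<gamma> / \<eta> t)"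
        using N mixing \<eta> by (intro sum_mono large_mixing_round) auto
      also have "\<dots> = 4 * G\<^sup>2 * (N * sqrt N) * (\<Sum>t=1..T. \<eta> t) + (\<Sum>t=1..T. 2 * N\<^sup>2 * \<gamma> / \<eta> t)"
        by (simp only: sum.distrib sum_distrib_left)
      also have "4 * G\<^sup>2 * (N * sqrt N) * (\<Sum>t=1..T. \<eta> t) \<le> 4 * G\<^sup>2 * (N * sqrt N) * S"
        using \<eta>S N by (intro mult_left_mono) auto
      also have "\<dots> + (\<Sum>t=1..T. 2 * N\<^sup>2 * \<gamma> / \<eta> t) \<le> ?Z"
        using extra by (simp add: distrib_right)
      finally show ?thesis using trivial last path by linarith
    next
      case short
      have "(\<Sum>t=1..T. N * G) = N * (G * real T)" by simp
      also have "\<dots> \<le> N * (N * l / \<eta> (T+1))" using short N by (intro mult_left_mono) auto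
      finally have "reg \<le> N * (N * l) / \<eta> (T+1)" using trivial by simp
      moreover have "0 \<le> 4 * G\<^sup>2 * (N * sqrt N) * S" using N S0 by simp
      ultimately show ?thesis using extra drift path unfolding distrib_right by linarith
    next
      case main
      have rN: "1 \<le> sqrt N" using N by simp
      have "2 * 1 \<le> N * sqrt N" using N rN by (intro mult_mono) auto
      then have "1 / (32 * (N * sqrt N)) \<le> 1 / 64" by (intro divide_left_mono) auto
      then have \<gamma>64: "\<gamma> < 1 / 64" using main(1) by linarith
      have l4: "4 \<le> l"
      proof -
        \<comment> \<open>exp 4 \<le> 81 < 128 < 2 / \<gamma> \<le> n / \<gamma>; the value 4 is the
          one \<open>sum_round_error_le\<close> asks for.\<close>
        have "exp (4::real) = exp 1 ^ 4" by (simp flip: exp_of_nat_mult)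
        also have "\<dots> \<le> 3 ^ 4" by (intro power_mono exp_le) auto
        also have "\<dots> \<le> 2 / \<gamma>" using \<gamma>64 mixing by (simp add: field_simps)
        also have "\<dots> \<le> n / \<gamma>" using N Nn mixing by (intro divide_right_mono) auto
        finally have "exp 4 \<le> n / \<gamma>" .
        then show ?thesis unfolding l_def
          using N Nn mixing by (subst ln_ge_iff) auto
      qed
      interpret ma_osea_run V nbr W \<gamma> f Astar T \<eta> c G K
      proof unfold_locales
        show "2 \<le> CARD('m)" by (rule agents)
        show "1 \<le> ln (real CARD('n) / \<gamma>)" using l4 by (simp add: l_def n_def)
        show "\<gamma> < 1" using \<gamma>64 by simp
      qed (use A2_weights A2_support mixing set_functions A \<eta> step_sizes A5_unbiased single K0 Lip G_nonneg in auto)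
      have reg: "reg = measure_pmf.expectation (run T) (\<lambda>(acts, x). regret T acts)"
        by (simp only: reg_def regret_def)
      have S: "S = (\<Sum>t=1..T. step_sum t)" by (simp only: S_def step_sum_def)
      have "N * l \<le> G * real T * \<eta> (T+1)"
        using main(2) \<eta>[of "T+1"] by (simp add: pos_divide_less_eq)
      then have "(\<Sum>s<T. round_error s) \<le> ?Z"
        using \<gamma>64 KG l4 unfolding S N_def D_def l_def n_def by (intro sum_round_error_le) auto
      with expected_regret show ?thesis
        unfolding reg P_def N_def l_def n_def comparator_bound_def by linarith
    qed
    with KL show ?thesis by (simp add: algebra_simps)
  qed
  have eta_term: "0 \<le> N * G / 2 * (\<Sum>t=1..T. \<eta> t)" using N G_nonneg \<eta>0 by simp
  have mixing_term: "0 \<le> G * D * \<gamma>" using G_nonneg D mixing by simp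
  have powr: "N powr (3/2) = N * sqrt N"
    using N powr_add[of N 1 "1/2"] by (simp add: powr_half_sqrt)
  have regret: "measure_pmf.expectation (ma_osea nbr W V f c \<gamma> \<eta> T)
      (\<lambda>(acts, x). curv_ratio c * (\<Sum>t=1..T. f t (Astar t)) - (\<Sum>t=1..T. f t (\<Union>i. {acts t i}))) = reg"
    unfolding reg_def by (simp add: sum_subtractf sum_distrib_left)
  show ?thesis
    using main eta_term mixing_term
    unfolding Let_def N_def[symmetric] n_def[symmetric] D_def[symmetric] S_def[symmetric]
      l_def[symmetric] P_def[symmetric] powr regret by linarith
qed

end
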